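(* Let $K$ be a field and let a finitely generated $K$-algebra $A$ be a domain with $0<\mathrm{GK}(A)<\infty$. Suppose that $C$ is a commutative finitely generated subalgebra of $A$ with field of fractions $Q$ such that $\mathrm{GK}(A)-\mathrm{GK}(C)=h_{A\otimes_K Q}$, the holonomic number of the $Q$-algebra $A\otimes_K Q$. Then $A\otimes_CQ$ is a simple holonomic module over the $Q$-algebra $A\otimes_K Q$ (i.e. it is simple and $\mathrm{GK}_Q({}_{A\otimes Q}\,A\otimes_CQ)=h_{A\otimes_K Q}$).
   Context: Algebras are associative with $1$; modules are left modules. For $f:\mathbb{N}\to\mathbb{N}$ put $\gamma(f):=\inf\{r\in\mathbb{R}\mid f(i)\leq i^r \text{ for } i\gg 0\}\in[0,\infty]$. For a finitely generated algebra $R=k\langle a_1,\ldots,a_s\rangle$ over a field $k$ let $R_0=k$, $R_1=k+\sum_jka_j$, $R_i=R_1^i$; $\mathrm{GK}_k(R)=\gamma(i\mapsto\dim_kR_i)$, and for a finitely generated $R$-module $M=RM_0$ with $M_0$ a finite dimensional generating subspace, $\mathrm{GK}_k(M)=\gamma(i\mapsto\dim_kR_iM_0)$; these are independent of the choices. $\mathrm{GK}=\mathrm{GK}_K$. The holonomic number of a finitely generated $k$-algebra $R$ is $h_R:=\inf\{\mathrm{GK}_k(M)\mid M\text{ a nonzero finitely generated }R\text{-module}\}$. A nonzero finitely generated $R$-module $M$ is holonomic if $\mathrm{GK}_k(M)=h_R$. For the $Q$-algebra $A\otimes_K Q$ these notions are taken over $k=Q$. The space $A\otimes_CQ$ ($A$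 viewed as a right $C$-module) is an $A\otimes_KQ$-module with $A$ acting by left multiplication on the first factor and $Q$ by multiplication on the second. *)

theory Defs
  imports
    "HOL-Library.Extended_Real"
    "HOL-Algebra.QuotRing"
    "HOL-Algebra.Subrings"
    "HOL-Algebra.Free_Abelian_Groups"
    "Jordan_Normal_Form.Missing_VectorSpace"
begin

text \<open>The name \<open>submodule\<close> is overloaded.  \<open>Module.submodule N R M\<close>, used below for left modules,
  does not presuppose a commutative base ring; \<open>VectorSpace.subspace K W V\<close> presupposes that
  \<open>V\<close> is a vector space over the field \<open>K\<close>.\<close>

section \<open>Associative algebras and left modules\<close>

text \<open>An algebra is stored in a \<open>module\<close> record: ring operations together with the scalar
  multiplication of \<open>K\<close>.  The locale \<open>algebra\<close> of the library is restricted to commutative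
  algebras, and \<open>module\<close> to commutative base rings.\<close>

locale assoc_algebra = vectorspace K A + A: ring A
    for K :: "'k ring" and A :: "('k, 'a) module" (structure) +
  assumes smult_mult_left:
      "\<lbrakk>c \<in> carrier K; x \<in> carrier A; y \<in> carrier A\<rbrakk> \<Longrightarrow> (c \<odot> x) \<otimes> y = c \<odot> (x \<otimes> y)"
    and smult_mult_right:
      "\<lbrakk>c \<in> carrier K; x \<in> carrier A; y \<in> carrier A\<rbrakk> \<Longrightarrow> x \<otimes> (c \<odot> y) = c \<odot> (x \<otimes> y)"

locale left_module = R: ring R + M: abelian_group M
    for R :: "('r, 'n) ring_scheme" and M :: "('r, 'm) module" (structure) +
  assumes smult_closed:
      "\<lbrakk>a \<in> carrier R; x \<in> carrier M\<rbrakk> \<Longrightarrow> a \<odot> x \<in> carrier M"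
    and smult_l_distr:
      "\<lbrakk>a \<in> carrier R; b \<in> carrier R; x \<in> carrier M\<rbrakk> \<Longrightarrow> (a \<oplus>\<^bsub>R\<^esub> b) \<odot> x = a \<odot> x \<oplus> b \<odot> x"
    and smult_r_distr:
      "\<lbrakk>a \<in> carrier R; x \<in> carrier M; y \<in> carrier M\<rbrakk> \<Longrightarrow> a \<odot> (x \<oplus> y) = a \<odot> x \<oplus> a \<odot> y"
    and smult_assoc:
      "\<lbrakk>a \<in> carrier R; b \<in> carrier R; x \<in> carrier M\<rbrakk> \<Longrightarrow> (a \<otimes>\<^bsub>R\<^esub> b) \<odot> x = a \<odot> (b \<odot> x)"
    and smult_one: "x \<in> carrier M \<Longrightarrow> \<one>\<^bsub>R\<^esub> \<odot> x = x"

definition noncomm_domain :: "('a, 'm) ring_scheme \<Rightarrow> bool" where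
  "noncomm_domain A \<longleftrightarrow> ring A \<and> \<one>\<^bsub>A\<^esub> \<noteq> \<zero>\<^bsub>A\<^esub> \<and>
     (\<forall>x\<in>carrier A. \<forall>y\<in>carrier A. x \<otimes>\<^bsub>A\<^esub> y = \<zero>\<^bsub>A\<^esub> \<longrightarrow> x = \<zero>\<^bsub>A\<^esub> \<or> y = \<zero>\<^bsub>A\<^esub>)"

definition is_subalgebra :: "'k ring \<Rightarrow> ('k, 'a) module \<Rightarrow> 'a set \<Rightarrow> bool" where
  "is_subalgebra K A B \<longleftrightarrow> subring B A \<and> VectorSpace.subspace K B A"

definition algebra_generators :: "'k ring \<Rightarrow> ('k, 'a) module \<Rightarrow> 'a set \<Rightarrow> bool" where
  "algebra_generators K A S \<longleftrightarrow> S \<subseteq> carrier A \<and>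
     (\<forall>B. is_subalgebra K A B \<and> S \<subseteq> B \<longrightarrow> B = carrier A)"

definition fg_algebra :: "'k ring \<Rightarrow> ('k, 'a) module \<Rightarrow> bool" where
  "fg_algebra K A \<longleftrightarrow> (\<exists>S. finite S \<and> algebra_generators K A S)"

definition module_generators :: "('r, 'n) ring_scheme \<Rightarrow> ('r, 'm) module \<Rightarrow> 'm set \<Rightarrow> bool" where
  "module_generators R M G \<longleftrightarrow> G \<subseteq> carrier M \<and>
     (\<forall>N. Module.submodule N R M \<and> G \<subseteq> N \<longrightarrow> N = carrier M)"

definition fg_module :: "('r, 'n) ring_scheme \<Rightarrow> ('r, 'm) module \<Rightarrow> bool" where
  "fg_module R M \<longleftrightarrow> (\<exists>G. finite G \<and> module_generators R M G)"

definition simple_module :: "('r, 'n) ring_scheme \<Rightarrow> ('r, 'm) module \<Rightarrow> bool" where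
  "simple_module R M \<longleftrightarrow> left_module R M \<and> carrier M \<noteq> {\<zero>\<^bsub>M\<^esub>} \<and>
     (\<forall>N. Module.submodule N R M \<longrightarrow> N = {\<zero>\<^bsub>M\<^esub>} \<or> N = carrier M)"

section \<open>Gelfand-Kirillov dimension and holonomic modules\<close>

text \<open>The value is \<open>\<infinity>\<close> if no exponent bounds \<open>f\<close>, and \<open>- \<infinity>\<close> only if \<open>f\<close> is eventually \<open>0\<close>, which
  does not happen for the dimension functions of nonzero algebras and modules.\<close>

definition growth_exponent :: "(nat \<Rightarrow> nat) \<Rightarrow> ereal" where
  "growth_exponent f =
     Inf {ereal r | r :: real. eventually (\<lambda>i. real (f i) \<le> real i powr r) sequentially}"

definition subspace_dim :: "'k ring \<Rightarrow> ('k, 'v) module \<Rightarrow> 'v set \<Rightarrow> nat" where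
  "subspace_dim K V W = vectorspace.dim K (V\<lparr>carrier := W\<rparr>)"

text \<open>For \<open>S = {a\<^sub>1, \<dots>, a\<^sub>s}\<close>: \<open>R\<^sub>0 = k\<close> and \<open>R\<^sub>i\<^sub>+\<^sub>1 = R\<^sub>i R\<^sub>1\<close> with \<open>R\<^sub>1 = k + \<Sum>\<^sub>j k a\<^sub>j\<close>, where the
  product of two subspaces is the span of all products.\<close>

primrec algebra_filtration :: "'k ring \<Rightarrow> ('k, 'a) module \<Rightarrow> 'a set \<Rightarrow> nat \<Rightarrow> 'a set" where
  "algebra_filtration K R S 0 = module.span K R {\<one>\<^bsub>R\<^esub>}"
| "algebra_filtration K R S (Suc i) =
     module.span K R {x \<otimes>\<^bsub>R\<^esub> y | x y.
       x \<in> algebra_filtration K R S i \<and> y \<in> module.span K R (insert \<one>\<^bsub>R\<^esub> S)}"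

text \<open>The dimensions do not depend on the generators, so they are computed from arbitrarily
  selected ones; they are meaningful only if the algebra (and module) is finitely generated.\<close>

definition chosen_generators :: "'k ring \<Rightarrow> ('k, 'a) module \<Rightarrow> 'a set" where
  "chosen_generators K R = (SOME S. finite S \<and> algebra_generators K R S)"

definition GK_algebra :: "'k ring \<Rightarrow> ('k, 'a) module \<Rightarrow> ereal" where
  "GK_algebra K R = growth_exponent
     (\<lambda>i. subspace_dim K R (algebra_filtration K R (chosen_generators K R) i))"

definition restrict_scalars ::
    "'k ring \<Rightarrow> ('k, 'r) module \<Rightarrow> ('r, 'm) module \<Rightarrow> ('k, 'm) module" where
  "restrict_scalars K R M = \<lparr>carrier = carrier M, monoid.mult = monoid.mult M,
     monoid.one = \<one>\<^bsub>M\<^esub>, ring.zero = \<zero>\<^bsub>M\<^esub>, ring.add = ring.add M,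
     smult = (\<lambda>c m. (c \<odot>\<^bsub>R\<^esub> \<one>\<^bsub>R\<^esub>) \<odot>\<^bsub>M\<^esub> m)\<rparr>"

definition generating_subspace ::
    "'k ring \<Rightarrow> ('k, 'r) module \<Rightarrow> ('r, 'm) module \<Rightarrow> 'm set \<Rightarrow> bool" where
  "generating_subspace K R M M0 \<longleftrightarrow>
     VectorSpace.subspace K M0 (restrict_scalars K R M) \<and>
     vectorspace.fin_dim K (restrict_scalars K R M\<lparr>carrier := M0\<rparr>) \<and>
     module_generators R M M0"

definition GK_module :: "'k ring \<Rightarrow> ('k, 'r) module \<Rightarrow> ('r, 'm) module \<Rightarrow> ereal" where
  "GK_module K R M =
     (let V = restrict_scalars K R M;
          S = chosen_generators K R;
          M0 = (SOME W. generating_subspace K R M W)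
      in growth_exponent (\<lambda>i. subspace_dim K V
           (module.span K V {r \<odot>\<^bsub>M\<^esub> m | r m. r \<in> algebra_filtration K R S i \<and> m \<in> M0})))"

text \<open>The infimum ranges over the modules with carrier in the type \<open>(nat \<Rightarrow> 'r) set\<close>.  Every
  finitely generated module is isomorphic to one of these: it is a quotient of some \<open>R\<^sup>n\<close>,
  whose elements are functions on the indices \<open>{..<n}\<close>, and the quotient consists of cosets,
  that is, of sets of such functions.\<close>

definition holonomic_number :: "'k ring \<Rightarrow> ('k, 'r) module \<Rightarrow> ereal" where
  "holonomic_number K R = Inf {GK_module K R M | M :: ('r, (nat \<Rightarrow> 'r) set) module.
     left_module R M \<and> fg_module R M \<and> carrier M \<noteq> {\<zero>\<^bsub>M\<^esub>}}"

definition holonomic :: "'k ring \<Rightarrow> ('k, 'r) module \<Rightarrow> ('r, 'm) module \<Rightarrow> bool" where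
  "holonomic K R M \<longleftrightarrow> left_module R M \<and> fg_module R M \<and> carrier M \<noteq> {\<zero>\<^bsub>M\<^esub>} \<and>
     GK_module K R M = holonomic_number K R"

section \<open>Field of fractions and tensor products\<close>

definition field_of_fractions ::
    "('a, 'm) ring_scheme \<Rightarrow> 'q ring \<Rightarrow> ('a \<Rightarrow> 'q) \<Rightarrow> bool" where
  "field_of_fractions D Q \<iota> \<longleftrightarrow> field Q \<and> \<iota> \<in> ring_hom D Q \<and> inj_on \<iota> (carrier D) \<and>
     (\<forall>q\<in>carrier Q. \<exists>c\<in>carrier D. \<exists>d\<in>carrier D - {\<zero>\<^bsub>D\<^esub>}. q = \<iota> c \<otimes>\<^bsub>Q\<^esub> inv\<^bsub>Q\<^esub> \<iota> d)"

text \<open>The free abelian group on \<open>A \<times> Q\<close>, with the biadditive multiplication given on generators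
  by \<open>(a, q) (a', q') = (a a', q q')\<close>.\<close>

definition pair_ring :: "('a, 'm) ring_scheme \<Rightarrow> 'q ring \<Rightarrow> ('a \<times> 'q \<Rightarrow>\<^sub>0 int) ring" where
  "pair_ring A Q =
     \<lparr>carrier = carrier (free_Abelian_group (carrier A \<times> carrier Q)),
      monoid.mult = (\<lambda>x y. frag_extend
        (\<lambda>(a, q). frag_extend (\<lambda>(a', q'). frag_of (a \<otimes>\<^bsub>A\<^esub> a', q \<otimes>\<^bsub>Q\<^esub> q')) y) x),
      monoid.one = frag_of (\<one>\<^bsub>A\<^esub>, \<one>\<^bsub>Q\<^esub>), ring.zero = 0, ring.add = (+)\<rparr>"

text \<open>The subgroup by which the free abelian group on \<open>A \<times> Q\<close> is divided in order to obtain the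
  tensor product over \<open>S\<close>, where \<open>S\<close> acts on \<open>A\<close> from the right by \<open>ract\<close> and on \<open>Q\<close> from the
  left by \<open>lact\<close>.\<close>

definition tensor_relations :: "('a, 'm) ring_scheme \<Rightarrow> 'q ring \<Rightarrow>
    's set \<Rightarrow> ('a \<Rightarrow> 's \<Rightarrow> 'a) \<Rightarrow> ('s \<Rightarrow> 'q \<Rightarrow> 'q) \<Rightarrow> ('a \<times> 'q \<Rightarrow>\<^sub>0 int) set" where
  "tensor_relations A Q S ract lact =
     generate (free_Abelian_group (carrier A \<times> carrier Q))
       ({frag_of (a \<oplus>\<^bsub>A\<^esub> a', q) - frag_of (a, q) - frag_of (a', q) | a a' q.
           a \<in> carrier A \<and> a' \<in> carrier A \<and> q \<in> carrier Q} \<union>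
        {frag_of (a, q \<oplus>\<^bsub>Q\<^esub> q') - frag_of (a, q) - frag_of (a, q') | a q q'.
           a \<in> carrier A \<and> q \<in> carrier Q \<and> q' \<in> carrier Q} \<union>
        {frag_of (ract a s, q) - frag_of (a, lact s q) | a s q.
           a \<in> carrier A \<and> s \<in> S \<and> q \<in> carrier Q})"

text \<open>\<open>K\<close> acts on \<open>Q\<close> through \<open>K \<rightarrow> C \<rightarrow> Q\<close>, as \<open>C\<close> is a subalgebra of \<open>A\<close>.\<close>

definition relations_K ::
    "'k ring \<Rightarrow> ('k, 'a) module \<Rightarrow> 'q ring \<Rightarrow> ('a \<Rightarrow> 'q) \<Rightarrow> ('a \<times> 'q \<Rightarrow>\<^sub>0 int) set" where
  "relations_K K A Q \<iota> = tensor_relations A Q (carrier K)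
     (\<lambda>a k. k \<odot>\<^bsub>A\<^esub> a) (\<lambda>k q. \<iota> (k \<odot>\<^bsub>A\<^esub> \<one>\<^bsub>A\<^esub>) \<otimes>\<^bsub>Q\<^esub> q)"

definition relations_C ::
    "('k, 'a) module \<Rightarrow> 'a set \<Rightarrow> 'q ring \<Rightarrow> ('a \<Rightarrow> 'q) \<Rightarrow> ('a \<times> 'q \<Rightarrow>\<^sub>0 int) set" where
  "relations_C A C Q \<iota> = tensor_relations A Q C
     (\<lambda>a c. a \<otimes>\<^bsub>A\<^esub> c) (\<lambda>c q. \<iota> c \<otimes>\<^bsub>Q\<^esub> q)"

text \<open>The \<open>Q\<close>-algebra \<open>A \<otimes>\<^sub>K Q\<close>: \<open>(a \<otimes> q) (a' \<otimes> q') = a a' \<otimes> q q'\<close>, with \<open>c \<in> Q\<close> acting as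
  multiplication by \<open>1 \<otimes> c\<close>.\<close>

definition tensor_algebra :: "'k ring \<Rightarrow> ('k, 'a) module \<Rightarrow> 'q ring \<Rightarrow> ('a \<Rightarrow> 'q) \<Rightarrow>
    ('q, ('a \<times> 'q \<Rightarrow>\<^sub>0 int) set) module" where
  "tensor_algebra K A Q \<iota> =
     (let F = pair_ring A Q; I = relations_K K A Q \<iota>; T = F Quot I in
      \<lparr>carrier = carrier T, monoid.mult = monoid.mult T, monoid.one = \<one>\<^bsub>T\<^esub>,
       ring.zero = \<zero>\<^bsub>T\<^esub>, ring.add = ring.add T,
       smult = (\<lambda>c X. (I +>\<^bsub>F\<^esub> frag_of (\<one>\<^bsub>A\<^esub>, c)) \<otimes>\<^bsub>T\<^esub> X)\<rparr>)"

text \<open>The \<open>A \<otimes>\<^sub>K Q\<close>-module \<open>A \<otimes>\<^sub>C Q\<close>: \<open>(a \<otimes> q) \<odot> (a' \<otimes> q') = a a' \<otimes> q q'\<close>.  The relations over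
  \<open>C\<close> form in general only a left ideal of \<open>pair_ring A Q\<close>, so only the additive structure of
  the quotient is used, and the fields \<open>mult\<close> and \<open>one\<close> of the record are meaningless.\<close>

definition tensor_module :: "('k, 'a) module \<Rightarrow> 'a set \<Rightarrow> 'q ring \<Rightarrow> ('a \<Rightarrow> 'q) \<Rightarrow>
    (('a \<times> 'q \<Rightarrow>\<^sub>0 int) set, ('a \<times> 'q \<Rightarrow>\<^sub>0 int) set) module" where
  "tensor_module A C Q \<iota> =
     (let F = pair_ring A Q; J = relations_C A C Q \<iota>; T = F Quot J in
      \<lparr>carrier = carrier T, monoid.mult = (\<lambda>_ _. \<zero>\<^bsub>T\<^esub>), monoid.one = \<zero>\<^bsub>T\<^esub>,
       ring.zero = \<zero>\<^bsub>T\<^esub>, ring.add = ring.add T,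
       smult = (\<lambda>X Y. \<Union>x\<in>X. \<Union>y\<in>Y. J +>\<^bsub>F\<^esub> (x \<otimes>\<^bsub>F\<^esub> y))\<rparr>)"

end

theory Submission
  imports Defs "HOL-Library.Multiset_Order" "HOL-Real_Asymp.Real_Asymp"
begin

text \<open>Write \<open>A\<^sub>i\<close>, \<open>C\<^sub>i\<close> for the filtrations of \<open>A\<close> and \<open>C\<close>.  Let \<open>M'\<close> be a quotient of \<open>A \<otimes>\<^sub>C Q\<close>,
  generated by the image \<open>e\<close> of \<open>1 \<otimes> 1\<close>, and choose \<open>a\<^sub>1, \<dots>, a\<^sub>d \<in> A\<^sub>i\<close> such that the \<open>a\<^sub>j e\<close> form a
  \<open>Q\<close>-basis of \<open>Q A\<^sub>i e\<close>.  The \<open>a\<^sub>j\<close> are right linearly independent over \<open>C\<close> modulo the left ideal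
  \<open>L = {a. a e = 0}\<close>, so \<open>W = \<Sum>\<^sub>j a\<^sub>j C\<^sub>i\<close> is a direct sum that meets \<open>L\<close> in \<open>0\<close>.  If \<open>0 \<noteq> u \<in> L\<close>, then
  \<open>W, W u, \<dots>, W u\<^sup>i\<close> are independent as well, because \<open>A\<close> is a domain.  All this happens in
  \<open>A\<^sub>q\<^sub>i\<close> for a fixed \<open>q\<close>, so \<open>d \<cdot> dim C\<^sub>i \<cdot> (i + 1)\<^sup>\<delta> \<le> dim A\<^sub>q\<^sub>i\<close> with \<open>\<delta> = 1\<close> if \<open>L \<noteq> 0\<close> and \<open>\<delta> = 0\<close>
  otherwise.  There is \<open>n \<ge> GK(C)\<close> with \<open>dim C\<^sub>i \<ge> c i\<^sup>n\<close>, whence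
  \<open>GK(M') \<le> GK(A) - n - \<delta> \<le> h - \<delta>\<close> for the holonomic number \<open>h\<close>.

  For \<open>M' = A \<otimes>\<^sub>C Q\<close> this shows that the module is holonomic.  A nonzero submodule \<open>N\<close> contains some
  \<open>u \<otimes> 1\<close> with \<open>u \<noteq> 0\<close>, by clearing denominators, so if it were proper, then
  \<open>(A \<otimes>\<^sub>C Q) / N\<close> would be a nonzero module of dimension at most \<open>h - 1\<close>.\<close>

section \<open>Dimensions of subspaces\<close>

text \<open>Gelfand-Kirillov dimension is a limsup of logarithmic growth, and such quantities cannot
  simply be subtracted: \<open>d * dim C_i <= dim A_qi\<close> says little about \<open>d\<close> at
  indices where \<open>dim C_i\<close> happens to be small. Hence the need for a lower bound
  \<open>c * i^n\<close> at every index, with an exponent that also bounds GK(C) from above.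
  Commutativity of C supplies it: C has a basis of standard monomials adapted to the filtration,
  their exponents form a downset, and the counting function of a downset lies between two multiples
  of one power \<open>i^n\<close>. This stands in for the Hilbert polynomial. The hypothesis on the
  holonomic number is used as h \<ge> GK(A) - n, which meets the estimate for M' from the other side
  and leaves no room for \<delta> = 1. The infimum h runs over modules whose carrier has one
  particular type, so the tensor module cannot be inserted directly. Its quotients are rebuilt in
  that type, and the quotient by 0 is compared with the module itself.\<close>

context vectorspace
begin

abbreviation sdim :: "'c set \<Rightarrow> nat" where
  "sdim W \<equiv> vectorspace.dim K (vs W)"

lemma subspace_iff_submodule: "VectorSpace.subspace K W V \<longleftrightarrow> LinearCombinations.submodule K W V"
  using vectorspace_axioms by (auto simp: VectorSpace.subspace_def)

lemma span_least:
  assumes "X \<subseteq> W" "VectorSpace.subspace K W V"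
  shows "span X \<subseteq> W"
  using assms span_is_subset subspace_iff_submodule by blast

lemma span_mono_span:
  assumes "X \<subseteq> span Y" "Y \<subseteq> carrier V"
  shows "span X \<subseteq> span Y"
  using assms span_least span_is_subspace by blast

lemma subspace_memD:
  assumes "VectorSpace.subspace K W V"
  shows "W \<subseteq> carrier V" "\<zero>\<^bsub>V\<^esub> \<in> W" "\<And>x y. x \<in> W \<Longrightarrow> y \<in> W \<Longrightarrow> x \<oplus>\<^bsub>V\<^esub> y \<in> W"
    "\<And>c x. c \<in> carrier K \<Longrightarrow> x \<in> W \<Longrightarrow> c \<odot>\<^bsub>V\<^esub> x \<in> W"
  using assms unfolding subspace_iff_submodule LinearCombinations.submodule_def by auto

lemma subspaceI:
  assumes "W \<subseteq> carrier V" "\<zero>\<^bsub>V\<^esub> \<in> W" "\<And>x y. x \<in> W \<Longrightarrow> y \<in> W \<Longrightarrow> x \<oplus>\<^bsub>V\<^esub> y \<in> W"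
    "\<And>c x. c \<in> carrier K \<Longrightarrow> x \<in> W \<Longrightarrow> c \<odot>\<^bsub>V\<^esub> x \<in> W"
  shows "VectorSpace.subspace K W V"
  using assms module_axioms unfolding subspace_iff_submodule LinearCombinations.submodule_def by auto

lemma subspace_span_eq:
  assumes "VectorSpace.subspace K W V"
  shows "span W = W"
  using assms span_least[OF subset_refl assms] in_own_span[OF subspace_memD(1)[OF assms]] by blast

lemma subspace_finsum_closed:
  assumes "VectorSpace.subspace K W V" "f \<in> I \<rightarrow> W"
  shows "finsum V f I \<in> W"
proof -
  have "f \<in> I \<rightarrow> carrier V"
    using assms subspace_memD(1) by blast
  then show ?thesis
    using assms(2)
  proof (induction I rule: infinite_finite_induct)
    case (insert i I)
    then show ?case
      using subspace_memD(3)[OF assms(1)] by (auto simp: finsum_insert Pi_def)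
  qed (use subspace_memD(2)[OF assms(1)] in auto)
qed

lemma card_le_of_subset_span:
  assumes "finite G" "G \<subseteq> carrier V" "B \<subseteq> span G" "lin_indpt B" "finite B"
  shows "card B \<le> card G"
  using replacement[OF assms(5,1,2,4,3)] by fastforce

lemma finite_lin_indpt_in_span:
  assumes "finite G" "G \<subseteq> carrier V" "B \<subseteq> span G" "lin_indpt B"
  shows "finite B \<and> card B \<le> card G"
proof (cases "finite B")
  case True
  then show ?thesis using card_le_of_subset_span assms by blast
next
  case False
  then obtain B' where B': "B' \<subseteq> B" "finite B'" "card B' = Suc (card G)"
    using infinite_arbitrarily_large by blast
  then have "card B' \<le> card G"
    using assms(1-3) subset_li_is_li[OF assms(4)] by (intro card_le_of_subset_span) auto
  then show ?thesis
    using B' by simp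
qed

lemma sdim_span_eq_card:
  assumes "finite B" "B \<subseteq> carrier V" "lin_indpt B"
  shows "sdim (span B) = card B"
proof -
  have sub: "VectorSpace.subspace K (span B) V"
    using span_is_subspace assms by blast
  interpret W: vectorspace K "vs (span B)"
    using subspace_is_vs[OF sub] .
  have "W.basis B"
    unfolding W.basis_def
    using span_li_not_depend[OF in_own_span[OF assms(2)] span_is_submodule[OF assms(2)]]
      assms in_own_span[OF assms(2)] by simp
  then show ?thesis
    using W.dim_basis[OF assms(1)] by blast
qed

text \<open>A maximal independent subset of \<open>X\<close> exists because Steinitz exchange bounds
  the size of all of them by \<open>card G\<close>. The point is \<open>B \<subseteq> X\<close>:
  later \<open>X\<close> is the image of a set under a map, and every basis vector must have a
  preimage in that set.\<close>

lemma obtain_basis_subset: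
  assumes "finite G" "G \<subseteq> carrier V" "X \<subseteq> span G"
  obtains B where "B \<subseteq> X" "finite B" "lin_indpt B" "span B = span X"
    "sdim (span X) = card B"
proof -
  define P where "P S \<longleftrightarrow> S \<subseteq> X \<and> lin_indpt S" for S
  have "P {}"
    unfolding P_def lin_dep_def by auto
  moreover have "\<And>S. P S \<Longrightarrow> finite S \<and> card S \<le> card G"
    unfolding P_def using finite_lin_indpt_in_span assms by blast
  ultimately obtain B where B: "finite B" "maximal B P"
    using maximal_exists by metis
  have X: "X \<subseteq> carrier V"
    using assms span_is_subset2 by blast
  have PB: "B \<subseteq> X" "lin_indpt B"
    using B by (auto simp: maximal_def P_def)
  have "x \<in> span B" if "x \<in> X" for x
  proof (rule ccontr)
    assume *: "x \<notin> span B"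
    then have "x \<notin> B"
      using in_own_span PB(1) X by blast
    then have "lin_indpt (B \<union> {x})"
      using lin_dep_iff_in_span[of B x] PB X that * by blast
    then have "P (B \<union> {x})"
      using PB that by (auto simp: P_def)
    then show False
      using B(2) \<open>x \<notin> B\<close> unfolding maximal_def by blast
  qed
  then have "span X \<subseteq> span B"
    using PB X by (intro span_mono_span) auto
  then have "span B = span X"
    using span_is_monotone[OF PB(1)] by blast
  then show ?thesis
    using that[of B] PB B X sdim_span_eq_card[of B] by auto
qed

lemma sdim_span_le_card:
  assumes "finite G" "G \<subseteq> carrier V"
  shows "sdim (span G) \<le> card G"
proof -
  obtain B where "B \<subseteq> G" "sdim (span G) = card B"
    using obtain_basis_subset[OF assms] in_own_span assms by metis
  then show ?thesis
    using card_mono assms by metis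
qed

lemma sdim_mono:
  assumes "finite G" "G \<subseteq> carrier V" "X \<subseteq> carrier V" "span X \<subseteq> span G"
  shows "sdim (span X) \<le> sdim (span G)"
proof -
  obtain B where B: "B \<subseteq> X" "lin_indpt B" "sdim (span X) = card B" "finite B"
    using obtain_basis_subset[OF assms(1,2)] in_own_span[OF assms(3)] assms(4)
    by (metis dual_order.trans)
  obtain B' where B': "B' \<subseteq> G" "span B' = span G" "sdim (span G) = card B'" "finite B'"
    using obtain_basis_subset[OF assms(1,2) in_own_span[OF assms(2)]] by metis
  have "B \<subseteq> span B'"
    using B B' assms in_own_span[OF assms(3)] by blast
  then show ?thesis
    using card_le_of_subset_span[of B' B] B B' assms by auto
qed

text \<open>Independence is asked of the indexed family and not of a set, so that index sets such as
  triples are counted directly. Injectivity of \<open>f\<close> comes out of the proof, since a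
  coincidence \<open>f i = f j\<close> is itself a relation, with coefficients 1 and -1.\<close>

lemma card_le_sdim:
  assumes "finite G" "G \<subseteq> carrier V" "finite I" "f \<in> I \<rightarrow> span G"
    and indep: "\<And>c i. \<lbrakk>c \<in> I \<rightarrow> carrier K; (\<Oplus>\<^bsub>V\<^esub>i\<in>I. c i \<odot>\<^bsub>V\<^esub> f i) = \<zero>\<^bsub>V\<^esub>; i \<in> I\<rbrakk> \<Longrightarrow> c i = \<zero>\<^bsub>K\<^esub>"
  shows "card I \<le> sdim (span G)"
proof -
  have f: "f \<in> I \<rightarrow> carrier V"
    using assms span_is_subset2 by blast
  have inj: "inj_on f I"
  proof (rule inj_onI, rule ccontr)
    fix i j assume ij: "i \<in> I" "j \<in> I" "f i = f j" "i \<noteq> j"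
    define c where "c l = (if l = i then \<one>\<^bsub>K\<^esub> else if l = j then \<ominus>\<^bsub>K\<^esub> \<one>\<^bsub>K\<^esub> else \<zero>\<^bsub>K\<^esub>)" for l
    define J where "J = I - {i, j}"
    have c: "c i = \<one>\<^bsub>K\<^esub>" "c j = \<ominus>\<^bsub>K\<^esub> \<one>\<^bsub>K\<^esub>" "\<And>l. l \<in> J \<Longrightarrow> c l = \<zero>\<^bsub>K\<^esub>" "\<And>l. c l \<in> carrier K"
      using ij by (auto simp: c_def J_def)
    have J: "I = insert i (insert j J)" "finite J" "i \<notin> insert j J" "j \<notin> J"
      using ij assms(3) by (auto simp: J_def)
    have fi: "f i \<in> carrier V" and cf: "\<And>l. l \<in> I \<Longrightarrow> c l \<odot>\<^bsub>V\<^esub> f l \<in> carrier V"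
      using f ij c(4) by (auto simp: Pi_iff)
    have "(\<Oplus>\<^bsub>V\<^esub>l\<in>J. c l \<odot>\<^bsub>V\<^esub> f l) = \<zero>\<^bsub>V\<^esub>"
      using f by (intro add.finprod_one_eqI) (auto simp: J(1) c(3) Pi_iff smult_l_null)
    moreover have "(\<Oplus>\<^bsub>V\<^esub>l\<in>I. c l \<odot>\<^bsub>V\<^esub> f l)
        = c i \<odot>\<^bsub>V\<^esub> f i \<oplus>\<^bsub>V\<^esub> (c j \<odot>\<^bsub>V\<^esub> f j \<oplus>\<^bsub>V\<^esub> (\<Oplus>\<^bsub>V\<^esub>l\<in>J. c l \<odot>\<^bsub>V\<^esub> f l))"
    proof -
      have "(\<Oplus>\<^bsub>V\<^esub>l\<in>insert j J. c l \<odot>\<^bsub>V\<^esub> f l) = c j \<odot>\<^bsub>V\<^esub> f j \<oplus>\<^bsub>V\<^esub> (\<Oplus>\<^bsub>V\<^esub>l\<in>J. c l \<odot>\<^bsub>V\<^esub> f l)"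
        by (rule finsum_insert[OF J(2,4)]) (use cf J(1) in auto)
      moreover have "(\<Oplus>\<^bsub>V\<^esub>l\<in>insert i (insert j J). c l \<odot>\<^bsub>V\<^esub> f l)
          = c i \<odot>\<^bsub>V\<^esub> f i \<oplus>\<^bsub>V\<^esub> (\<Oplus>\<^bsub>V\<^esub>l\<in>insert j J. c l \<odot>\<^bsub>V\<^esub> f l)"
        by (rule finsum_insert) (use cf J in auto)
      ultimately show ?thesis
        unfolding J(1) by metis
    qed
    ultimately have "(\<Oplus>\<^bsub>V\<^esub>l\<in>I. c l \<odot>\<^bsub>V\<^esub> f l) = f i \<oplus>\<^bsub>V\<^esub> (\<ominus>\<^bsub>V\<^esub> f i \<oplus>\<^bsub>V\<^esub> \<zero>\<^bsub>V\<^esub>)"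
      using fi ij(3) c(1,2) smult_minus_1 smult_one by metis
    also have "\<dots> = \<zero>\<^bsub>V\<^esub>"
      using fi by (simp add: M.r_neg)
    finally have "c i = \<zero>\<^bsub>K\<^esub>"
      using ij c(4) by (intro indep) auto
    then have "\<one>\<^bsub>K\<^esub> = \<zero>\<^bsub>K\<^esub>"
      using c(1) by simp
    then show False by simp
  qed
  have "lin_indpt (f ` I)"
  proof (rule finite_lin_indpt2)
    fix a assume a: "a \<in> f ` I \<rightarrow> carrier K" "lincomb a (f ` I) = \<zero>\<^bsub>V\<^esub>"
    have "(\<Oplus>\<^bsub>V\<^esub>i\<in>I. a (f i) \<odot>\<^bsub>V\<^esub> f i) = lincomb a (f ` I)"
      unfolding lincomb_def using f a inj by (subst finsum_reindex) (auto simp: Pi_def)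
    then have "\<And>i. i \<in> I \<Longrightarrow> a (f i) = \<zero>\<^bsub>K\<^esub>"
      using a by (intro indep[of "\<lambda>i. a (f i)"]) auto
    then show "\<forall>v\<in>f ` I. a v = \<zero>\<^bsub>K\<^esub>" by auto
  qed (use assms f in auto)
  moreover obtain B where B: "B \<subseteq> G" "span B = span G" "sdim (span G) = card B" "finite B"
    using obtain_basis_subset[OF assms(1,2) in_own_span[OF assms(2)]] by metis
  ultimately have "card (f ` I) \<le> card B"
    using assms by (intro card_le_of_subset_span) (auto simp: B(2))
  then show ?thesis
    using card_image[OF inj] B by simp
qed

lemma lin_indpt_finsumD:
  assumes "finite B" "B \<subseteq> carrier V" "lin_indpt B" "c \<in> B \<rightarrow> carrier K"
    "(\<Oplus>\<^bsub>V\<^esub>b\<in>B. c b \<odot>\<^bsub>V\<^esub> b) = \<zero>\<^bsub>V\<^esub>" "b \<in> B"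
  shows "c b = \<zero>\<^bsub>K\<^esub>"
  using lin_dep_crit[OF assms(1) subset_refl assms(4,6)] assms unfolding lincomb_def by blast

end

section \<open>Growth exponents\<close>

text \<open>The factor \<open>c\<close> is eventually below \<open>i powr e\<close> for every
  \<open>e > 0\<close>, so constants do not affect the exponent.\<close>

lemma growth_exponent_leI:
  assumes "\<forall>\<^sub>F i in sequentially. real (f i) \<le> c * real i powr r"
  shows "growth_exponent f \<le> ereal r"
proof (rule ereal_le_epsilon2)
  fix e :: real assume e: "0 < e"
  have "\<forall>\<^sub>F i in sequentially. c \<le> real i powr e"
    using e by real_asymp
  with assms have "\<forall>\<^sub>F i in sequentially. real (f i) \<le> real i powr (r + e)"
  proof eventually_elim
    case (elim i)
    have "c * real i powr r \<le> real i powr e * real i powr r"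
      using elim by (intro mult_right_mono) auto
    then show ?case
      using elim by (simp add: powr_add mult.commute)
  qed
  then have "growth_exponent f \<le> ereal (r + e)"
    unfolding growth_exponent_def by (intro Inf_lower) auto
  then show "growth_exponent f \<le> ereal r + ereal e"
    by simp
qed

text \<open>Insert \<open>p * i + q\<close> into \<open>g j \<le> j powr r\<close> and divide by
  \<open>c * i ^ m\<close>: the linear change of index costs only the constant
  \<open>(p + q) powr r\<close>. With \<open>m = 0\<close> this compares two filtrations; with
  \<open>m > 0\<close> it moves a known power of \<open>i\<close> to the other side.\<close>

lemma growth_exponent_add_le:
  assumes "0 < c" "0 < p"
    and le: "\<forall>\<^sub>F i in sequentially. real (f i) * (c * real i ^ m) \<le> real (g (p * i + q))"
  shows "growth_exponent f + ereal (real m) \<le> growth_exponent g"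
  unfolding growth_exponent_def[of g]
proof (rule Inf_greatest, clarify)
  fix r assume r: "\<forall>\<^sub>F i in sequentially. real (g i) \<le> real i powr r"
  have *: "filterlim (\<lambda>i. p * i + q) at_top sequentially"
    using assms(2) by (intro filterlim_at_top_mono[OF filterlim_ident]) (auto intro!: always_eventually trans_le_add1)
  have g: "\<forall>\<^sub>F i in sequentially. real (g (p * i + q)) \<le> real (p * i + q) powr r"
    using eventually_compose_filterlim[OF r *] .
  have "growth_exponent f \<le> ereal (r - real m)"
  \<comment> \<open>For negative \<open>r\<close> the function \<open>j powr r\<close> decreases, so
    the comparison with \<open>(p + q) * i\<close> goes the wrong way. But then the natural number
    \<open>g (p * i + q)\<close> is below 1, hence 0, and this forces
    \<open>f i = 0\<close>.\<close>
  proof (cases "r < 0")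
    case True
    have "\<forall>\<^sub>F i in sequentially. real (f i) \<le> 1 * real i powr (r - real m)"
      using g le eventually_gt_at_top[of 1]
    proof eventually_elim
      case (elim i)
      have "i \<le> p * i + q"
        using assms(2) by (simp add: trans_le_add1)
      then have "1 < real (p * i + q)"
        using elim by linarith
      then have "real (p * i + q) powr r < 1"
        using True powr_less_mono[of r 0 "real (p * i + q)"] by simp
      then have "g (p * i + q) = 0"
        using elim by linarith
      then have "real (f i) * (c * real i ^ m) \<le> 0"
        using elim by simp
      moreover have "0 < c * real i ^ m"
        using elim assms by simp
      ultimately have "real (f i) \<le> 0"
        by (meson linorder_not_less mult_pos_pos)
      then show ?case
        by (simp add: order_trans[OF _ powr_ge_zero])
    qed
    then show ?thesis by (rule growth_exponent_leI)
  next
    case False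
    have "\<forall>\<^sub>F i in sequentially. real (f i) \<le> (real (p + q) powr r / c) * real i powr (r - real m)"
      using g le eventually_gt_at_top[of 1]
    proof eventually_elim
      case (elim i)
      have "real (p * i + q) \<le> real (p + q) * real i"
        using elim mult_left_mono[of 1 "real i" "real q"] by (simp add: algebra_simps)
      then have "real (p * i + q) powr r \<le> (real (p + q) * real i) powr r"
        using False by (intro powr_mono2) auto
      also have "\<dots> = real (p + q) powr r * real i powr r"
        by (simp add: powr_mult)
      finally have "real (f i) * (c * real i ^ m) \<le> real (p + q) powr r * real i powr r"
        using elim by linarith
      then have "real (f i) \<le> real (p + q) powr r * real i powr r / (c * real i ^ m)"
        using elim assms by (simp add: pos_le_divide_eq)
      then show ?case
        using elim by (simp add: powr_diff powr_realpow)
    qed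
    then show ?thesis by (rule growth_exponent_leI)
  qed
  then have "growth_exponent f + ereal (real m) \<le> ereal (r - real m) + ereal (real m)"
    by (intro add_right_mono)
  then show "growth_exponent f + ereal (real m) \<le> ereal r"
    by simp
qed

section \<open>Filtrations of algebras\<close>

lemma (in vectorspace) span_induct [consumes 2, case_names zero add smult base]:
  assumes "x \<in> span X" "X \<subseteq> carrier V"
    and "P \<zero>\<^bsub>V\<^esub>"
    and "\<And>x y. \<lbrakk>x \<in> carrier V; y \<in> carrier V; P x; P y\<rbrakk> \<Longrightarrow> P (x \<oplus>\<^bsub>V\<^esub> y)"
    and "\<And>c x. \<lbrakk>c \<in> carrier K; x \<in> carrier V; P x\<rbrakk> \<Longrightarrow> P (c \<odot>\<^bsub>V\<^esub> x)"
    and "\<And>x. x \<in> X \<Longrightarrow> P x"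
  shows "P x"
proof -
  have "span X \<subseteq> {x \<in> carrier V. P x}"
    by (rule span_least) (use assms in \<open>auto intro!: subspaceI\<close>)
  then show ?thesis
    using assms(1) by blast
qed

context assoc_algebra
begin

text \<open>Bilinearity reduces the claim to the spanning sets, one factor at a time. Inclusions
  between products of subspaces are later checked on generators in this way.\<close>

lemma mult_mem_subspace:
  assumes "x \<in> span X" "y \<in> span Y" "X \<subseteq> carrier A" "Y \<subseteq> carrier A" "VectorSpace.subspace K W A"
    and XY: "\<And>x y. \<lbrakk>x \<in> X; y \<in> Y\<rbrakk> \<Longrightarrow> x \<otimes> y \<in> W"
  shows "x \<otimes> y \<in> W"
proof -
  note W = subspace_memD[OF assms(5)]
  have *: "x \<otimes> y \<in> W" if "x \<in> X" for x
    using assms(2,4)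
  proof (induction rule: span_induct)
    case zero
    then show ?case using that assms(3) W(2) by (auto simp: subset_iff)
  next
    case (add y z)
    moreover have "x \<in> carrier A" using that assms(3) by blast
    ultimately show ?case using W(3) by (simp add: A.r_distr)
  next
    case (smult c y)
    moreover have "x \<in> carrier A" using that assms(3) by blast
    ultimately show ?case using W(4) by (simp add: smult_mult_right)
  next
    case (base y)
    then show ?case using XY that by blast
  qed
  have y: "y \<in> carrier A"
    using assms(2,4) span_is_subset2 by blast
  from assms(1,3) show ?thesis
  proof (induction rule: span_induct)
    case zero
    then show ?case using y W(2) by simp
  next
    case (add u v)
    then show ?case using W(3) y by (simp add: A.l_distr)
  next
    case (smult c u)
    then show ?case using W(4) y by (simp add: smult_mult_left)
  next
    case (base u)
    then show ?case by (rule *)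
  qed
qed

abbreviation filt :: "'a set \<Rightarrow> nat \<Rightarrow> 'a set" where
  "filt S \<equiv> algebra_filtration K A S"

lemma span_insert_one_closed: "S \<subseteq> carrier A \<Longrightarrow> span (insert \<one> S) \<subseteq> carrier A"
  by (intro span_is_subset2) auto

lemma filt_subspace:
  assumes "S \<subseteq> carrier A"
  shows "VectorSpace.subspace K (filt S i) A"
proof (induction i)
  case 0
  then show ?case by (auto intro: span_is_subspace)
next
  case (Suc i)
  then show ?case
    using span_insert_one_closed[OF assms] subspace_memD(1)[OF Suc]
    by (auto intro!: span_is_subspace)
qed

lemma filt_closed:
  assumes "S \<subseteq> carrier A"
  shows "filt S i \<subseteq> carrier A"
  using filt_subspace[OF assms] by (rule subspace_memD(1))

lemma filt_SucI:
  assumes "S \<subseteq> carrier A" "x \<in> filt S i" "y \<in> span (insert \<one> S)"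
  shows "x \<otimes> y \<in> filt S (Suc i)"
proof -
  have "{x \<otimes> y | x y. x \<in> filt S i \<and> y \<in> span (insert \<one> S)} \<subseteq> carrier A"
    using filt_closed[OF assms(1)] span_insert_one_closed[OF assms(1)] by blast
  from in_own_span[OF this] show ?thesis
    using assms by auto
qed

lemma filt_mono:
  assumes "S \<subseteq> carrier A" "i \<le> j"
  shows "filt S i \<subseteq> filt S j"
  using assms(2)
proof (induction rule: dec_induct)
  case (step j)
  have "\<one> \<in> span (insert \<one> S)"
    using assms in_own_span[of "insert \<one> S"] by auto
  then have "filt S j \<subseteq> filt S (Suc j)"
    using filt_SucI[OF assms(1), of _ j \<one>] filt_closed[OF assms(1), of j] by fastforce
  then show ?case
    using step by blast
qed auto

lemma one_mem_filt:
  assumes "S \<subseteq> carrier A"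
  shows "\<one> \<in> filt S i"
proof -
  have "\<one> \<in> filt S 0"
    using in_own_span[of "{\<one>}"] by simp
  then show ?thesis
    using filt_mono[OF assms, of 0 i] by blast
qed

lemma filt_Suc_subset:
  assumes "S \<subseteq> carrier A" "VectorSpace.subspace K W A"
    and "\<And>x s. \<lbrakk>x \<in> filt S i; s \<in> insert \<one> S\<rbrakk> \<Longrightarrow> x \<otimes> s \<in> W"
  shows "filt S (Suc i) \<subseteq> W"
proof -
  have "x \<otimes> y \<in> W" if "x \<in> filt S i" "y \<in> span (insert \<one> S)" for x y
    using mult_mem_subspace[of x "filt S i" y "insert \<one> S" W] that assms
      filt_closed[OF assms(1)] subspace_span_eq[OF filt_subspace[OF assms(1), of i]] by auto
  then have "span {x \<otimes> y | x y. x \<in> filt S i \<and> y \<in> span (insert \<one> S)} \<subseteq> W"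
    by (intro span_least assms(2)) blast
  then show ?thesis by simp
qed

lemma generators_subset_filt:
  assumes "S \<subseteq> carrier A"
  shows "S \<subseteq> filt S 1"
proof
  fix s assume s: "s \<in> S"
  then have "s \<in> span (insert \<one> S)"
    using assms in_own_span[of "insert \<one> S"] by auto
  then have "\<one> \<otimes> s \<in> filt S (Suc 0)"
    using filt_SucI one_mem_filt assms by blast
  then show "s \<in> filt S 1"
    using s assms by auto
qed

text \<open>For fixed \<open>x\<close> the elements \<open>y\<close> with
  \<open>x \<otimes> y\<close> in the step \<open>i + Suc j\<close> form a subspace, so it suffices
  to treat products \<open>y \<otimes> s\<close> with \<open>s\<close> a generator or 1, where
  associativity applies.\<close>

lemma filt_mult:
  assumes "S \<subseteq> carrier A" "x \<in> filt S i" "y \<in> filt S j"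
  shows "x \<otimes> y \<in> filt S (i + j)"
  using assms(3)
proof (induction j arbitrary: y)
  case 0
  have "x \<otimes> y \<in> filt S i"
  proof (rule mult_mem_subspace[of x "filt S i" y "{\<one>}"])
    show "x \<in> span (filt S i)"
      using subspace_span_eq[OF filt_subspace[OF assms(1)]] assms by simp
    show "y \<in> span {\<one>}" using 0 by simp
  next
    fix a b assume "a \<in> filt S i" "b \<in> {\<one>}"
    then show "a \<otimes> b \<in> filt S i"
      using filt_closed[OF assms(1), of i] by auto
  qed (use filt_closed[OF assms(1)] filt_subspace[OF assms(1)] in auto)
  then show ?case by simp
next
  case (Suc j)
  let ?W = "{y \<in> carrier A. x \<otimes> y \<in> filt S (i + Suc j)}"
  have x: "x \<in> carrier A"
    using assms filt_closed by blast
  note F = subspace_memD[OF filt_subspace[OF assms(1), of "i + Suc j"]]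
  have "filt S (Suc j) \<subseteq> ?W"
  proof (rule filt_Suc_subset[OF assms(1)])
    show "VectorSpace.subspace K ?W A"
      using x F by (intro subspaceI) (auto simp: A.r_distr smult_mult_right simp del: algebra_filtration.simps)
  next
    fix y s assume y: "y \<in> filt S j" and s: "s \<in> insert \<one> S"
    have s': "s \<in> span (insert \<one> S)" "s \<in> carrier A"
      using assms s in_own_span[of "insert \<one> S"] by auto
    have "y \<in> carrier A"
      using y filt_closed assms by blast
    then show "y \<otimes> s \<in> ?W"
      using filt_SucI[OF assms(1) Suc.IH[OF y] s'(1)] s'(2) x A.m_assoc[OF x _ s'(2), of y]
      by (simp del: algebra_filtration.simps)
  qed
  then show ?case
    using Suc.prems by blast
qed

lemma filt_pow:
  assumes "S \<subseteq> carrier A" "x \<in> filt S i"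
  shows "x [^] (n::nat) \<in> filt S (i * n)"
proof (induction n)
  case 0
  show ?case using one_mem_filt[OF assms(1), of "i * 0"] by (simp only: A.nat_pow_0)
next
  case (Suc n)
  have "i * Suc n = i * n + i" by simp
  then show ?case
    using filt_mult[OF assms(1) Suc assms(2)] by (simp only: A.nat_pow_Suc)
qed

lemma filt_finite_dim:
  assumes "S \<subseteq> carrier A" "finite S"
  obtains G where "finite G" "G \<subseteq> carrier A" "filt S i = span G"
proof -
  have "\<exists>G. finite G \<and> G \<subseteq> carrier A \<and> filt S i = span G"
  proof (induction i)
    case 0
    show ?case by (rule exI[of _ "{\<one>}"]) auto
  next
    case (Suc i)
    then obtain G where G: "finite G" "G \<subseteq> carrier A" "filt S i = span G" by blast
    let ?H = "(\<lambda>(x, y). x \<otimes> y) ` (G \<times> insert \<one> S)"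
    have H: "?H \<subseteq> carrier A" using G assms by auto
    have "filt S (Suc i) \<subseteq> span ?H"
    proof (rule filt_Suc_subset[OF assms(1) span_is_subspace[OF H]])
      fix x s assume xs: "x \<in> filt S i" "s \<in> insert \<one> S"
      then have s: "s \<in> carrier A" using assms by auto
      show "x \<otimes> s \<in> span ?H"
        using xs s G assms in_own_span[OF H] in_own_span[of "{s}"] 
        by (intro mult_mem_subspace[of x G s "{s}"] span_is_subspace H) auto
    qed
    moreover have "?H \<subseteq> filt S (Suc i)"
    proof clarify
      fix x s assume xs: "x \<in> G" "s \<in> insert \<one> S"
      then have "x \<in> filt S i" "s \<in> span (insert \<one> S)"
        using G in_own_span[OF G(2)] in_own_span[of "insert \<one> S"] assms by auto
      then show "x \<otimes> s \<in> filt S (Suc i)"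
        by (rule filt_SucI[OF assms(1)])
    qed
    ultimately have "filt S (Suc i) = span ?H"
      using span_least[OF _ filt_subspace[OF assms(1)]] by blast
    then show ?case
      using H G assms by (intro exI[of _ ?H]) auto
  qed
  then show ?thesis using that by blast
qed

lemma filt_exhaust:
  assumes "algebra_generators K A S"
  shows "(\<Union>i. filt S i) = carrier A"
proof -
  have S: "S \<subseteq> carrier A"
    using assms by (auto simp: algebra_generators_def)
  let ?B = "\<Union>i. filt S i"
  have ub: "\<exists>k. x \<in> filt S k \<and> y \<in> filt S k" if xy: "x \<in> ?B" "y \<in> ?B" for x y
  proof -
    obtain i where "x \<in> filt S i" using xy(1) by blast
    moreover obtain j where "y \<in> filt S j" using xy(2) by blast
    ultimately show ?thesis
      using filt_mono[OF S, of i "max i j"] filt_mono[OF S, of j "max i j"]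
      by (intro exI[of _ "max i j"] conjI) (meson max.cobounded1 max.cobounded2 subsetD)+
  qed
  note F = subspace_memD[OF filt_subspace[OF S]]
  have sub: "VectorSpace.subspace K ?B A"
  proof (rule subspaceI)
    show "?B \<subseteq> carrier A" using F(1) by blast
    show "\<zero> \<in> ?B" using F(2) by blast
    show "x \<oplus> y \<in> ?B" if "x \<in> ?B" "y \<in> ?B" for x y using F(3) ub[OF that] by blast
    show "c \<odot> x \<in> ?B" if "c \<in> carrier K" "x \<in> ?B" for c x using F(4) that by blast
  qed
  note B = subspace_memD[OF sub]
  have "subring ?B A"
  proof (rule A.subringI)
    show "?B \<subseteq> carrier A" by (rule B(1))
    show "\<one> \<in> ?B" using one_mem_filt[OF S] by blast
    show "x \<otimes> y \<in> ?B" if "x \<in> ?B" "y \<in> ?B" for x y using that filt_mult[OF S] by blast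
    show "x \<oplus> y \<in> ?B" if "x \<in> ?B" "y \<in> ?B" for x y
      using that by (rule B(3))
    show "\<ominus> x \<in> ?B" if "x \<in> ?B" for x
    proof -
      have "(\<ominus>\<^bsub>K\<^esub> \<one>\<^bsub>K\<^esub>) \<odot> x \<in> ?B"
        by (rule B(4)) (use that in simp_all)
      moreover have "x \<in> carrier A" using that B(1) by blast
      ultimately show ?thesis by (simp add: smult_minus_1)
    qed
  qed
  moreover have "S \<subseteq> ?B"
    using generators_subset_filt[OF S] by blast
  ultimately show ?thesis
    using assms sub unfolding algebra_generators_def is_subalgebra_def by blast
qed

lemma finite_subset_filt:
  assumes "algebra_generators K A S" "finite X" "X \<subseteq> carrier A"
  obtains p where "X \<subseteq> filt S p"
proof -
  have S: "S \<subseteq> carrier A"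
    using assms by (auto simp: algebra_generators_def)
  have "\<exists>p. X \<subseteq> filt S p"
    using assms(2,3)
  proof (induction rule: finite_induct)
    case (insert x X)
    then obtain p q where "X \<subseteq> filt S p" "x \<in> filt S q"
      using filt_exhaust[OF assms(1)] by blast
    then show ?case
      using filt_mono[OF S, of p "max p q"] filt_mono[OF S, of q "max p q"] by (intro exI[of _ "max p q"]) (meson max.cobounded1 max.cobounded2 subsetD insert_subset order_trans)
  qed auto
  then show ?thesis using that by blast
qed

text \<open>Filtrations given by different generators dominate each other up to a linear rescaling
  of the index, which is why the growth exponent does not depend on the choice. The lemma also
  places the filtration of \<open>C\<close> inside that of \<open>A\<close>.\<close>

lemma filt_subset_filt:
  assumes "S \<subseteq> carrier A" "S' \<subseteq> carrier A" "S' \<subseteq> filt S p"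
  shows "filt S' i \<subseteq> filt S (p * i)"
proof (induction i)
  case 0
  have "span {\<one>} \<subseteq> filt S 0"
    using one_mem_filt[OF assms(1)] by (intro span_least filt_subspace assms(1)) blast
  then show ?case by simp
next
  case (Suc i)
  show ?case
  proof (rule filt_Suc_subset[OF assms(2) filt_subspace[OF assms(1)]])
    fix x s assume "x \<in> filt S' i" "s \<in> insert \<one> S'"
    then have "x \<in> filt S (p * i)" "s \<in> filt S p"
      using Suc assms one_mem_filt by auto
    then show "x \<otimes> s \<in> filt S (p * Suc i)"
      using filt_mult[OF assms(1), of x "p * i" s p] by (simp add: add.commute)
  qed
qed

lemma subalgebra_assoc_algebra:
  assumes "is_subalgebra K A C"
  shows "assoc_algebra K (A\<lparr>carrier := C\<rparr>)"
proof -
  have "subring C A" "VectorSpace.subspace K C A"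
    using assms by (auto simp: is_subalgebra_def)
  then have "ring (A\<lparr>carrier := C\<rparr>)" "vectorspace K (A\<lparr>carrier := C\<rparr>)" "C \<subseteq> carrier A"
    using A.subring_is_ring subspace_is_vs subspace_memD(1) by blast+
  then show ?thesis
    by (intro assoc_algebra.intro assoc_algebra_axioms.intro)
      (auto intro: smult_mult_left smult_mult_right)
qed

text \<open>The dimension of \<open>C\<close> is defined through the record with restricted carrier,
  while the estimates take place in \<open>A\<close>. Spans of subsets of \<open>C\<close> agree in
  both.\<close>

lemma filt_subalgebra:
  assumes "is_subalgebra K A C" "S \<subseteq> C"
  shows "algebra_filtration K (A\<lparr>carrier := C\<rparr>) S i = filt S i"
proof -
  interpret C: assoc_algebra K "A\<lparr>carrier := C\<rparr>"
    using subalgebra_assoc_algebra[OF assms(1)] .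
  have sub: "LinearCombinations.submodule K C A"
    using assms by (auto simp: is_subalgebra_def subspace_iff_submodule)
  note span = span_li_not_depend(1)[OF _ sub]
  have one: "\<one> \<in> C"
    using C.A.one_closed by simp
  show ?thesis
  proof (induction i)
    case 0
    show ?case using one span by simp
  next
    case (Suc i)
    have "filt S i \<subseteq> C"
      using C.filt_closed[of S i] assms(2) Suc by simp
    moreover have "span (insert \<one> S) \<subseteq> C"
      using span_is_subset[OF _ sub] one assms by simp
    ultimately have "{x \<otimes> y |x y. x \<in> filt S i \<and> y \<in> span (insert \<one> S)} \<subseteq> C"
      using C.A.m_closed by auto
    from span[OF this] show ?case
      using Suc span[of "insert \<one> S"] one assms by simp
  qed
qed

end

section \<open>Filtrations of modules\<close>

text \<open>Preimages of a basis of the image are independent, because \<open>T\<close> carries a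
  relation among them to the same relation among the basis vectors.\<close>

lemma (in linear_map) sdim_image_le:
  assumes "finite G" "G \<subseteq> carrier V" "X \<subseteq> carrier V" "V.module.span X \<subseteq> V.module.span G"
  shows "W.sdim (W.module.span (T ` X)) \<le> V.sdim (V.module.span G)"
proof -
  have XG: "X \<subseteq> V.module.span G"
    using assms V.module.in_own_span by blast
  have TG: "finite (T ` G)" "T ` G \<subseteq> carrier W" "T ` X \<subseteq> W.module.span (T ` G)"
  proof -
    show TG: "T ` G \<subseteq> carrier W" using assms by auto
    note span = W.subspace_memD[OF W.span_is_subspace[OF TG]]
    show "T ` X \<subseteq> W.module.span (T ` G)"
    proof clarify
      fix x assume "x \<in> X"
      then have "x \<in> V.module.span G" using XG by blast
      then show "T x \<in> W.module.span (T ` G)"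
        using assms(2)
      proof (induction rule: V.span_induct)
        case (base x)
        then show ?case using W.module.in_own_span[OF TG] by auto
      next
        case zero
        then show ?case using span(2) by auto
      next
        case (add x y)
        then show ?case using span(3) by auto
      next
        case (smult c x)
        then show ?case using span(4) by auto
      qed
    qed
  qed (use assms in auto)
  obtain B where B: "B \<subseteq> T ` X" "finite B" "W.module.lin_indpt B"
    "W.sdim (W.module.span (T ` X)) = card B"
    using W.obtain_basis_subset[OF TG] by metis
  have BW: "B \<subseteq> carrier W"
    using B(1) assms(3) by auto
  define h where "h b = (SOME x. x \<in> X \<and> T x = b)" for b
  have h: "h b \<in> X" "T (h b) = b" if "b \<in> B" for b
    using someI_ex[of "\<lambda>x. x \<in> X \<and> T x = b"] that B(1) unfolding h_def by blast+
  have "card B \<le> V.sdim (V.module.span G)"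
  proof (rule V.card_le_sdim[OF assms(1,2) B(2)])
    show "h \<in> B \<rightarrow> V.module.span G" using h XG by blast
  next
    fix c b assume c: "c \<in> B \<rightarrow> carrier K" "(\<Oplus>\<^bsub>V\<^esub>b\<in>B. c b \<odot>\<^bsub>V\<^esub> h b) = \<zero>\<^bsub>V\<^esub>" and b: "b \<in> B"
    have c': "c b \<in> carrier K" "h b \<in> carrier V" if "b \<in> B" for b
      using c(1) h(1)[OF that] that assms(3) by auto
    then have ch: "c b \<odot>\<^bsub>V\<^esub> h b \<in> carrier V" if "b \<in> B" for b
      using that by simp
    have "T (\<Oplus>\<^bsub>V\<^esub>b\<in>F. c b \<odot>\<^bsub>V\<^esub> h b) = (\<Oplus>\<^bsub>W\<^esub>b\<in>F. T (c b \<odot>\<^bsub>V\<^esub> h b))" if "finite F" "F \<subseteq> B" for F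
      using that
    proof (induction rule: finite_induct)
      case (insert b F)
      have "(\<Oplus>\<^bsub>V\<^esub>b\<in>insert b F. c b \<odot>\<^bsub>V\<^esub> h b) = c b \<odot>\<^bsub>V\<^esub> h b \<oplus>\<^bsub>V\<^esub> (\<Oplus>\<^bsub>V\<^esub>b\<in>F. c b \<odot>\<^bsub>V\<^esub> h b)"
        by (rule V.module.M.finsum_insert) (use insert ch in auto)
      moreover have "(\<Oplus>\<^bsub>W\<^esub>b\<in>insert b F. T (c b \<odot>\<^bsub>V\<^esub> h b))
          = T (c b \<odot>\<^bsub>V\<^esub> h b) \<oplus>\<^bsub>W\<^esub> (\<Oplus>\<^bsub>W\<^esub>b\<in>F. T (c b \<odot>\<^bsub>V\<^esub> h b))"
        by (rule W.module.M.finsum_insert) (use insert ch in \<open>auto intro!: f_im\<close>)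
      moreover have "(\<Oplus>\<^bsub>V\<^esub>b\<in>F. c b \<odot>\<^bsub>V\<^esub> h b) \<in> carrier V"
        by (rule V.module.M.finsum_closed) (use insert ch in auto)
      ultimately show ?case
        using insert ch[of b] f_add by simp
    qed simp
    from this[OF B(2) subset_refl] have "(\<Oplus>\<^bsub>W\<^esub>b\<in>B. T (c b \<odot>\<^bsub>V\<^esub> h b)) = \<zero>\<^bsub>W\<^esub>"
      using c(2) by simp
    moreover have "(\<Oplus>\<^bsub>W\<^esub>b\<in>B. T (c b \<odot>\<^bsub>V\<^esub> h b)) = (\<Oplus>\<^bsub>W\<^esub>b\<in>B. c b \<odot>\<^bsub>W\<^esub> b)"
      using c' h(2) BW by (intro W.module.M.finsum_cong') (auto simp: Pi_iff subset_iff)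
    ultimately show "c b = \<zero>\<^bsub>K\<^esub>"
      using W.lin_indpt_finsumD[OF B(2) _ B(3) c(1) _ b] BW by simp
  qed
  then show ?thesis using B by simp
qed

context left_module
begin

lemma act_zero [simp]:
  "a \<in> carrier R \<Longrightarrow> a \<odot> \<zero> = \<zero>"
  "x \<in> carrier M \<Longrightarrow> \<zero>\<^bsub>R\<^esub> \<odot> x = \<zero>"
proof -
  show "a \<odot> \<zero> = \<zero>" if "a \<in> carrier R"
    using smult_r_distr[OF that M.zero_closed M.zero_closed] smult_closed[OF that M.zero_closed] by simp
  show "\<zero>\<^bsub>R\<^esub> \<odot> x = \<zero>" if "x \<in> carrier M"
    using smult_l_distr[OF R.zero_closed R.zero_closed that] smult_closed[OF R.zero_closed that] by simp
qed

lemma act_uminus_one: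
  assumes "x \<in> carrier M"
  shows "(\<ominus>\<^bsub>R\<^esub> \<one>\<^bsub>R\<^esub>) \<odot> x = \<ominus> x"
proof -
  have "(\<ominus>\<^bsub>R\<^esub> \<one>\<^bsub>R\<^esub>) \<odot> x \<oplus> x = \<zero>"
    using smult_l_distr[of "\<ominus>\<^bsub>R\<^esub> \<one>\<^bsub>R\<^esub>" "\<one>\<^bsub>R\<^esub>" x] assms by (simp add: R.l_neg smult_one)
  then show ?thesis
    using assms smult_closed by (intro M.minus_equality[symmetric]) auto
qed

lemma left_submoduleI:
  assumes "N \<subseteq> carrier M" "\<zero> \<in> N" "\<And>x y. \<lbrakk>x \<in> N; y \<in> N\<rbrakk> \<Longrightarrow> x \<oplus> y \<in> N"
    "\<And>a x. \<lbrakk>a \<in> carrier R; x \<in> N\<rbrakk> \<Longrightarrow> a \<odot> x \<in> N"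
  shows "Module.submodule N R M"
proof (intro Module.submodule.intro Module.submodule_axioms.intro subgroup.intro)
  fix x assume x: "x \<in> N"
  then have "(\<ominus>\<^bsub>R\<^esub> \<one>\<^bsub>R\<^esub>) \<odot> x \<in> N" "x \<in> carrier M"
    using assms by auto
  then show "inv\<^bsub>add_monoid M\<^esub> x \<in> N"
    using act_uminus_one by (simp add: a_inv_def)
qed (use assms in auto)

lemma left_submoduleD:
  assumes "Module.submodule N R M"
  shows "N \<subseteq> carrier M" "\<zero> \<in> N" "\<And>x y. \<lbrakk>x \<in> N; y \<in> N\<rbrakk> \<Longrightarrow> x \<oplus> y \<in> N"
    "\<And>a x. \<lbrakk>a \<in> carrier R; x \<in> N\<rbrakk> \<Longrightarrow> a \<odot> x \<in> N" "\<And>x. x \<in> N \<Longrightarrow> \<ominus> x \<in> N"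
proof -
  interpret N: Module.submodule N R M by fact
  show "N \<subseteq> carrier M" "\<zero> \<in> N" "\<And>x y. \<lbrakk>x \<in> N; y \<in> N\<rbrakk> \<Longrightarrow> x \<oplus> y \<in> N"
    "\<And>a x. \<lbrakk>a \<in> carrier R; x \<in> N\<rbrakk> \<Longrightarrow> a \<odot> x \<in> N"
    using N.subset N.one_closed N.m_closed N.smult_closed by auto
  show "\<And>x. x \<in> N \<Longrightarrow> \<ominus> x \<in> N"
    using N.m_inv_closed by (simp add: a_inv_def)
qed

end

lemma chosen_generatorsD:
  assumes "fg_algebra K R"
  shows "finite (chosen_generators K R)" "algebra_generators K R (chosen_generators K R)"
  using someI_ex[of "\<lambda>S. finite S \<and> algebra_generators K R S"] assms
  by (auto simp: chosen_generators_def fg_algebra_def)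

section \<open>Modules over an algebra as vector spaces, and their growth\<close>

locale algebra_module = alg: assoc_algebra K R + mod: left_module R M
  for K :: "'k ring" and R :: "('k, 'r) module" and M :: "('r, 'm) module" (structure)
begin

abbreviation VM :: "('k, 'm) module" where
  "VM \<equiv> restrict_scalars K R M"

lemma VM_simps [simp]:
  "carrier VM = carrier M" "\<zero>\<^bsub>VM\<^esub> = \<zero>" "(\<oplus>\<^bsub>VM\<^esub>) = (\<oplus>)"
  "c \<odot>\<^bsub>VM\<^esub> m = (c \<odot>\<^bsub>R\<^esub> \<one>\<^bsub>R\<^esub>) \<odot> m"
  by (auto simp: restrict_scalars_def)

text \<open>Scalar multiples of the unit of \<open>R\<close> are central, hence every element of
  \<open>R\<close> acts linearly over \<open>K\<close>.\<close>

lemma scalar_smult: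
  assumes "c \<in> carrier K" "r \<in> carrier R" "m \<in> carrier M"
  shows "(c \<odot>\<^bsub>R\<^esub> r) \<odot> m = c \<odot>\<^bsub>VM\<^esub> (r \<odot> m)"
    "r \<odot> (c \<odot>\<^bsub>VM\<^esub> m) = c \<odot>\<^bsub>VM\<^esub> (r \<odot> m)"
proof -
  have "(c \<odot>\<^bsub>R\<^esub> \<one>\<^bsub>R\<^esub>) \<otimes>\<^bsub>R\<^esub> r = c \<odot>\<^bsub>R\<^esub> r"
    using alg.smult_mult_left[OF assms(1) alg.A.one_closed assms(2)] assms by simp
  then show 1: "(c \<odot>\<^bsub>R\<^esub> r) \<odot> m = c \<odot>\<^bsub>VM\<^esub> (r \<odot> m)"
    using mod.smult_assoc[of "c \<odot>\<^bsub>R\<^esub> \<one>\<^bsub>R\<^esub>" r m] assms by simp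
  have "r \<otimes>\<^bsub>R\<^esub> (c \<odot>\<^bsub>R\<^esub> \<one>\<^bsub>R\<^esub>) = c \<odot>\<^bsub>R\<^esub> r"
    using alg.smult_mult_right[OF assms(1,2) alg.A.one_closed] assms by simp
  then show "r \<odot> (c \<odot>\<^bsub>VM\<^esub> m) = c \<odot>\<^bsub>VM\<^esub> (r \<odot> m)"
    using mod.smult_assoc[of r "c \<odot>\<^bsub>R\<^esub> \<one>\<^bsub>R\<^esub>" m] 1 assms by simp
qed

lemma VM_vectorspace: "vectorspace K VM"
proof (rule vs_criteria)
  show "field K" ..
  show "\<forall>c v w. c \<in> carrier K \<and> v \<in> carrier VM \<and> w \<in> carrier VM \<longrightarrow>
      c \<odot>\<^bsub>VM\<^esub> (v \<oplus>\<^bsub>VM\<^esub> w) = c \<odot>\<^bsub>VM\<^esub> v \<oplus>\<^bsub>VM\<^esub> c \<odot>\<^bsub>VM\<^esub> w"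
    by (auto intro: mod.smult_r_distr)
  show "\<forall>v\<in>carrier VM. \<exists>neg_v\<in>carrier VM. v \<oplus>\<^bsub>VM\<^esub> neg_v = \<zero>\<^bsub>VM\<^esub>"
    using mod.M.r_neg mod.M.a_inv_closed by auto
  show "\<forall>a b v. a \<in> carrier K \<and> b \<in> carrier K \<and> v \<in> carrier VM \<longrightarrow>
      (a \<otimes>\<^bsub>K\<^esub> b) \<odot>\<^bsub>VM\<^esub> v = a \<odot>\<^bsub>VM\<^esub> (b \<odot>\<^bsub>VM\<^esub> v)"
  proof clarify
    fix a b v assume *: "a \<in> carrier K" "b \<in> carrier K" "v \<in> carrier VM"
    then have "(a \<otimes>\<^bsub>K\<^esub> b) \<odot>\<^bsub>R\<^esub> \<one>\<^bsub>R\<^esub> = a \<odot>\<^bsub>R\<^esub> (b \<odot>\<^bsub>R\<^esub> \<one>\<^bsub>R\<^esub>)"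
      by (simp add: alg.smult_assoc1)
    then show "(a \<otimes>\<^bsub>K\<^esub> b) \<odot>\<^bsub>VM\<^esub> v = a \<odot>\<^bsub>VM\<^esub> (b \<odot>\<^bsub>VM\<^esub> v)"
      using * scalar_smult(1)[of a "b \<odot>\<^bsub>R\<^esub> \<one>\<^bsub>R\<^esub>" v] by simp
  qed
  show "\<forall>a b v. a \<in> carrier K \<and> b \<in> carrier K \<and> v \<in> carrier VM \<longrightarrow>
      (a \<oplus>\<^bsub>K\<^esub> b) \<odot>\<^bsub>VM\<^esub> v = a \<odot>\<^bsub>VM\<^esub> v \<oplus>\<^bsub>VM\<^esub> b \<odot>\<^bsub>VM\<^esub> v"
    by (auto simp: alg.smult_l_distr mod.smult_l_distr)
qed (auto simp: mod.M.a_ac mod.smult_one intro: mod.smult_closed)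

sublocale V: vectorspace K VM
  by (rule VM_vectorspace)

lemma act_mem_subspace:
  assumes "r \<in> alg.span X" "m \<in> V.span Y" "X \<subseteq> carrier R" "Y \<subseteq> carrier M"
    and sub: "VectorSpace.subspace K W VM"
    and XY: "\<And>x y. \<lbrakk>x \<in> X; y \<in> Y\<rbrakk> \<Longrightarrow> x \<odot> y \<in> W"
  shows "r \<odot> m \<in> W"
proof -
  note W = V.subspace_memD[OF sub, unfolded VM_simps(1-3)]
  have Y: "Y \<subseteq> carrier VM" using assms by simp
  have *: "x \<odot> m \<in> W" if x: "x \<in> X" for x
  proof -
    have xR: "x \<in> carrier R" using x assms(3) by blast
    from assms(2) Y show ?thesis
    proof (induction rule: V.span_induct)
      case zero
      then show ?case using xR W(2) by simp
    next
      case (add y z)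
      then show ?case using W(3) xR by (simp add: mod.smult_r_distr)
    next
      case (smult c y)
      then show ?case using W(4) xR scalar_smult(2)[of c x y] by simp
    next
      case (base y)
      then show ?case using XY x by blast
    qed
  qed
  have m: "m \<in> carrier M"
    using assms(2) Y V.span_is_subset2[OF Y] by auto
  from assms(1,3) show ?thesis
  proof (induction rule: alg.span_induct)
    case zero
    then show ?case using m W(2) by simp
  next
    case (add u v)
    then show ?case using W(3) m by (simp add: mod.smult_l_distr)
  next
    case (smult c u)
    then show ?case using W(4) m scalar_smult(1)[of c u m] by simp
  next
    case (base u)
    then show ?case by (rule *)
  qed
qed

abbreviation mfilt_gens :: "'r set \<Rightarrow> 'm set \<Rightarrow> nat \<Rightarrow> 'm set" where
  "mfilt_gens S G i \<equiv> {r \<odot> m | r m. r \<in> alg.filt S i \<and> m \<in> G}"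

text \<open>This is the subspace \<open>R_i M_0\<close>. The set \<open>G\<close> may be a finite
  set of generators or an entire subspace: \<open>GK_module\<close> uses the latter, while finite
  dimensionality is read off from the former.\<close>

definition mfilt :: "'r set \<Rightarrow> 'm set \<Rightarrow> nat \<Rightarrow> 'm set" where
  "mfilt S G i = V.span (mfilt_gens S G i)"

context
  fixes S G
  assumes S: "S \<subseteq> carrier R" and G: "G \<subseteq> carrier M"
begin

lemma mfilt_gens_closed: "mfilt_gens S G i \<subseteq> carrier VM"
  using alg.filt_closed[OF S] G by (auto intro!: mod.smult_closed)

lemma mfilt_subspace: "VectorSpace.subspace K (mfilt S G i) VM"
  unfolding mfilt_def by (rule V.span_is_subspace[OF mfilt_gens_closed])

lemma mfiltI: "r \<in> alg.filt S i \<Longrightarrow> m \<in> G \<Longrightarrow> r \<odot> m \<in> mfilt S G i"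
  unfolding mfilt_def using V.in_own_span[OF mfilt_gens_closed] by blast

lemma mfilt_closed: "mfilt S G i \<subseteq> carrier M"
  using V.subspace_memD(1)[OF mfilt_subspace] by simp

lemma mfilt_mono: "i \<le> j \<Longrightarrow> mfilt S G i \<subseteq> mfilt S G j"
  unfolding mfilt_def using alg.filt_mono[OF S, of i j] by (intro V.span_is_monotone) blast

lemma gens_subset_mfilt: "G \<subseteq> mfilt S G i"
  using mfiltI[OF alg.one_mem_filt[OF S]] mod.smult_one G by (metis subsetD subsetI)

lemma act_mfilt:
  assumes "r \<in> alg.filt S i" "m \<in> mfilt S G j"
  shows "r \<odot> m \<in> mfilt S G (i + j)"
proof (rule act_mem_subspace[of r "alg.filt S i" m "mfilt_gens S G j"])
  show "r \<in> alg.span (alg.filt S i)"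
    using alg.subspace_span_eq[OF alg.filt_subspace[OF S]] assms by simp
  show "m \<in> V.span (mfilt_gens S G j)"
    using assms by (simp add: mfilt_def)
  fix x y assume xy: "x \<in> alg.filt S i" "y \<in> (mfilt_gens S G j)"
  then obtain s m where sm: "y = s \<odot> m" "s \<in> alg.filt S j" "m \<in> G" by blast
  have "x \<in> carrier R" "s \<in> carrier R" "m \<in> carrier M"
    using xy sm alg.filt_closed[OF S] G by auto
  then have "x \<odot> y = (x \<otimes>\<^bsub>R\<^esub> s) \<odot> m"
    using sm mod.smult_assoc by simp
  then show "x \<odot> y \<in> mfilt S G (i + j)"
    using mfiltI alg.filt_mult[OF S xy(1) sm(2)] sm(3) by simp
qed (use alg.filt_closed[OF S] mfilt_gens_closed mfilt_subspace in auto)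

lemma mfilt_finite_dim:
  assumes "finite S" "finite G"
  obtains H where "finite H" "H \<subseteq> carrier M" "mfilt S G i = V.span H"
proof -
  obtain E where E: "finite E" "E \<subseteq> carrier R" "alg.filt S i = alg.span E"
    using alg.filt_finite_dim[OF S assms(1)] .
  let ?H = "(\<lambda>(r, m). r \<odot> m) ` (E \<times> G)"
  have H: "?H \<subseteq> carrier VM"
    using E G by (auto intro!: mod.smult_closed)
  have "mfilt_gens S G i \<subseteq> V.span ?H"
  proof clarify
    fix r m assume "r \<in> alg.filt S i" "m \<in> G"
    then show "r \<odot> m \<in> V.span ?H"
      using E G V.in_own_span[OF H] V.in_own_span[of G]
      by (intro act_mem_subspace[of r E m G] V.span_is_subspace[OF H]) auto
  qed
  then have "mfilt S G i \<subseteq> V.span ?H"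
    unfolding mfilt_def by (intro V.span_mono_span H)
  moreover have "?H \<subseteq> mfilt S G i"
    using E alg.in_own_span[OF E(2)] mfiltI[of _ i] by auto
  then have "V.span ?H \<subseteq> mfilt S G i"
    by (intro V.span_least mfilt_subspace)
  ultimately show ?thesis
    using that[of ?H] H E assms by auto
qed

lemma mfilt_exhaust:
  assumes "algebra_generators K R S" "module_generators R M G"
  shows "(\<Union>i. mfilt S G i) = carrier M"
proof -
  let ?N = "\<Union>i. mfilt S G i"
  note F = V.subspace_memD[OF mfilt_subspace, unfolded VM_simps(1-3)]
  have "Module.submodule ?N R M"
  proof (rule mod.left_submoduleI)
    show "?N \<subseteq> carrier M" using F(1) by blast
    show "\<zero> \<in> ?N" using F(2) by blast
  next
    fix x y assume "x \<in> ?N" "y \<in> ?N"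
    then obtain i j where ij: "x \<in> mfilt S G i" "y \<in> mfilt S G j" by fast
    then have "x \<in> mfilt S G (max i j)" "y \<in> mfilt S G (max i j)"
      using mfilt_mono[of i "max i j"] mfilt_mono[of j "max i j"] by auto
    then show "x \<oplus> y \<in> ?N" using F(3) by blast
  next
    fix r x assume r: "r \<in> carrier R" and x: "x \<in> ?N"
    obtain i where i: "r \<in> alg.filt S i"
      using alg.filt_exhaust[OF assms(1)] r by fast
    obtain j where "x \<in> mfilt S G j" using x by fast
    then show "r \<odot> x \<in> ?N" using act_mfilt[OF i] by blast
  qed
  then show ?thesis
    using assms(2) gens_subset_mfilt unfolding module_generators_def by blast
qed

lemma finite_subset_mfilt:
  assumes "algebra_generators K R S" "module_generators R M G" "finite X" "X \<subseteq> carrier M"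
  obtains p where "X \<subseteq> mfilt S G p"
proof -
  have "\<exists>p. X \<subseteq> mfilt S G p"
    using assms(3,4)
  proof (induction rule: finite_induct)
    case (insert x X)
    then obtain p q where "X \<subseteq> mfilt S G p" "x \<in> mfilt S G q"
      using mfilt_exhaust[OF assms(1,2)] by blast
    then have "insert x X \<subseteq> mfilt S G (max p q)"
      using mfilt_mono[of p "max p q"] mfilt_mono[of q "max p q"] by auto
    then show ?case ..
  qed auto
  then show ?thesis using that by blast
qed

end

text \<open>Guarantees that the choice made in \<open>GK_module\<close> picks a genuine generating
  subspace.\<close>

lemma generating_subspace_exists:
  assumes "fg_module R M"
  shows "\<exists>W. generating_subspace K R M W"
proof -
  obtain G where G: "finite G" "module_generators R M G"
    using assms by (auto simp: fg_module_def)
  then have GM: "G \<subseteq> carrier VM" by (auto simp: module_generators_def)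
  have sub: "VectorSpace.subspace K (V.span G) VM"
    using V.span_is_subspace[OF GM] .
  interpret W: vectorspace K "V.vs (V.span G)"
    using V.subspace_is_vs[OF sub] .
  have "W.fin_dim"
    unfolding W.fin_dim_def
    using G(1) V.in_own_span[OF GM] V.span_li_not_depend(1)[OF V.in_own_span[OF GM] V.span_is_submodule[OF GM]]
    by (intro exI[of _ G]) auto
  moreover have "module_generators R M (V.span G)"
    using G(2) V.in_own_span[OF GM] V.subspace_memD(1)[OF sub]
    unfolding module_generators_def VM_simps(1) by (meson order_trans)
  ultimately show ?thesis
    using sub unfolding generating_subspace_def by blast
qed

lemma generating_subspaceE:
  assumes "generating_subspace K R M W"
  obtains G where "finite G" "G \<subseteq> carrier M" "W = V.span G" "module_generators R M G"
proof -
  have sub: "VectorSpace.subspace K W VM" and W: "module_generators R M W"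
    using assms by (auto simp: generating_subspace_def)
  interpret W: vectorspace K "V.vs W"
    using V.subspace_is_vs[OF sub] .
  have "W.fin_dim"
    using assms by (auto simp: generating_subspace_def)
  then obtain G where G: "finite G" "G \<subseteq> W" "W.span G = W"
    unfolding W.fin_dim_def by auto
  then have "W = V.span G"
    using V.span_li_not_depend(1)[of G W] sub V.subspace_iff_submodule by auto
  moreover have GM: "G \<subseteq> carrier M"
    using G(2) V.subspace_memD(1)[OF sub] by auto
  moreover have "module_generators R M G"
    unfolding module_generators_def
  proof (intro conjI allI impI GM)
    fix N assume N: "Module.submodule N R M \<and> G \<subseteq> N"
    then have "Module.submodule N R M" by blast
    note N' = mod.left_submoduleD[OF this]
    have "VectorSpace.subspace K N VM"
      using N' by (intro V.subspaceI) auto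
    then have "W \<subseteq> N"
      using V.span_least[of G N] N \<open>W = V.span G\<close> by simp
    then show "N = carrier M"
      using W N unfolding module_generators_def by blast
  qed
  ultimately show ?thesis using that G(1) by blast
qed

text \<open>The chosen generators and the chosen subspace lie in fixed steps \<open>p\<close> and
  \<open>q\<close> of the filtrations given by \<open>S\<close> and \<open>G\<close>. Hence the
  chosen filtration at \<open>i\<close> is contained in the given one at
  \<open>Suc p * i + q\<close>.\<close>

lemma GK_module_le:
  assumes "finite S" "algebra_generators K R S" "finite G" "module_generators R M G"
  shows "GK_module K R M \<le> growth_exponent (\<lambda>i. V.sdim (mfilt S G i))"
proof -
  define S0 where "S0 = chosen_generators K R"
  define W where "W = (SOME W. generating_subspace K R M W)"
  have SR: "S \<subseteq> carrier R" and GM: "G \<subseteq> carrier M"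
    using assms by (auto simp: algebra_generators_def module_generators_def)
  have S0: "finite S0" "algebra_generators K R S0"
    using chosen_generatorsD assms unfolding S0_def fg_algebra_def by blast+
  then have S0R: "S0 \<subseteq> carrier R" by (auto simp: algebra_generators_def)
  have "generating_subspace K R M W"
    unfolding W_def
    by (rule someI_ex, rule generating_subspace_exists) (use assms in \<open>auto simp: fg_module_def\<close>)
  then obtain G0 where G0: "finite G0" "G0 \<subseteq> carrier M" "W = V.span G0"
    by (rule generating_subspaceE)
  obtain p where p: "S0 \<subseteq> alg.filt S p"
    using alg.finite_subset_filt[OF assms(2) S0(1) S0R] .
  \<comment> \<open>The step is raised by one so that the factor of \<open>i\<close> is positive, as
    the comparison of growth exponents demands.\<close>
  then have p': "S0 \<subseteq> alg.filt S (Suc p)"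
    using alg.filt_mono[OF SR le_SucI[OF order_refl]] by (rule order_trans)
  obtain q where q: "G0 \<subseteq> mfilt S G q"
    using finite_subset_mfilt[OF SR GM assms(2,4) G0(1,2)] .
  have W: "W \<subseteq> mfilt S G q"
    unfolding G0(3) by (intro V.span_least q mfilt_subspace SR GM)
  have le: "V.sdim (mfilt S0 W i) \<le> V.sdim (mfilt S G (Suc p * i + q))" for i
  proof -
    obtain H where H: "finite H" "H \<subseteq> carrier M" "mfilt S G (Suc p * i + q) = V.span H"
      using mfilt_finite_dim[OF SR GM assms(1,3)] .
    have WM: "W \<subseteq> carrier M"
      using W mfilt_closed[OF SR GM] by blast
    have "mfilt_gens S0 W i \<subseteq> mfilt S G (Suc p * i + q)"
      using alg.filt_subset_filt[OF SR S0R p', of i] W act_mfilt[OF SR GM, of _ "Suc p * i" _ q] by blast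
    then have "mfilt S0 W i \<subseteq> mfilt S G (Suc p * i + q)"
      unfolding mfilt_def[of S0] by (intro V.span_least mfilt_subspace SR GM)
    then show ?thesis
      using V.sdim_mono[of H "mfilt_gens S0 W i"] H
        mfilt_gens_closed[OF S0R WM, of i] unfolding mfilt_def[of S0] by simp
  qed
  have "growth_exponent (\<lambda>i. V.sdim (mfilt S0 W i)) + ereal (real 0) \<le> growth_exponent (\<lambda>i. V.sdim (mfilt S G i))"
    by (rule growth_exponent_add_le[of 1 "Suc p" _ 0 _ q]) (use le in auto)
  then show ?thesis
    unfolding GK_module_def Let_def S0_def[symmetric] W_def[symmetric] mfilt_def subspace_dim_def
    by (simp add: zero_ereal_def[symmetric])
qed

end

text \<open>Images of generators generate the image, and linear maps do not raise dimensions.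
  Applied to the map onto the quotient by 0, this carries the lower bound
  \<open>holonomic_number\<close> from a copy in the prescribed type to the module itself.\<close>

lemma GK_module_surj_le:
  assumes "algebra_module K R M" "algebra_module K R N" "fg_algebra K R" "fg_module R M"
    and \<phi>: "\<phi> ` carrier M = carrier N"
      "\<And>x y. \<lbrakk>x \<in> carrier M; y \<in> carrier M\<rbrakk> \<Longrightarrow> \<phi> (x \<oplus>\<^bsub>M\<^esub> y) = \<phi> x \<oplus>\<^bsub>N\<^esub> \<phi> y"
      "\<And>r x. \<lbrakk>r \<in> carrier R; x \<in> carrier M\<rbrakk> \<Longrightarrow> \<phi> (r \<odot>\<^bsub>M\<^esub> x) = r \<odot>\<^bsub>N\<^esub> \<phi> x"
  shows "GK_module K R N \<le> GK_module K R M"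
proof -
  interpret M: algebra_module K R M by fact
  interpret N: algebra_module K R N by fact
  define S where "S = chosen_generators K R"
  define W where "W = (SOME W. generating_subspace K R M W)"
  have S: "finite S" "algebra_generators K R S"
    using chosen_generatorsD[OF assms(3)] unfolding S_def by blast+
  have SR: "S \<subseteq> carrier R"
    using S by (auto simp: algebra_generators_def)
  have "generating_subspace K R M W"
    unfolding W_def by (rule someI_ex[OF M.generating_subspace_exists[OF assms(4)]])
  then obtain G where G: "finite G" "G \<subseteq> carrier M" "W = M.V.span G" "module_generators R M G"
    by (rule M.generating_subspaceE)
  interpret \<phi>: linear_map K M.VM N.VM \<phi>
  proof (intro linear_map.intro mod_hom.intro mod_hom_axioms.intro M.V.vectorspace_axioms
      N.V.vectorspace_axioms M.V.module_axioms N.V.module_axioms)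
    show "\<phi> \<in> module_hom K M.VM N.VM"
      using \<phi> by (auto simp: module_hom_def)
  qed
  have gen: "module_generators R N (\<phi> ` G)"
    unfolding module_generators_def
  proof (intro conjI allI impI)
    show "\<phi> ` G \<subseteq> carrier N" using G \<phi> by blast
    fix P assume P: "Module.submodule P R N \<and> \<phi> ` G \<subseteq> P"
    then have "Module.submodule P R N" by blast
    note P' = N.mod.left_submoduleD[OF this]
    have "Module.submodule {x \<in> carrier M. \<phi> x \<in> P} R M"
      using P' \<phi>(2,3) \<phi>.f0_is_0 M.mod.smult_closed by (intro M.mod.left_submoduleI) auto
    then have "{x \<in> carrier M. \<phi> x \<in> P} = carrier M"
      using G P unfolding module_generators_def by blast
    then have "\<phi> x \<in> P" if "x \<in> carrier M" for x
      using that by (metis (mono_tags, lifting) mem_Collect_eq)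
    then show "P = carrier N"
      using P'(1) unfolding \<phi>(1)[symmetric] by (intro equalityI) (simp, blast)
  qed
  have le: "N.V.sdim (N.mfilt S (\<phi> ` G) i) \<le> M.V.sdim (M.mfilt S G i)" for i
  proof -
    obtain H where H: "finite H" "H \<subseteq> carrier M" "M.mfilt S G i = M.V.span H"
      using M.mfilt_finite_dim[OF SR G(2) S(1) G(1)] .
    let ?X = "{r \<odot>\<^bsub>M\<^esub> m | r m. r \<in> M.alg.filt S i \<and> m \<in> G}"
    have "{r \<odot>\<^bsub>N\<^esub> m | r m. r \<in> M.alg.filt S i \<and> m \<in> \<phi> ` G} = \<phi> ` ?X"
    proof safe
      fix r m assume "r \<in> M.alg.filt S i" "m \<in> G"
      moreover then have "\<phi> (r \<odot>\<^bsub>M\<^esub> m) = r \<odot>\<^bsub>N\<^esub> \<phi> m"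
        using \<phi>(3) M.alg.filt_closed[OF SR] G by blast
      ultimately show "r \<odot>\<^bsub>N\<^esub> \<phi> m \<in> \<phi> ` ?X" "\<exists>r' m'. \<phi> (r \<odot>\<^bsub>M\<^esub> m) = r' \<odot>\<^bsub>N\<^esub> m' \<and> r' \<in> M.alg.filt S i \<and> m' \<in> \<phi> ` G"
        by (metis (mono_tags, lifting) imageI mem_Collect_eq, blast)
    qed
    then have "N.mfilt S (\<phi> ` G) i = N.V.span (\<phi> ` ?X)"
      unfolding N.mfilt_def by simp
    moreover have "N.V.sdim (N.V.span (\<phi> ` ?X)) \<le> M.V.sdim (M.V.span H)"
      using H M.mfilt_gens_closed[OF SR G(2)] by (intro \<phi>.sdim_image_le) (auto simp: M.mfilt_def)
    ultimately show ?thesis using H by simp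
  qed
  \<comment> \<open>\<open>GK_module\<close> multiplies by all of \<open>W\<close>, whereas the
    bound for \<open>N\<close> starts from the finite set \<open>G\<close> that spans
    \<open>W\<close>. Both lead to the same subspaces.\<close>
  have le': "M.V.sdim (M.mfilt S G i) \<le> M.V.sdim (M.mfilt S W i)" for i
  proof -
    have W: "W \<subseteq> carrier M" "G \<subseteq> W"
      using G M.V.span_is_subset2[of G] M.V.in_own_span[of G] by auto
    obtain E where E: "finite E" "E \<subseteq> carrier R" "M.alg.filt S i = M.alg.span E"
      using M.alg.filt_finite_dim[OF SR S(1)] .
    obtain H where H: "finite H" "H \<subseteq> carrier M" "M.mfilt S G i = M.V.span H"
      using M.mfilt_finite_dim[OF SR G(2) S(1) G(1)] .
    have "r \<odot>\<^bsub>M\<^esub> m \<in> M.V.span H" if "r \<in> M.alg.filt S i" "m \<in> W" for r m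
    proof (rule M.act_mem_subspace[of r "M.alg.filt S i" m G])
      show "r \<in> M.alg.span (M.alg.filt S i)"
        using that M.alg.subspace_span_eq[OF M.alg.filt_subspace[OF SR]] by simp
      show "VectorSpace.subspace K (M.V.span H) M.VM"
        using H by (intro M.V.span_is_subspace) auto
      show "x \<odot>\<^bsub>M\<^esub> y \<in> M.V.span H" if "x \<in> M.alg.filt S i" "y \<in> G" for x y
        using M.mfiltI[OF SR G(2) that] H by simp
    qed (use that G M.alg.filt_closed[OF SR] in auto)
    then have "M.mfilt S W i \<subseteq> M.mfilt S G i"
      unfolding M.mfilt_def[of S W] using H by (intro M.V.span_least M.mfilt_subspace[OF SR G(2)]) auto
    moreover have "M.mfilt S G i \<subseteq> M.mfilt S W i"
      unfolding M.mfilt_def using W by (intro M.V.span_is_monotone) blast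
    ultimately show ?thesis by simp
  qed
  have "GK_module K R N \<le> growth_exponent (\<lambda>i. N.V.sdim (N.mfilt S (\<phi> ` G) i))"
    using N.GK_module_le[OF S _ gen] G by simp
  also have "\<dots> \<le> growth_exponent (\<lambda>i. M.V.sdim (M.mfilt S W i))"
    using growth_exponent_add_le[of 1 1 "\<lambda>i. N.V.sdim (N.mfilt S (\<phi> ` G) i)" 0 "\<lambda>i. M.V.sdim (M.mfilt S W i)" 0]
      order_trans[OF le le'] by (simp add: zero_ereal_def[symmetric])
  also have "\<dots> = GK_module K R M"
    unfolding GK_module_def Let_def S_def[symmetric] W_def[symmetric] M.mfilt_def subspace_dim_def ..
  finally show ?thesis .
qed

section \<open>Growth of commutative algebras\<close>

text \<open>The exponent \<open>n\<close> is the largest size of a set of indices all of whose multisets belong to \<open>D\<close>: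
  any larger set \<open>T\<close> carries a multiset outside \<open>D\<close>, so in the members of \<open>D\<close> at most \<open>n\<close>
  multiplicities exceed a common bound.\<close>

lemma downset_growth:
  fixes D :: "nat multiset set"
  assumes k: "\<And>\<alpha>. \<alpha> \<in> D \<Longrightarrow> set_mset \<alpha> \<subseteq> {..<k}"
    and down: "\<And>\<alpha> \<beta>. \<lbrakk>\<alpha> \<in> D; \<beta> \<subseteq># \<alpha>\<rbrakk> \<Longrightarrow> \<beta> \<in> D"
    and empty: "{#} \<in> D"
  obtains n :: nat and c C :: real where "0 < c"
    "\<And>i. c * real i ^ n \<le> real (card {\<alpha> \<in> D. size \<alpha> \<le> i})"
    "\<And>i. 0 < i \<Longrightarrow> real (card {\<alpha> \<in> D. size \<alpha> \<le> i}) \<le> C * real i ^ n"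
    "\<And>i. finite {\<alpha> \<in> D. size \<alpha> \<le> i}"
proof -
  define full where "full T \<longleftrightarrow> T \<subseteq> {..<k} \<and> (\<forall>\<alpha>. set_mset \<alpha> \<subseteq> T \<longrightarrow> \<alpha> \<in> D)" for T
  define n where "n = Max (card ` {T. full T})"
  have fin_full: "finite {T. full T}"
    by (rule finite_subset[of _ "Pow {..<k}"]) (auto simp: full_def)
  have "full {}"
    using empty by (auto simp: full_def)
  then have "n \<in> card ` {T. full T}"
    unfolding n_def using fin_full by (intro Max_in) auto
  then obtain T where T: "full T" "card T = n" by auto
  have finT: "finite T"
    using T by (auto simp: full_def intro: finite_subset)
  have le_n: "card T' \<le> n" if "full T'" for T'
    unfolding n_def using fin_full that by (intro Max_ge) auto

  \<comment> \<open>By maximality of \<open>n\<close> no \<open>T\<close> with \<open>n + 1\<close>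
    elements is full, and \<open>bad T\<close> witnesses this. The sizes of these witnesses are at
    most \<open>m\<close>, so a multiset with \<open>m\<close> copies of each element of
    \<open>T\<close> contains \<open>bad T\<close> and cannot belong to the downset
    \<open>D\<close>.\<close>
  define bad where "bad T = (SOME \<alpha>. set_mset \<alpha> \<subseteq> T \<and> \<alpha> \<notin> D)" for T
  define m where "m = (\<Sum>T\<in>Pow {..<k}. size (bad T))"
  have bad: "set_mset (bad T) \<subseteq> T" "bad T \<notin> D" "size (bad T) \<le> m"
    if "T \<subseteq> {..<k}" "card T = Suc n" for T
  proof -
    have "\<not> full T" using le_n[of T] that by auto
    then have "\<exists>\<alpha>. set_mset \<alpha> \<subseteq> T \<and> \<alpha> \<notin> D" using that by (auto simp: full_def)
    from someI_ex[OF this] show "set_mset (bad T) \<subseteq> T" "bad T \<notin> D" by (auto simp: bad_def)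
    show "size (bad T) \<le> m"
      unfolding m_def using that by (intro member_le_sum) auto
  qed
  define big where "big \<alpha> = {j \<in> {..<k}. m \<le> count \<alpha> j}" for \<alpha>
  have big: "card (big \<alpha>) \<le> n" if "\<alpha> \<in> D" for \<alpha>
  proof (rule ccontr)
    assume "\<not> card (big \<alpha>) \<le> n"
    then obtain U where U: "U \<subseteq> big \<alpha>" "card U = Suc n"
      using obtain_subset_with_card_n[of "Suc n" "big \<alpha>"] by auto
    then have U': "U \<subseteq> {..<k}" by (auto simp: big_def)
    have "bad U \<subseteq># \<alpha>"
    proof (rule mset_subset_eqI)
      fix j
      show "count (bad U) j \<le> count \<alpha> j"
      proof (cases "j \<in> U")
        case True
        have "count (bad U) j \<le> m"
          using bad(3)[OF U' U(2)] count_le_size[of "bad U" j] by linarith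
        then show ?thesis using True U(1) by (auto simp: big_def)
      next
        case False
        then have "count (bad U) j = 0"
          using bad(1)[OF U' U(2)] by (auto simp: count_eq_zero_iff)
        then show ?thesis by simp
      qed
    qed
    then show False
      using down[OF that] bad(2)[OF U' U(2)] by blast
  qed

  \<comment> \<open>An element of \<open>D\<close> is determined by its multiplicities below
    \<open>k\<close>. At the at most \<open>n\<close> indices in \<open>big \<alpha>\<close> they
    are bounded by \<open>i\<close>, elsewhere they are less than \<open>m\<close>. So the part of
    \<open>D\<close> up to size \<open>i\<close> is covered by at most \<open>2 ^ k\<close> boxes,
    one for each candidate for \<open>big \<alpha>\<close>.\<close>
  define box where "box i T = PiE {..<k} (\<lambda>j. if j \<in> T then {..i} else {..<m})" for i T
  define P where "P = {T. T \<subseteq> {..<k} \<and> card T \<le> n}"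
  have finP: "finite P"
    by (rule finite_subset[of _ "Pow {..<k}"]) (auto simp: P_def)
  have card_P: "card P \<le> 2 ^ k"
  proof -
    have "card P \<le> card (Pow {..<k})"
      by (intro card_mono) (auto simp: P_def)
    then show ?thesis by (simp add: card_Pow)
  qed
  have fin_box: "finite (box i T)" for i T
    unfolding box_def by (intro finite_PiE) auto
  have card_box: "card (box i T) \<le> Suc i ^ n * Suc m ^ k" if "T \<in> P" for i T
  proof -
    have T: "T \<subseteq> {..<k}" "card T \<le> n" using that by (auto simp: P_def)
    have "card (box i T) = (\<Prod>j<k. if j \<in> T then Suc i else m)"
      unfolding box_def by (subst card_PiE) (auto intro!: prod.cong)
    \<comment> \<open>Padding every factor with \<open>Suc m\<close> separates the power of
      \<open>Suc i\<close> from a constant.\<close>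
    also have "\<dots> \<le> (\<Prod>j<k. (if j \<in> T then Suc i else 1) * Suc m)"
      by (intro prod_mono) auto
    also have "\<dots> = (\<Prod>j<k. if j \<in> T then Suc i else 1) * Suc m ^ k"
      by (simp only: prod.distrib prod_constant card_lessThan)
    also have "(\<Prod>j<k. if j \<in> T then Suc i else 1) = Suc i ^ card T"
      using T(1) by (simp add: prod.If_cases Int_absorb1)
    also have "\<dots> * Suc m ^ k \<le> Suc i ^ n * Suc m ^ k"
      using T(2) by (intro mult_right_mono power_increasing) auto
    finally show ?thesis .
  qed
  define enc where "enc \<alpha> = restrict (count \<alpha>) {..<k}" for \<alpha> :: "nat multiset"
  have inj: "inj_on enc D"
  proof (rule inj_onI, rule multiset_eqI)
    fix \<alpha> \<beta> j assume *: "\<alpha> \<in> D" "\<beta> \<in> D" "enc \<alpha> = enc \<beta>"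
    show "count \<alpha> j = count \<beta> j"
    proof (cases "j < k")
      case True
      then show ?thesis using fun_cong[OF *(3), of j] by (simp add: enc_def)
    next
      case False
      then have "j \<notin># \<alpha>" "j \<notin># \<beta>" using k[of \<alpha>] k[of \<beta>] * by auto
      then show ?thesis by (metis count_eq_zero_iff)
    qed
  qed
  have enc_box: "enc ` {\<alpha> \<in> D. size \<alpha> \<le> i} \<subseteq> (\<Union>T\<in>P. box i T)" for i
  proof clarify
    fix \<alpha> assume \<alpha>: "\<alpha> \<in> D" "size \<alpha> \<le> i"
    have "big \<alpha> \<in> P"
      using big[OF \<alpha>(1)] by (auto simp: P_def big_def)
    moreover have "count \<alpha> j \<le> i" for j
      using \<alpha>(2) count_le_size[of \<alpha> j] by linarith
    then have "enc \<alpha> \<in> box i (big \<alpha>)"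
      by (auto simp: enc_def box_def big_def)
    ultimately show "enc \<alpha> \<in> (\<Union>T\<in>P. box i T)" by blast
  qed
  have fin: "finite {\<alpha> \<in> D. size \<alpha> \<le> i}" for i
  proof (rule finite_imageD)
    show "finite (enc ` {\<alpha> \<in> D. size \<alpha> \<le> i})"
      by (rule finite_subset[OF enc_box]) (use finP fin_box in auto)
    show "inj_on enc {\<alpha> \<in> D. size \<alpha> \<le> i}"
      by (rule inj_on_subset[OF inj]) auto
  qed
  have upper: "card {\<alpha> \<in> D. size \<alpha> \<le> i} \<le> 2 ^ k * (Suc i ^ n * Suc m ^ k)" for i
  proof -
    have "card {\<alpha> \<in> D. size \<alpha> \<le> i} = card (enc ` {\<alpha> \<in> D. size \<alpha> \<le> i})"
      by (intro card_image[symmetric] inj_on_subset[OF inj]) auto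
    also have "\<dots> \<le> card (\<Union>T\<in>P. box i T)"
      using finP fin_box by (intro card_mono enc_box) auto
    also have "\<dots> \<le> (\<Sum>T\<in>P. card (box i T))"
      using finP by (rule card_UN_le)
    also have "\<dots> \<le> (\<Sum>T\<in>P. Suc i ^ n * Suc m ^ k)"
      by (intro sum_mono card_box)
    also have "\<dots> = card P * (Suc i ^ n * Suc m ^ k)" by simp
    also have "\<dots> \<le> 2 ^ k * (Suc i ^ n * Suc m ^ k)"
      using card_P by (intro mult_right_mono) auto
    finally show ?thesis .
  qed
  have upper': "real (card {\<alpha> \<in> D. size \<alpha> \<le> i}) \<le> (2 ^ k * real (Suc m) ^ k * 2 ^ n) * real i ^ n"
    if "0 < i" for i
  proof -
    have "real (card {\<alpha> \<in> D. size \<alpha> \<le> i}) \<le> real (2 ^ k * (Suc i ^ n * Suc m ^ k))"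
      using upper[of i] by (intro of_nat_mono)
    also have "\<dots> = (2 ^ k * real (Suc m) ^ k) * real (Suc i) ^ n"
      by (simp add: algebra_simps)
    also have "\<dots> \<le> (2 ^ k * real (Suc m) ^ k) * (2 * real i) ^ n"
      using that by (intro mult_left_mono power_mono) auto
    finally show ?thesis by (simp add: power_mult_distrib algebra_simps)
  qed

  define dec where "dec f = (\<Sum>j\<in>T. replicate_mset (f j) j)" for f :: "nat \<Rightarrow> nat"
  have count_dec: "count (dec f) j = (if j \<in> T then f j else 0)" for f j
  proof -
    have "count (dec f) j = (\<Sum>l\<in>T. if l = j then f l else 0)"
      unfolding dec_def count_sum by (intro sum.cong) auto
    then show ?thesis using finT by simp
  qed
  \<comment> \<open>All multisets on the full set \<open>T\<close> belong to \<open>D\<close>.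
    Multiplicities up to \<open>i div Suc n\<close> on its \<open>n\<close> elements keep the size
    at most \<open>i\<close>; the divisor \<open>Suc n\<close> stays positive when
    \<open>n = 0\<close>.\<close>
  have lower: "Suc (i div Suc n) ^ n \<le> card {\<alpha> \<in> D. size \<alpha> \<le> i}" for i
  proof -
    let ?F = "PiE T (\<lambda>_. {..i div Suc n})"
    have cardF: "card ?F = Suc (i div Suc n) ^ n"
      using finT T by (simp add: card_PiE)
    have inj_dec: "inj_on dec ?F"
    proof (rule inj_onI)
      fix f g assume fg: "f \<in> ?F" "g \<in> ?F" "dec f = dec g"
      have "f j = g j" if "j \<in> T" for j
        using count_dec[of f j] count_dec[of g j] fg(3) that by simp
      then show "f = g" using fg(1,2) by (intro PiE_ext[of f T _ g]) auto
    qed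
    have dec_F: "dec ` ?F \<subseteq> {\<alpha> \<in> D. size \<alpha> \<le> i}"
    proof clarify
      fix f assume f: "f \<in> ?F"
      have "set_mset (dec f) \<subseteq> T"
      proof
        fix j assume "j \<in># dec f"
        then have "count (dec f) j \<noteq> 0" by simp
        then show "j \<in> T" using count_dec[of f j] by (auto split: if_splits)
      qed
      then have "dec f \<in> D" using T(1) by (auto simp: full_def)
      moreover have "size (dec f) = (\<Sum>j\<in>T. f j)"
        unfolding dec_def size_multiset_sum by simp
      moreover have "(\<Sum>j\<in>T. f j) \<le> (\<Sum>j\<in>T. i div Suc n)"
        using f by (intro sum_mono) auto
      moreover have "(\<Sum>j\<in>T. i div Suc n) \<le> i"
      proof -
        have "n * (i div Suc n) \<le> Suc n * (i div Suc n)" by simp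
        also have "\<dots> \<le> i" by (rule times_div_less_eq_dividend)
        finally show ?thesis using T(2) by simp
      qed
      ultimately show "dec f \<in> D \<and> size (dec f) \<le> i" by linarith
    qed
    show ?thesis
      using card_inj_on_le[OF inj_dec dec_F fin] unfolding cardF .
  qed
  have lower': "(1 / real (Suc n) ^ n) * real i ^ n \<le> real (card {\<alpha> \<in> D. size \<alpha> \<le> i})" for i
  proof -
    have "i < Suc n * Suc (i div Suc n)"
      using dividend_less_times_div[of "Suc n" i] by simp
    then have "real i \<le> real (Suc n * Suc (i div Suc n))"
      by (intro of_nat_mono less_imp_le)
    then have "real i \<le> real (Suc (i div Suc n)) * real (Suc n)"
      by (simp only: of_nat_mult mult.commute)
    then have "real i / real (Suc n) \<le> real (Suc (i div Suc n))"
      by (subst pos_divide_le_eq) auto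
    then have "(real i / real (Suc n)) ^ n \<le> real (Suc (i div Suc n)) ^ n"
      by (intro power_mono) auto
    also have "\<dots> \<le> real (card {\<alpha> \<in> D. size \<alpha> \<le> i})"
      using of_nat_mono[OF lower[of i], where ?'a = real] by simp
    finally show ?thesis by (simp add: power_divide)
  qed
  show ?thesis
    by (rule that[OF _ lower' upper' fin]) auto
qed

section \<open>Standard monomials of a commutative algebra\<close>

locale comm_algebra_family = assoc_algebra K A + C: cring A
  for K :: "'k ring" and A :: "('k, 'a) module" (structure) +
  fixes x :: "nat \<Rightarrow> 'a" and k :: nat
  assumes x_closed: "\<And>j. j < k \<Longrightarrow> x j \<in> carrier A"
begin

definition mon :: "nat multiset \<Rightarrow> 'a" where
  "mon \<alpha> = (\<Otimes>j\<in>{..<k}. x j [^] count \<alpha> j)"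

definition exps :: "nat multiset set" where
  "exps = {\<alpha>. set_mset \<alpha> \<subseteq> {..<k}}"

lemma mon_closed [simp, intro]: "mon \<alpha> \<in> carrier A"
  unfolding mon_def using x_closed by (intro C.finprod_closed) auto

lemma mon_add: "mon (\<alpha> + \<beta>) = mon \<alpha> \<otimes> mon \<beta>"
proof -
  have "mon (\<alpha> + \<beta>) = (\<Otimes>j\<in>{..<k}. x j [^] count \<alpha> j \<otimes> x j [^] count \<beta> j)"
    unfolding mon_def using x_closed by (intro C.finprod_cong') (auto simp: A.nat_pow_mult)
  then show ?thesis
    unfolding mon_def using x_closed by (subst (asm) C.finprod_multf) auto
qed

lemma mon_empty: "mon {#} = \<one>"
  unfolding mon_def by (intro C.finprod_one_eqI) auto

lemma mon_single:
  assumes "j < k"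
  shows "mon {#j#} = x j"
proof -
  have "mon {#j#} = (\<Otimes>i\<in>{..<k}. if j = i then x i else \<one>)"
    unfolding mon_def using x_closed by (intro C.finprod_cong') auto
  also have "\<dots> = x j"
    using assms x_closed by (intro C.finprod_singleton) auto
  finally show ?thesis .
qed

text \<open>Commutativity sorts the factors of a word, so only the multiplicities of the generators
  matter. All sizes up to \<open>i\<close> occur because 1 belongs to the first step of the
  filtration.\<close>

lemma filt_eq_span_mon: "filt (x ` {..<k}) i = span {mon \<alpha> | \<alpha>. \<alpha> \<in> exps \<and> size \<alpha> \<le> i}"
proof
  let ?S = "x ` {..<k}"
  have S: "?S \<subseteq> carrier A" using x_closed by auto
  have X: "{mon \<alpha> | \<alpha>. \<alpha> \<in> exps \<and> size \<alpha> \<le> i} \<subseteq> carrier A" for i by auto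
  have "mon \<alpha> \<in> filt ?S (size \<alpha>)" if "\<alpha> \<in> exps" for \<alpha>
    using that
  proof (induction \<alpha>)
    case empty
    then show ?case using one_mem_filt[OF S, of 0] by (simp only: mon_empty size_empty)
  next
    case (add j \<alpha>)
    then have "j < k" "\<alpha> \<in> exps" by (auto simp: exps_def)
    then have "mon \<alpha> \<otimes> x j \<in> filt ?S (size \<alpha> + 1)"
      using add.IH generators_subset_filt[OF S] by (intro filt_mult[OF S]) auto
    moreover have "mon (add_mset j \<alpha>) = mon \<alpha> \<otimes> x j"
      using mon_add[of \<alpha> "{#j#}"] mon_single[OF \<open>j < k\<close>] by simp
    ultimately show ?case by (simp only: size_add_mset Suc_eq_plus1)
  qed
  then show "span {mon \<alpha> | \<alpha>. \<alpha> \<in> exps \<and> size \<alpha> \<le> i} \<subseteq> filt ?S i"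
    using filt_mono[OF S] by (intro span_least filt_subspace[OF S]) blast
  show "filt ?S i \<subseteq> span {mon \<alpha> | \<alpha>. \<alpha> \<in> exps \<and> size \<alpha> \<le> i}"
  proof (induction i)
    case 0
    have "{mon \<alpha> | \<alpha>. \<alpha> \<in> exps \<and> size \<alpha> \<le> 0} = {\<one>}"
      by (auto simp: exps_def mon_empty intro!: exI[of _ "{#}"])
    then show ?case by simp
  next
    case (Suc i)
    show ?case
    proof (rule filt_Suc_subset[OF S span_is_subspace[OF X]])
      fix y s assume y: "y \<in> filt ?S i" and s: "s \<in> insert \<one> ?S"
      obtain \<beta> where \<beta>: "\<beta> \<in> exps" "size \<beta> \<le> 1" "s = mon \<beta>"
      proof (cases "s = \<one>")
        case True
        then show ?thesis using that[of "{#}"] by (simp add: exps_def mon_empty)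
      next
        case False
        then obtain j where "j < k" "s = x j" using s by auto
        then show ?thesis using that[of "{#j#}"] mon_single by (simp add: exps_def)
      qed
      show "y \<otimes> s \<in> span {mon \<alpha> | \<alpha>. \<alpha> \<in> exps \<and> size \<alpha> \<le> Suc i}"
      proof (rule mult_mem_subspace[of y _ s "{s}", OF _ _ X _ span_is_subspace[OF X]])
        show "y \<in> span {mon \<alpha> | \<alpha>. \<alpha> \<in> exps \<and> size \<alpha> \<le> i}" using Suc y by blast
        show "{s} \<subseteq> carrier A" using \<beta> by simp
        then show "s \<in> span {s}" using in_own_span by blast
        fix a b assume "a \<in> {mon \<alpha> | \<alpha>. \<alpha> \<in> exps \<and> size \<alpha> \<le> i}" "b \<in> {s}"
        then obtain \<alpha> where "a = mon \<alpha>" "\<alpha> \<in> exps" "size \<alpha> \<le> i" "b = mon \<beta>" using \<beta> by auto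
        then have "a \<otimes> b = mon (\<alpha> + \<beta>)" "\<alpha> + \<beta> \<in> exps" "size (\<alpha> + \<beta>) \<le> Suc i"
          using \<beta> by (auto simp: mon_add exps_def)
        then show "a \<otimes> b \<in> span {mon \<alpha> | \<alpha>. \<alpha> \<in> exps \<and> size \<alpha> \<le> Suc i}"
          using in_own_span[OF X, of "Suc i"] by blast
      qed
    qed
  qed
qed

text \<open>The standard monomials below form a downset with respect to any well-ordering of the exponents
  that is compatible with addition.  Comparing the degrees first makes them a basis of each step of
  the filtration.\<close>

definition exp_less :: "nat multiset \<Rightarrow> nat multiset \<Rightarrow> bool" where
  "exp_less \<beta> \<alpha> \<longleftrightarrow> size \<beta> < size \<alpha> \<or> size \<beta> = size \<alpha> \<and> \<beta> < \<alpha>"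

lemma exp_less_add: "exp_less \<beta> \<alpha> \<Longrightarrow> exp_less (\<beta> + \<gamma>) (\<alpha> + \<gamma>)"
  by (auto simp: exp_less_def)

lemma exp_less_linear: "exp_less \<alpha> \<beta> \<or> \<alpha> = \<beta> \<or> exp_less \<beta> \<alpha>"
  unfolding exp_less_def by (metis less_linear)

lemma exp_less_trans: "exp_less \<alpha> \<beta> \<Longrightarrow> exp_less \<beta> \<gamma> \<Longrightarrow> exp_less \<alpha> \<gamma>"
  unfolding exp_less_def by auto

text \<open>Degrees are well-founded and so is the multiset order over the natural numbers, hence so
  is their lexicographic combination. Induction along it plays the role of a terminating reduction
  of monomials.\<close>

lemma exp_less_induct:
  assumes "\<And>\<alpha>. (\<And>\<beta>. exp_less \<beta> \<alpha> \<Longrightarrow> P \<beta>) \<Longrightarrow> P \<alpha>"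
  shows "P \<alpha>"
proof -
  have "wf (size <*mlex*> {(\<beta> :: nat multiset, \<alpha>). \<beta> < \<alpha>})"
    by (intro wf_mlex wf)
  then show ?thesis
  proof (induction rule: wf_induct_rule)
    case (less \<alpha>)
    show ?case
      by (rule assms, rule less) (simp add: mlex_iff exp_less_def)
  qed
qed

lemma finite_exp_max:
  assumes "finite E" "E \<noteq> {}"
  obtains \<alpha> where "\<alpha> \<in> E" "\<And>\<beta>. \<beta> \<in> E \<Longrightarrow> \<beta> \<noteq> \<alpha> \<Longrightarrow> exp_less \<beta> \<alpha>"
proof -
  have "\<exists>\<alpha>\<in>E. \<forall>\<beta>\<in>E. \<beta> \<noteq> \<alpha> \<longrightarrow> exp_less \<beta> \<alpha>"
    using assms
  proof (induction rule: finite_ne_induct)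
    case (insert \<gamma> E)
    then obtain \<alpha> where "\<alpha> \<in> E" "\<forall>\<beta>\<in>E. \<beta> \<noteq> \<alpha> \<longrightarrow> exp_less \<beta> \<alpha>" by blast
    then show ?case
      using exp_less_linear[of \<gamma> \<alpha>] exp_less_trans by (metis insert_iff)
  qed auto
  then show ?thesis using that by blast
qed

definition lower_mons :: "nat multiset \<Rightarrow> 'a set" where
  "lower_mons \<alpha> = {mon \<beta> | \<beta>. \<beta> \<in> exps \<and> exp_less \<beta> \<alpha>}"

text \<open>In the language of Groebner bases these are the exponents outside the initial ideal of
  the relations among the \<open>x j\<close>: membership of \<open>mon \<alpha>\<close> in the span
  means that some relation has leading exponent \<open>\<alpha>\<close>.\<close>

definition std :: "nat multiset set" where
  "std = {\<alpha> \<in> exps. mon \<alpha> \<notin> span (lower_mons \<alpha>)}"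

lemma lower_mons_closed: "lower_mons \<alpha> \<subseteq> carrier A"
  by (auto simp: lower_mons_def)

text \<open>A representation of \<open>mon \<beta>\<close> by smaller monomials can be multiplied by
  \<open>mon \<gamma>\<close>. Adding \<open>\<gamma>\<close> preserves the order, so
  \<open>\<beta> + \<gamma>\<close> would not be standard either.\<close>

lemma std_downset:
  assumes "\<alpha> \<in> std" "\<beta> \<subseteq># \<alpha>"
  shows "\<beta> \<in> std"
proof (rule ccontr)
  assume "\<beta> \<notin> std"
  obtain \<gamma> where \<alpha>: "\<alpha> = \<beta> + \<gamma>"
    using assms(2) by (metis subset_mset.add_diff_inverse)
  then have exps: "\<beta> \<in> exps" "\<gamma> \<in> exps"
    using assms(1) by (auto simp: std_def exps_def)
  then have "mon \<beta> \<in> span (lower_mons \<beta>)"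
    using \<open>\<beta> \<notin> std\<close> by (auto simp: std_def)
  moreover have "mon \<gamma> \<in> span {mon \<gamma>}"
    using in_own_span[of "{mon \<gamma>}"] by auto
  ultimately have "mon \<beta> \<otimes> mon \<gamma> \<in> span (lower_mons \<alpha>)"
  proof (rule mult_mem_subspace[OF _ _ lower_mons_closed _ span_is_subspace[OF lower_mons_closed]])
    fix a b assume "a \<in> lower_mons \<beta>" "b \<in> {mon \<gamma>}"
    then obtain \<delta> where "\<delta> \<in> exps" "exp_less \<delta> \<beta>" "a \<otimes> b = mon (\<delta> + \<gamma>)"
      by (auto simp: lower_mons_def mon_add)
    then have "a \<otimes> b \<in> lower_mons \<alpha>"
      using exps exp_less_add[of \<delta> \<beta> \<gamma>]
      by (auto simp: lower_mons_def \<alpha> exps_def intro!: exI[of _ "\<delta> + \<gamma>"])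
    then show "a \<otimes> b \<in> span (lower_mons \<alpha>)"
      using in_own_span[OF lower_mons_closed] by blast
  qed auto
  then show False
    using assms(1) by (simp add: std_def \<alpha> mon_add)
qed

text \<open>A nonstandard monomial is a combination of smaller ones, to which induction applies. As
  the order compares degrees first, no degree grows on the way; this makes the basis compatible with
  the filtration.\<close>

lemma mon_in_span_std: "\<alpha> \<in> exps \<Longrightarrow> mon \<alpha> \<in> span {mon \<beta> | \<beta>. \<beta> \<in> std \<and> size \<beta> \<le> size \<alpha>}"
proof (induction \<alpha> rule: exp_less_induct)
  case (1 \<alpha>)
  have cl: "{mon \<beta> | \<beta>. \<beta> \<in> std \<and> size \<beta> \<le> n} \<subseteq> carrier A" for n by auto
  show ?case
  proof (cases "\<alpha> \<in> std")
    case True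
    then show ?thesis using in_own_span[OF cl, of "size \<alpha>"] by blast
  next
    case False
    have "lower_mons \<alpha> \<subseteq> span {mon \<beta> | \<beta>. \<beta> \<in> std \<and> size \<beta> \<le> size \<alpha>}"
    proof
      fix y assume "y \<in> lower_mons \<alpha>"
      then obtain \<beta> where \<beta>: "y = mon \<beta>" "\<beta> \<in> exps" "exp_less \<beta> \<alpha>" by (auto simp: lower_mons_def)
      have "span {mon \<gamma> | \<gamma>. \<gamma> \<in> std \<and> size \<gamma> \<le> size \<beta>} \<subseteq> span {mon \<gamma> | \<gamma>. \<gamma> \<in> std \<and> size \<gamma> \<le> size \<alpha>}"
        using \<beta>(3) by (intro span_is_monotone) (auto simp: exp_less_def)
      then show "y \<in> span {mon \<beta> | \<beta>. \<beta> \<in> std \<and> size \<beta> \<le> size \<alpha>}"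
        using 1(1)[OF \<beta>(3,2)] \<beta>(1) by blast
    qed
    then have "span (lower_mons \<alpha>) \<subseteq> span {mon \<beta> | \<beta>. \<beta> \<in> std \<and> size \<beta> \<le> size \<alpha>}"
      by (intro span_mono_span cl)
    then show ?thesis using False 1(2) by (auto simp: std_def)
  qed
qed

lemma filt_eq_span_std: "filt (x ` {..<k}) i = span (mon ` {\<alpha> \<in> std. size \<alpha> \<le> i})"
proof -
  have cl: "mon ` {\<alpha> \<in> std. size \<alpha> \<le> i} \<subseteq> carrier A" by auto
  have "span {mon \<alpha> | \<alpha>. \<alpha> \<in> exps \<and> size \<alpha> \<le> i} \<subseteq> span (mon ` {\<alpha> \<in> std. size \<alpha> \<le> i})"
  proof (rule span_mono_span[OF _ cl], clarify)
    fix \<alpha> assume \<alpha>: "\<alpha> \<in> exps" "size \<alpha> \<le> i"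
    have "span {mon \<beta> | \<beta>. \<beta> \<in> std \<and> size \<beta> \<le> size \<alpha>} \<subseteq> span (mon ` {\<alpha> \<in> std. size \<alpha> \<le> i})"
      using \<alpha> by (intro span_is_monotone) auto
    then show "mon \<alpha> \<in> span (mon ` {\<alpha> \<in> std. size \<alpha> \<le> i})"
      using mon_in_span_std[OF \<alpha>(1)] by blast
  qed
  moreover have "span (mon ` {\<alpha> \<in> std. size \<alpha> \<le> i}) \<subseteq> span {mon \<alpha> | \<alpha>. \<alpha> \<in> exps \<and> size \<alpha> \<le> i}"
    by (intro span_is_monotone) (auto simp: std_def)
  ultimately show ?thesis
    unfolding filt_eq_span_mon by blast
qed

text \<open>In a nontrivial relation the monomial with the largest exponent among those with nonzero
  coefficient would be a combination of smaller ones.\<close>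

lemma std_mons_indep:
  assumes "finite E" "E \<subseteq> std" "c \<in> E \<rightarrow> carrier K" "(\<Oplus>\<alpha>\<in>E. c \<alpha> \<odot> mon \<alpha>) = \<zero>" "\<alpha> \<in> E"
  shows "c \<alpha> = \<zero>\<^bsub>K\<^esub>"
proof (rule ccontr)
  assume "c \<alpha> \<noteq> \<zero>\<^bsub>K\<^esub>"
  then have "finite {\<alpha> \<in> E. c \<alpha> \<noteq> \<zero>\<^bsub>K\<^esub>}" "{\<alpha> \<in> E. c \<alpha> \<noteq> \<zero>\<^bsub>K\<^esub>} \<noteq> {}"
    using assms by auto
  then obtain \<mu> where \<mu>: "\<mu> \<in> E" "c \<mu> \<noteq> \<zero>\<^bsub>K\<^esub>"
    and max: "\<And>\<beta>. \<beta> \<in> E \<Longrightarrow> c \<beta> \<noteq> \<zero>\<^bsub>K\<^esub> \<Longrightarrow> \<beta> \<noteq> \<mu> \<Longrightarrow> exp_less \<beta> \<mu>"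
    using finite_exp_max[of "{\<alpha> \<in> E. c \<alpha> \<noteq> \<zero>\<^bsub>K\<^esub>}"] by (metis (mono_tags, lifting) mem_Collect_eq)
  let ?W = "span (lower_mons \<mu>)"
  have sub: "VectorSpace.subspace K ?W A"
    by (rule span_is_subspace[OF lower_mons_closed])
  note W = subspace_memD[OF sub]
  have c: "c \<beta> \<in> carrier K" if "\<beta> \<in> E" for \<beta> using assms(3) that by auto
  define r where "r = (\<Oplus>\<alpha>\<in>E - {\<mu>}. c \<alpha> \<odot> mon \<alpha>)"
  have "c \<beta> \<odot> mon \<beta> \<in> ?W" if "\<beta> \<in> E - {\<mu>}" for \<beta>
  proof (cases "c \<beta> = \<zero>\<^bsub>K\<^esub>")
    case True
    then show ?thesis using W(2) by (simp add: smult_l_null)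
  next
    case False
    then have "mon \<beta> \<in> lower_mons \<mu>"
      using that max[of \<beta>] assms(2) by (auto simp: lower_mons_def std_def)
    then show ?thesis
      using W(4) c that in_own_span[OF lower_mons_closed] by blast
  qed
  then have r: "r \<in> ?W"
    unfolding r_def by (intro subspace_finsum_closed[OF sub]) auto
  then have rA: "r \<in> carrier A" using W(1) by blast
  have "(\<Oplus>\<alpha>\<in>insert \<mu> (E - {\<mu>}). c \<alpha> \<odot> mon \<alpha>) = c \<mu> \<odot> mon \<mu> \<oplus> r"
    unfolding r_def using assms(1) c \<mu>(1) by (intro finsum_insert) auto
  then have sum0: "c \<mu> \<odot> mon \<mu> \<oplus> r = \<zero>"
    using assms(4) insert_Diff[OF \<mu>(1)] by simp
  have cm: "c \<mu> \<odot> mon \<mu> \<in> carrier A" using c[OF \<mu>(1)] by simp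
  have "c \<mu> \<odot> mon \<mu> = \<ominus> r"
    using sum0 cm rA by (metis M.minus_equality)
  also have "\<dots> = (\<ominus>\<^bsub>K\<^esub> \<one>\<^bsub>K\<^esub>) \<odot> r"
    using rA by (simp add: smult_minus_1)
  finally have "c \<mu> \<odot> mon \<mu> \<in> ?W"
    using W(4) r by simp
  moreover have "inv\<^bsub>K\<^esub> c \<mu> \<in> carrier K"
    using c[OF \<mu>(1)] \<mu>(2) field_Units by (intro R.Units_inv_closed) blast
  ultimately have "inv\<^bsub>K\<^esub> c \<mu> \<odot> (c \<mu> \<odot> mon \<mu>) \<in> ?W"
    by (rule W(4)[rotated])
  then have "mon \<mu> \<in> ?W"
    using mult_inverse[OF c[OF \<mu>(1)] mon_closed refl \<mu>(2)] by simp
  then show False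
    using \<mu>(1) assms(2) by (auto simp: std_def)
qed

text \<open>This turns the dimension function of the algebra into the counting function of a downset
  of exponents.\<close>

lemma card_std_eq_sdim:
  assumes "finite {\<alpha> \<in> std. size \<alpha> \<le> i}"
  shows "card {\<alpha> \<in> std. size \<alpha> \<le> i} = sdim (filt (x ` {..<k}) i)"
proof (rule antisym)
  let ?E = "{\<alpha> \<in> std. size \<alpha> \<le> i}"
  show "card ?E \<le> sdim (filt (x ` {..<k}) i)"
    unfolding filt_eq_span_std
  proof (rule card_le_sdim[OF _ _ assms])
    show "mon \<in> ?E \<rightarrow> span (mon ` ?E)"
      using in_own_span[of "mon ` ?E"] by blast
  next
    fix c \<alpha> assume "c \<in> ?E \<rightarrow> carrier K" "(\<Oplus>\<alpha>\<in>?E. c \<alpha> \<odot> mon \<alpha>) = \<zero>" "\<alpha> \<in> ?E"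
    then show "c \<alpha> = \<zero>\<^bsub>K\<^esub>" by (intro std_mons_indep[OF assms]) auto
  qed (use assms in auto)
  have "sdim (filt (x ` {..<k}) i) \<le> card (mon ` ?E)"
    unfolding filt_eq_span_std using assms by (intro sdim_span_le_card) auto
  also have "\<dots> \<le> card ?E"
    using assms by (rule card_image_le)
  finally show "sdim (filt (x ` {..<k}) i) \<le> card ?E" .
qed

end

text \<open>Combines the basis of standard monomials with the growth of downsets. The lower bound is
  what allows the growth of \<open>C\<close> to be divided out of that of \<open>A\<close>.\<close>

lemma comm_algebra_growth:
  fixes K :: "'k ring" and A :: "('k, 'a) module"
  assumes "assoc_algebra K A" "cring A" "\<one>\<^bsub>A\<^esub> \<noteq> \<zero>\<^bsub>A\<^esub>" "finite S" "S \<subseteq> carrier A"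
  obtains n :: nat and c :: real where "0 < c"
    "\<And>i. c * real i ^ n \<le> real (subspace_dim K A (algebra_filtration K A S i))"
    "growth_exponent (\<lambda>i. subspace_dim K A (algebra_filtration K A S i)) \<le> ereal (real n)"
proof -
  interpret assoc_algebra K A by fact
  obtain k and x where S: "S = x ` {j. j < (k::nat)}"
    using finite_imp_nat_seg_image_inj_on[OF assms(4)] by blast
  interpret comm_algebra_family K A x k
    using assms(1,2,5) S by (auto intro!: comm_algebra_family.intro comm_algebra_family_axioms.intro)
  have S': "S = x ` {..<k}" using S by auto
  \<comment> \<open>No exponent is smaller than the empty one, so its standardness amounts to 1
    being nonzero.\<close>
  have empty: "{#} \<in> std"
  proof -
    have "lower_mons {#} = {}" by (auto simp: lower_mons_def exp_less_def)
    then show ?thesis using assms(3) by (simp add: std_def exps_def mon_empty span_empty)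
  qed
  have std_k: "\<And>\<alpha>. \<alpha> \<in> std \<Longrightarrow> set_mset \<alpha> \<subseteq> {..<k}"
    by (auto simp: std_def exps_def)
  obtain n c C where *: "0 < c"
    "\<And>i. c * real i ^ n \<le> real (card {\<alpha> \<in> std. size \<alpha> \<le> i})"
    "\<And>i. 0 < i \<Longrightarrow> real (card {\<alpha> \<in> std. size \<alpha> \<le> i}) \<le> C * real i ^ n"
    "\<And>i. finite {\<alpha> \<in> std. size \<alpha> \<le> i}"
    by (rule downset_growth[of std k], erule std_k, erule (1) std_downset, rule empty, rule that; assumption)
  have eq: "subspace_dim K A (algebra_filtration K A S i) = card {\<alpha> \<in> std. size \<alpha> \<le> i}" for i
    unfolding subspace_dim_def S' using card_std_eq_sdim[OF *(4)] by simp
  show ?thesis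
  proof (rule that[OF *(1)])
    show "c * real i ^ n \<le> real (subspace_dim K A (algebra_filtration K A S i))" for i
      unfolding eq by (rule *(2))
    have "\<forall>\<^sub>F i in sequentially. real (card {\<alpha> \<in> std. size \<alpha> \<le> i}) \<le> C * real i powr real n"
      using eventually_gt_at_top[of 0] by eventually_elim (use *(3) in \<open>simp add: powr_realpow\<close>)
    then show "growth_exponent (\<lambda>i. subspace_dim K A (algebra_filtration K A S i)) \<le> ereal (real n)"
      unfolding eq by (rule growth_exponent_leI)
  qed
qed

section \<open>Cyclic modules over an extension of scalars\<close>

lemma (in abelian_monoid) finsum_Times:
  assumes "finite I" "finite J" "\<And>i j. \<lbrakk>i \<in> I; j \<in> J\<rbrakk> \<Longrightarrow> f (i, j) \<in> carrier G"
  shows "(\<Oplus>x\<in>I \<times> J. f x) = (\<Oplus>i\<in>I. \<Oplus>j\<in>J. f (i, j))"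
  using assms(1,3)
proof (induction rule: finite_induct)
  case (insert a I)
  have "insert a I \<times> J = Pair a ` J \<union> I \<times> J" by auto
  then have "(\<Oplus>x\<in>insert a I \<times> J. f x) = (\<Oplus>x\<in>Pair a ` J. f x) \<oplus> (\<Oplus>x\<in>I \<times> J. f x)"
    using insert assms(2) by (simp only:) (rule finsum_Un_disjoint; auto)
  also have "(\<Oplus>x\<in>Pair a ` J. f x) = (\<Oplus>j\<in>J. f (a, j))"
    using insert.prems by (subst finsum_reindex) (auto simp: inj_on_def)
  also have "(\<Oplus>x\<in>I \<times> J. f x) = (\<Oplus>i\<in>I. \<Oplus>j\<in>J. f (i, j))"
    using insert by auto
  also have "(\<Oplus>j\<in>J. f (a, j)) \<oplus> \<dots> = (\<Oplus>i\<in>insert a I. \<Oplus>j\<in>J. f (i, j))"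
    using insert by (intro finsum_insert[symmetric]) auto
  finally show ?case .
qed simp

locale fraction_setup = A: assoc_algebra K A
  for K :: "'k ring" and A :: "('k, 'a) module" (structure) +
  fixes C :: "'a set" and Q :: "'q ring" and \<iota> :: "'a \<Rightarrow> 'q"
  assumes subalgebra: "is_subalgebra K A C"
    and fractions: "field_of_fractions (A\<lparr>carrier := C\<rparr>) Q \<iota>"
begin

sublocale Q: field Q
  using fractions by (simp add: field_of_fractions_def)

lemma C_closed: "C \<subseteq> carrier A" "\<one> \<in> C" "\<zero> \<in> C" "\<lbrakk>c \<in> C; d \<in> C\<rbrakk> \<Longrightarrow> c \<otimes> d \<in> C"
  "\<lbrakk>c \<in> C; d \<in> C\<rbrakk> \<Longrightarrow> c \<oplus> d \<in> C" "k \<in> carrier K \<Longrightarrow> k \<odot> \<one> \<in> C"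
  "\<lbrakk>k \<in> carrier K; c \<in> C\<rbrakk> \<Longrightarrow> k \<odot> c \<in> C"
proof -
  have sub: "subring C A" "VectorSpace.subspace K C A"
    using subalgebra by (auto simp: is_subalgebra_def)
  show "C \<subseteq> carrier A" "\<one> \<in> C" "\<zero> \<in> C" "\<lbrakk>c \<in> C; d \<in> C\<rbrakk> \<Longrightarrow> c \<otimes> d \<in> C"
    "\<lbrakk>c \<in> C; d \<in> C\<rbrakk> \<Longrightarrow> c \<oplus> d \<in> C"
    using subringE[OF sub(1)] by auto
  then show "k \<in> carrier K \<Longrightarrow> k \<odot> \<one> \<in> C" "\<lbrakk>k \<in> carrier K; c \<in> C\<rbrakk> \<Longrightarrow> k \<odot> c \<in> C"
    using A.subspace_memD(4)[OF sub(2)] by blast+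
qed

lemma C_in_A [simp]: "c \<in> C \<Longrightarrow> c \<in> carrier A"
  using C_closed(1) by blast

lemma \<iota>_hom: "c \<in> C \<Longrightarrow> \<iota> c \<in> carrier Q" "\<lbrakk>c \<in> C; d \<in> C\<rbrakk> \<Longrightarrow> \<iota> (c \<otimes> d) = \<iota> c \<otimes>\<^bsub>Q\<^esub> \<iota> d"
  "\<lbrakk>c \<in> C; d \<in> C\<rbrakk> \<Longrightarrow> \<iota> (c \<oplus> d) = \<iota> c \<oplus>\<^bsub>Q\<^esub> \<iota> d" "\<iota> \<one> = \<one>\<^bsub>Q\<^esub>"
  "\<lbrakk>c \<in> C; d \<in> C; \<iota> c = \<iota> d\<rbrakk> \<Longrightarrow> c = d"
proof -
  have hom: "\<iota> \<in> ring_hom (A\<lparr>carrier := C\<rparr>) Q" and inj: "inj_on \<iota> C"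
    using fractions by (auto simp: field_of_fractions_def)
  show "c \<in> C \<Longrightarrow> \<iota> c \<in> carrier Q" "\<lbrakk>c \<in> C; d \<in> C\<rbrakk> \<Longrightarrow> \<iota> (c \<otimes> d) = \<iota> c \<otimes>\<^bsub>Q\<^esub> \<iota> d"
    "\<lbrakk>c \<in> C; d \<in> C\<rbrakk> \<Longrightarrow> \<iota> (c \<oplus> d) = \<iota> c \<oplus>\<^bsub>Q\<^esub> \<iota> d" "\<iota> \<one> = \<one>\<^bsub>Q\<^esub>"
    using ring_hom_closed[OF hom, of c] ring_hom_mult[OF hom, of c d] ring_hom_add[OF hom, of c d]
      ring_hom_one[OF hom] by auto
  show "\<lbrakk>c \<in> C; d \<in> C; \<iota> c = \<iota> d\<rbrakk> \<Longrightarrow> c = d"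
    using inj by (auto dest: inj_onD)
qed

lemma \<iota>_zero: "\<iota> \<zero> = \<zero>\<^bsub>Q\<^esub>"
  using \<iota>_hom(3)[of "\<zero>" "\<zero>"] \<iota>_hom(1)[of "\<zero>"] C_closed(3) by simp

lemma \<iota>_zeroD: "\<lbrakk>c \<in> C; \<iota> c = \<zero>\<^bsub>Q\<^esub>\<rbrakk> \<Longrightarrow> c = \<zero>"
  using \<iota>_hom(5)[of c \<zero>] C_closed(3) \<iota>_zero by auto

lemma fractionE:
  assumes "q \<in> carrier Q"
  obtains c d where "c \<in> C" "d \<in> C" "d \<noteq> \<zero>" "q = \<iota> c \<otimes>\<^bsub>Q\<^esub> inv\<^bsub>Q\<^esub> \<iota> d"
proof -
  have "\<exists>c\<in>C. \<exists>d\<in>C - {\<zero>}. q = \<iota> c \<otimes>\<^bsub>Q\<^esub> inv\<^bsub>Q\<^esub> \<iota> d"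
    using fractions assms by (simp add: field_of_fractions_def)
  then show ?thesis using that by blast
qed

end

text \<open>Captures what the estimates use of the tensor product over \<open>K\<close>:
  \<open>t a q\<close> stands for the tensor of \<open>a\<close> and \<open>q\<close>, and
  \<open>T\<close> is spanned over \<open>Q\<close> by those with \<open>q = 1\<close>. Working with
  these rules keeps the cosets of the construction out of the dimension counts.\<close>

locale scalar_extension = fraction_setup K A C Q \<iota> + T: assoc_algebra Q T
  for K :: "'k ring" and A :: "('k, 'a) module" (structure) and C :: "'a set"
    and Q :: "'q ring" and \<iota> :: "'a \<Rightarrow> 'q" and T :: "('q, 't) module" +
  fixes t :: "'a \<Rightarrow> 'q \<Rightarrow> 't"
  assumes t_closed [simp]: "\<lbrakk>a \<in> carrier A; q \<in> carrier Q\<rbrakk> \<Longrightarrow> t a q \<in> carrier T"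
    and t_add_left: "\<lbrakk>a \<in> carrier A; b \<in> carrier A; q \<in> carrier Q\<rbrakk> \<Longrightarrow> t (a \<oplus> b) q = t a q \<oplus>\<^bsub>T\<^esub> t b q"
    and t_mult: "\<lbrakk>a \<in> carrier A; b \<in> carrier A; p \<in> carrier Q; q \<in> carrier Q\<rbrakk> \<Longrightarrow>
      t a p \<otimes>\<^bsub>T\<^esub> t b q = t (a \<otimes> b) (p \<otimes>\<^bsub>Q\<^esub> q)"
    and t_one: "t \<one> \<one>\<^bsub>Q\<^esub> = \<one>\<^bsub>T\<^esub>"
    and t_smult: "\<lbrakk>a \<in> carrier A; p \<in> carrier Q; q \<in> carrier Q\<rbrakk> \<Longrightarrow> p \<odot>\<^bsub>T\<^esub> t a q = t a (p \<otimes>\<^bsub>Q\<^esub> q)"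
    and t_scalar: "\<lbrakk>k \<in> carrier K; a \<in> carrier A; q \<in> carrier Q\<rbrakk> \<Longrightarrow>
      t (k \<odot> a) q = t a (\<iota> (k \<odot> \<one>) \<otimes>\<^bsub>Q\<^esub> q)"
    and t_span: "T.span ((\<lambda>a. t a \<one>\<^bsub>Q\<^esub>) ` carrier A) = carrier T"
begin

abbreviation emb :: "'a \<Rightarrow> 't" where
  "emb a \<equiv> t a \<one>\<^bsub>Q\<^esub>"

lemma emb_closed: "a \<in> carrier A \<Longrightarrow> emb a \<in> carrier T"
  by simp

lemma t_eq_smult: "\<lbrakk>a \<in> carrier A; q \<in> carrier Q\<rbrakk> \<Longrightarrow> t a q = q \<odot>\<^bsub>T\<^esub> emb a"
  by (simp add: t_smult)

lemma emb_mult: "\<lbrakk>a \<in> carrier A; b \<in> carrier A\<rbrakk> \<Longrightarrow> emb (a \<otimes> b) = emb a \<otimes>\<^bsub>T\<^esub> emb b"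
  by (simp add: t_mult)

lemma emb_scalar: "\<lbrakk>k \<in> carrier K; a \<in> carrier A\<rbrakk> \<Longrightarrow> emb (k \<odot> a) = \<iota> (k \<odot> \<one>) \<odot>\<^bsub>T\<^esub> emb a"
  using \<iota>_hom(1) C_closed(6) by (simp add: t_scalar t_smult)

lemma emb_zero: "emb \<zero> = \<zero>\<^bsub>T\<^esub>"
  using t_add_left[of "\<zero>" "\<zero>" "\<one>\<^bsub>Q\<^esub>"] t_closed[of "\<zero>" "\<one>\<^bsub>Q\<^esub>"] by simp

text \<open>Pulled back along \<open>emb\<close>, a \<open>Q\<close>-subalgebra that contains the
  image of \<open>S\<close> becomes a \<open>K\<close>-subalgebra of \<open>A\<close> that contains
  \<open>S\<close>, hence all of \<open>A\<close>. The elements \<open>emb a\<close> span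
  \<open>T\<close>.\<close>

lemma emb_generators:
  assumes "algebra_generators K A S"
  shows "algebra_generators Q T (emb ` S)"
  unfolding algebra_generators_def
proof (intro conjI allI impI)
  have S: "S \<subseteq> carrier A"
    using assms by (auto simp: algebra_generators_def)
  then show "emb ` S \<subseteq> carrier T" by auto
  fix B assume B: "is_subalgebra Q T B \<and> emb ` S \<subseteq> B"
  then have sub: "VectorSpace.subspace Q B T" and ring: "subring B T"
    by (auto simp: is_subalgebra_def)
  note V = T.subspace_memD[OF sub]
  let ?D = "{a \<in> carrier A. emb a \<in> B}"
  have D: "VectorSpace.subspace K ?D A"
  proof (rule A.subspaceI)
    show "\<zero> \<in> ?D" using emb_zero V(2) by simp
    show "\<And>x y. x \<in> ?D \<Longrightarrow> y \<in> ?D \<Longrightarrow> x \<oplus> y \<in> ?D"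
      using V(3) by (simp add: t_add_left)
    show "\<And>c x. c \<in> carrier K \<Longrightarrow> x \<in> ?D \<Longrightarrow> c \<odot> x \<in> ?D"
      using V(4) \<iota>_hom(1) C_closed(6) by (simp add: emb_scalar)
  qed auto
  note D' = A.subspace_memD[OF D]
  have "subring ?D A"
  proof (rule A.A.subringI)
    show "\<one> \<in> ?D" using subringE(3)[OF ring] t_one by simp
    show "\<ominus> h \<in> ?D" if h: "h \<in> ?D" for h
    proof -
      have "(\<ominus>\<^bsub>K\<^esub> \<one>\<^bsub>K\<^esub>) \<odot> h \<in> ?D" by (rule D'(4)[OF _ h]) simp
      then show ?thesis using h by (simp add: A.smult_minus_1)
    qed
    show "h1 \<otimes> h2 \<in> ?D" if "h1 \<in> ?D" "h2 \<in> ?D" for h1 h2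
      using that subringE(6)[OF ring] emb_mult by simp
    show "h1 \<oplus> h2 \<in> ?D" if "h1 \<in> ?D" "h2 \<in> ?D" for h1 h2
      using that by (rule D'(3))
  qed auto
  then have "?D = carrier A"
    using assms D B S unfolding algebra_generators_def is_subalgebra_def by blast
  then have "emb ` carrier A \<subseteq> B" by auto
  then have "carrier T \<subseteq> B"
    using T.span_least[OF _ sub] t_span by metis
  then show "B = carrier T" using V(1) by blast
qed

text \<open>Scalars from \<open>Q\<close> pass through products, so only products of elements
  \<open>emb a\<close> have to be followed. Each step of the filtration of \<open>T\<close> over
  \<open>Q\<close> is thus controlled by the same step of \<open>A\<close> over
  \<open>K\<close>.\<close>

lemma emb_filt:
  assumes "S \<subseteq> carrier A"
  shows "T.filt (emb ` S) i \<subseteq> T.span (emb ` A.filt S i)"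
proof (induction i)
  have cl: "emb ` A.filt S i \<subseteq> carrier T" for i
    using A.filt_closed[OF assms] emb_closed by blast
  {
    case 0
    have "emb \<one> \<in> T.span (emb ` A.filt S 0)"
      using A.one_mem_filt[OF assms, of 0] T.in_own_span[OF cl, of 0] by blast
    then have "T.span {\<one>\<^bsub>T\<^esub>} \<subseteq> T.span (emb ` A.filt S 0)"
      using t_one by (intro T.span_least T.span_is_subspace[OF cl]) simp
    then show ?case by simp
  next
    case (Suc i)
    have S': "emb ` S \<subseteq> carrier T" using assms by auto
    show ?case
    proof (rule T.filt_Suc_subset[OF S' T.span_is_subspace[OF cl]])
      fix x s assume x: "x \<in> T.filt (emb ` S) i" and "s \<in> insert \<one>\<^bsub>T\<^esub> (emb ` S)"
      then obtain b where b: "s = emb b" "b \<in> A.span (insert \<one> S)" "b \<in> carrier A"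
        using A.in_own_span[of "insert \<one> S"] assms t_one[symmetric] by auto
      show "x \<otimes>\<^bsub>T\<^esub> s \<in> T.span (emb ` A.filt S (Suc i))"
      proof (rule T.mult_mem_subspace[OF _ _ cl _ T.span_is_subspace[OF cl]])
        show "x \<in> T.span (emb ` A.filt S i)" using Suc x by blast
        show "{s} \<subseteq> carrier T" using b by auto
        then show "s \<in> T.span {s}" using T.in_own_span by blast
        fix y z assume "y \<in> emb ` A.filt S i" "z \<in> {s}"
        then obtain a where a: "a \<in> A.filt S i" "y = emb a" "z = emb b" using b by auto
        then have "y \<otimes>\<^bsub>T\<^esub> z = emb (a \<otimes> b)"
          using A.filt_closed[OF assms] b(3) by (subst emb_mult) auto
        moreover have "a \<otimes> b \<in> A.filt S (Suc i)"
          using A.filt_SucI[OF assms a(1) b(2)] .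
        ultimately show "y \<otimes>\<^bsub>T\<^esub> z \<in> T.span (emb ` A.filt S (Suc i))"
          using T.in_own_span[OF cl, of "Suc i"] by blast
      qed
    qed
  }
qed

end

text \<open>Models the quotients of the tensor product over \<open>C\<close>, with \<open>e\<close>
  as the image of \<open>1 \<otimes> 1\<close>; \<open>balanced\<close> moves an element of
  \<open>C\<close> across the tensor sign. The tensor module and its quotients are treated together
  in this way.\<close>

locale cyclic_module = scalar_extension K A C Q \<iota> T t + M: algebra_module Q T M
  for K :: "'k ring" and A :: "('k, 'a) module" (structure) and Q :: "'q ring" and T :: "('q, 't) module"
    and C \<iota> t and M :: "('t, 'm) module" +
  fixes e :: 'm
  assumes e_closed: "e \<in> carrier M"
    and e_gen: "module_generators T M {e}"
    and balanced: "\<lbrakk>a \<in> carrier A; c \<in> C\<rbrakk> \<Longrightarrow> t (a \<otimes> c) \<one>\<^bsub>Q\<^esub> \<odot>\<^bsub>M\<^esub> e = t a (\<iota> c) \<odot>\<^bsub>M\<^esub> e"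
    and domain: "noncomm_domain A"
begin

text \<open>The zero set of this map is the left ideal \<open>L\<close>.\<close>

definition h :: "'a \<Rightarrow> 'm" where
  "h a = emb a \<odot>\<^bsub>M\<^esub> e"

lemma h_closed [simp]: "a \<in> carrier A \<Longrightarrow> h a \<in> carrier M"
  unfolding h_def using e_closed by (intro M.mod.smult_closed) auto

lemma h_add: "\<lbrakk>a \<in> carrier A; b \<in> carrier A\<rbrakk> \<Longrightarrow> h (a \<oplus> b) = h a \<oplus>\<^bsub>M\<^esub> h b"
  unfolding h_def using e_closed by (simp add: t_add_left M.mod.smult_l_distr)

lemma h_mult: "\<lbrakk>a \<in> carrier A; b \<in> carrier A\<rbrakk> \<Longrightarrow> h (a \<otimes> b) = emb a \<odot>\<^bsub>M\<^esub> h b"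
  unfolding h_def using e_closed by (simp add: emb_mult M.mod.smult_assoc)

lemma h_zero: "h \<zero> = \<zero>\<^bsub>M\<^esub>"
  unfolding h_def using e_closed by (simp add: emb_zero)

lemma h_scalar: "\<lbrakk>k \<in> carrier K; a \<in> carrier A\<rbrakk> \<Longrightarrow> h (k \<odot> a) = \<iota> (k \<odot> \<one>) \<odot>\<^bsub>M.VM\<^esub> h a"
  unfolding h_def using e_closed \<iota>_hom(1) C_closed(6) M.scalar_smult(1)
  by (simp add: emb_scalar del: M.VM_simps)

text \<open>Right multiplication by \<open>C\<close> turns into scalar multiplication by
  \<open>Q\<close>. Elements of \<open>A\<close> whose images are independent over \<open>Q\<close>
  are therefore right independent over \<open>C\<close> modulo the zero set of
  \<open>h\<close>.\<close>

lemma h_C: "\<lbrakk>a \<in> carrier A; c \<in> C\<rbrakk> \<Longrightarrow> h (a \<otimes> c) = \<iota> c \<odot>\<^bsub>M.VM\<^esub> h a"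
  unfolding h_def using e_closed \<iota>_hom(1) M.scalar_smult(1)
  by (simp add: balanced t_eq_smult[of a "\<iota> c"] del: M.VM_simps)

lemma h_finsum:
  assumes "finite I" "f \<in> I \<rightarrow> carrier A"
  shows "h (\<Oplus>i\<in>I. f i) = (\<Oplus>\<^bsub>M.VM\<^esub>i\<in>I. h (f i))"
  using assms
proof (induction rule: finite_induct)
  case empty
  show ?case by (simp add: h_zero)
next
  case (insert i I)
  have "(\<Oplus>i\<in>insert i I. f i) = f i \<oplus> (\<Oplus>i\<in>I. f i)"
    using insert by (intro A.M.finsum_insert) auto
  moreover have "(\<Oplus>\<^bsub>M.VM\<^esub>i\<in>insert i I. h (f i)) = h (f i) \<oplus>\<^bsub>M.VM\<^esub> (\<Oplus>\<^bsub>M.VM\<^esub>i\<in>I. h (f i))"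
    using insert by (intro M.V.M.finsum_insert) (auto simp: Pi_iff)
  moreover have "(\<Oplus>i\<in>I. f i) \<in> carrier A"
    using insert by (intro A.M.finsum_closed) auto
  ultimately show ?case using insert by (simp add: h_add)
qed

lemma h_span:
  assumes "G \<subseteq> carrier A" "a \<in> A.span G"
  shows "h a \<in> M.V.span (h ` G)"
proof -
  have cl: "h ` G \<subseteq> carrier M.VM" using assms by auto
  note W = M.V.subspace_memD[OF M.V.span_is_subspace[OF cl]]
  show ?thesis
    using assms(2,1)
  proof (induction rule: A.span_induct)
    case zero
    then show ?case using W(2) by (simp add: h_zero)
  next
    case (add x y)
    then show ?case using W(3) by (simp add: h_add)
  next
    case (smult c x)
    then show ?case using W(4) \<iota>_hom(1) C_closed(6) h_scalar by simp
  next
    case (base x)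
    then show ?case using M.V.in_own_span[OF cl] by blast
  qed
qed

lemma no_zero_divisors:
  "\<lbrakk>x \<in> carrier A; y \<in> carrier A; x \<otimes> y = \<zero>; y \<noteq> \<zero>\<rbrakk> \<Longrightarrow> x = \<zero>"
  using domain by (auto simp: noncomm_domain_def)

text \<open>A sum \<open>\<Sum>\<^sub>l w\<^sub>l u\<^sup>l\<close> with \<open>u\<close> in the left ideal \<open>{a. h a = 0}\<close> is \<open>w\<^sub>0\<close> modulo this ideal, so
  its coefficients vanish one after the other if they come from a set that meets the ideal in \<open>0\<close>.\<close>

lemma power_sum_zero:
  fixes m l :: nat
  assumes W: "W \<subseteq> carrier A" "\<And>w. \<lbrakk>w \<in> W; h w = \<zero>\<^bsub>M\<^esub>\<rbrakk> \<Longrightarrow> w = \<zero>"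
    and u: "u \<in> carrier A" "m = 0 \<or> u \<noteq> \<zero> \<and> h u = \<zero>\<^bsub>M\<^esub>"
    and w: "\<And>l. l \<le> m \<Longrightarrow> w l \<in> W" "(\<Oplus>l\<in>{..m}. w l \<otimes> u [^] l) = \<zero>"
    and l: "l \<le> m"
  shows "w l = \<zero>"
  using u(2) w l
proof (induction m arbitrary: w l)
  case 0
  then have "w 0 \<in> carrier A" using W(1) by auto
  then show ?case using 0 u(1) by simp
next
  case (Suc m)
  have wA: "w j \<in> carrier A" if "j \<le> Suc m" for j using Suc.prems(2)[OF that] W(1) by blast
  let ?r = "\<Oplus>l\<in>{..m}. w (Suc l) \<otimes> u [^] l"
  have r: "?r \<in> carrier A"
    using wA u(1) by (intro A.M.finsum_closed) auto
  \<comment> \<open>The terms with positive exponent form a left multiple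
    \<open>?r \<otimes> u\<close> of \<open>u\<close> and lie in the left ideal, so
    \<open>w 0\<close> does too and vanishes. Then \<open>u\<close> is cancelled, and
    \<open>?r\<close> is a sum of the same kind with one term less.\<close>
  have "(\<Oplus>l\<in>{..Suc m}. w l \<otimes> u [^] l)
      = (\<Oplus>l\<in>{..m}. w (Suc l) \<otimes> u [^] Suc l) \<oplus> w 0 \<otimes> u [^] (0::nat)"
    using wA u(1) by (intro A.M.finsum_Suc2) auto
  also have "(\<Oplus>l\<in>{..m}. w (Suc l) \<otimes> u [^] Suc l) = ?r \<otimes> u"
    using wA u(1) by (subst A.A.finsum_ldistr) (auto intro!: A.M.finsum_cong' simp: A.A.m_assoc)
  finally have sum: "?r \<otimes> u \<oplus> w 0 = \<zero>"
    using Suc.prems(3) wA[of 0] by simp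
  have hu: "u \<noteq> \<zero>" "h u = \<zero>\<^bsub>M\<^esub>" using Suc.prems(1) by auto
  have "h (?r \<otimes> u) = \<zero>\<^bsub>M\<^esub>"
    using h_mult[OF r u(1)] hu r by simp
  then have "h (w 0) = \<zero>\<^bsub>M\<^esub>"
    using arg_cong[OF sum, of h] h_add[of "?r \<otimes> u" "w 0"] r u(1) wA[of 0] by (simp add: h_zero)
  then have w0: "w 0 = \<zero>"
    using W(2) Suc.prems(2) by blast
  then have "?r \<otimes> u = \<zero>" using sum r u(1) by simp
  then have r0: "?r = \<zero>" using no_zero_divisors[OF r u(1) _ hu(1)] by blast
  show ?case
  proof (cases l)
    case 0
    then show ?thesis using w0 by simp
  next
    case (Suc l')
    have "w (Suc l') = \<zero>"
      using Suc.IH[of "\<lambda>l. w (Suc l)" l'] Suc.prems Suc r0 hu by auto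
    then show ?thesis using Suc by simp
  qed
qed

text \<open>The products \<open>(a_j c) u^l\<close> with \<open>c\<close> in a basis of
  \<open>C_i\<close> and \<open>l \<le> m\<close> are independent over \<open>K\<close>. Their
  coefficients vanish in three layers: the powers of \<open>u\<close> separate by
  \<open>power_sum_zero\<close>, the \<open>a_j\<close> by independence over \<open>Q\<close>, the
  \<open>c\<close> by independence over \<open>K\<close>. The indices are \<open>i\<close> for
  \<open>a_j\<close>, \<open>p * i\<close> for \<open>c\<close> and at most \<open>p * i\<close> for
  \<open>u^l\<close>, which add up to \<open>Suc (2 * p) * i\<close>. The case \<open>m = 0\<close>,
  with the single power \<open>u^0\<close>, serves the bound without a gain from
  \<open>u\<close>.\<close>

lemma dimension_product_le:
  assumes S: "finite S" "S \<subseteq> carrier A" and SC: "finite SC" "SC \<subseteq> C" "SC \<subseteq> A.filt S p"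
    and u: "u \<in> A.filt S p" "m = 0 \<or> u \<noteq> \<zero> \<and> h u = \<zero>\<^bsub>M\<^esub>" and m: "m \<le> i"
  shows "M.V.sdim (M.V.span (h ` A.filt S i)) * A.sdim (A.filt SC i) * Suc m
    \<le> A.sdim (A.filt S (Suc (2 * p) * i))"
proof -
  have SCA: "SC \<subseteq> carrier A" using SC C_closed(1) by blast
  have uA: "u \<in> carrier A" using u(1) A.filt_closed[OF S(2)] by blast
  obtain G where G: "finite G" "G \<subseteq> carrier A" "A.filt S i = A.span G"
    using A.filt_finite_dim[OF S(2,1)] .
  have "h ` A.filt S i \<subseteq> M.V.span (h ` G)"
    using h_span[OF G(2)] G(3) by auto
  moreover have "finite (h ` G)" "h ` G \<subseteq> carrier M.VM"
    using G by auto
  ultimately obtain B where B: "B \<subseteq> h ` A.filt S i" "finite B" "M.V.lin_indpt B"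
    "M.V.sdim (M.V.span (h ` A.filt S i)) = card B"
    using M.V.obtain_basis_subset[of "h ` G" "h ` A.filt S i"] by metis
  define g where "g b = (SOME a. a \<in> A.filt S i \<and> h a = b)" for b
  have g: "g b \<in> A.filt S i" "h (g b) = b" if "b \<in> B" for b
    using someI_ex[of "\<lambda>a. a \<in> A.filt S i \<and> h a = b"] that B(1) unfolding g_def by blast+
  have gA: "g b \<in> carrier A" if "b \<in> B" for b
    using g(1)[OF that] A.filt_closed[OF S(2)] by blast
  have BM: "B \<subseteq> carrier M.VM" using g(2) gA h_closed by (metis M.VM_simps(1) subsetI)
  obtain H where H: "finite H" "H \<subseteq> carrier A" "A.filt SC i = A.span H"
    using A.filt_finite_dim[OF SCA SC(1)] .
  obtain E where E: "E \<subseteq> A.filt SC i" "finite E" "A.lin_indpt E" "A.sdim (A.filt SC i) = card E"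
    using A.obtain_basis_subset[OF H(1,2), of "A.filt SC i"] H
      A.subspace_span_eq[OF A.filt_subspace[OF SCA]] by (metis order_refl)
  have filtC: "A.filt SC i \<subseteq> C"
  proof -
    interpret C: assoc_algebra K "A\<lparr>carrier := C\<rparr>"
      by (rule A.subalgebra_assoc_algebra[OF subalgebra])
    show ?thesis
      using C.filt_closed[of SC i] A.filt_subalgebra[OF subalgebra SC(2)] SC(2) by simp
  qed
  have EC: "E \<subseteq> C" using E(1) filtC by blast
  have EA: "E \<subseteq> carrier A" using EC C_closed(1) by blast
  have subC: "VectorSpace.subspace K C A"
    using subalgebra by (simp add: is_subalgebra_def)
  obtain G' where G': "finite G'" "G' \<subseteq> carrier A" "A.filt S (Suc (2 * p) * i) = A.span G'"
    using A.filt_finite_dim[OF S(2,1)] .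
  let ?I = "{..m} \<times> (B \<times> E)"
  define f where "f = (\<lambda>(l, b, c). (g b \<otimes> c) \<otimes> u [^] (l :: nat))"
  have "card ?I \<le> A.sdim (A.span G')"
  proof (rule A.card_le_sdim[OF G'(1,2)])
    show "finite ?I" using B E by auto
    show "f \<in> ?I \<rightarrow> A.span G'"
    proof (rule Pi_I)
      fix x assume "x \<in> ?I"
      then obtain l b c where x: "x = (l, b, c)" and *: "l \<in> {..m}" "b \<in> B" "c \<in> E" by auto
      have c: "c \<in> A.filt S (p * i)"
        using A.filt_subset_filt[OF S(2) SCA SC(3)] E(1) * by blast
      have "g b \<otimes> c \<in> A.filt S (i + p * i)"
        by (rule A.filt_mult[OF S(2) g(1)[OF *(2)] c])
      then have "f (l, b, c) \<in> A.filt S ((i + p * i) + p * l)"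
        unfolding f_def prod.case by (rule A.filt_mult[OF S(2) _ A.filt_pow[OF S(2) u(1)]])
      moreover have "p * l \<le> p * i" using * m by (intro mult_le_mono) auto
      then have "(i + p * i) + p * l \<le> Suc (2 * p) * i" by simp
      ultimately show "f x \<in> A.span G'"
        using A.filt_mono[OF S(2), of "(i + p * i) + p * l" "Suc (2 * p) * i"] unfolding G'(3) x by blast
    qed
  next
    fix k x assume k: "k \<in> ?I \<rightarrow> carrier K" and sum: "(\<Oplus>x\<in>?I. k x \<odot> f x) = \<zero>" and x: "x \<in> ?I"
    have kK: "k (l, b, c) \<in> carrier K" if "l \<le> m" "b \<in> B" "c \<in> E" for l b c
      using k that by auto
    have cA: "c \<in> carrier A" if "c \<in> E" for c using EA that by blast
    define z where "z l b = (\<Oplus>c\<in>E. k (l, b, c) \<odot> c)" for l b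
    define w where "w l = (\<Oplus>b\<in>B. g b \<otimes> z l b)" for l
    have z: "z l b \<in> C" if "l \<le> m" "b \<in> B" for l b
      unfolding z_def using that kK EC C_closed(7) by (intro A.subspace_finsum_closed[OF subC]) auto
    then have zA: "z l b \<in> carrier A" if "l \<le> m" "b \<in> B" for l b
      using that C_closed(1) by blast
    \<comment> \<open>Coefficients range over all of \<open>C\<close>, which contains the
      \<open>K\<close>-combinations \<open>z l b\<close>. The next fact shows at once that the sum
      over the \<open>g b\<close> is direct and that it meets the zero set of \<open>h\<close> only
      in 0.\<close>
    define W where "W = {\<Oplus>b\<in>B. g b \<otimes> y b | y. y \<in> B \<rightarrow> C}"
    have indep: "y b = \<zero>" if y: "y \<in> B \<rightarrow> C" "h (\<Oplus>b\<in>B. g b \<otimes> y b) = \<zero>\<^bsub>M\<^esub>" "b \<in> B" for y b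
    proof -
      have yC: "y b \<in> C" if "b \<in> B" for b using y(1) that by blast
      have yA: "y b \<in> carrier A" if "b \<in> B" for b using yC[OF that] C_closed(1) by blast
      have "h (\<Oplus>b\<in>B. g b \<otimes> y b) = (\<Oplus>\<^bsub>M.VM\<^esub>b\<in>B. h (g b \<otimes> y b))"
        using B(2) gA yA by (intro h_finsum) auto
      also have "\<dots> = (\<Oplus>\<^bsub>M.VM\<^esub>b\<in>B. \<iota> (y b) \<odot>\<^bsub>M.VM\<^esub> b)"
      proof (rule M.V.M.finsum_cong')
        show "(\<lambda>b. \<iota> (y b) \<odot>\<^bsub>M.VM\<^esub> b) \<in> B \<rightarrow> carrier M.VM"
        proof
          fix b assume "b \<in> B"
          then show "\<iota> (y b) \<odot>\<^bsub>M.VM\<^esub> b \<in> carrier M.VM"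
            using \<iota>_hom(1)[OF yC] BM by (intro M.V.smult_closed) auto
        qed
        show "h (g b \<otimes> y b) = \<iota> (y b) \<odot>\<^bsub>M.VM\<^esub> b" if "b \<in> B" for b
          using h_C[OF gA yC] g(2) that by simp
      qed simp
      finally have "(\<Oplus>\<^bsub>M.VM\<^esub>b\<in>B. \<iota> (y b) \<odot>\<^bsub>M.VM\<^esub> b) = \<zero>\<^bsub>M.VM\<^esub>"
        using y(2) by simp
      then have "\<iota> (y b) = \<zero>\<^bsub>Q\<^esub>"
        using \<iota>_hom(1)[OF yC] by (intro M.V.lin_indpt_finsumD[OF B(2) BM B(3) _ _ y(3), of "\<lambda>b. \<iota> (y b)"]) auto
      then show ?thesis
        using \<iota>_zeroD yC[OF y(3)] by blast
    qed
    have WA: "W \<subseteq> carrier A"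
      unfolding W_def using gA C_closed(1) by (auto intro!: A.M.finsum_closed)
    have W0: "w = \<zero>" if w: "w \<in> W" "h w = \<zero>\<^bsub>M\<^esub>" for w
    proof -
      obtain y where y: "w = (\<Oplus>b\<in>B. g b \<otimes> y b)" "y \<in> B \<rightarrow> C" using w by (auto simp: W_def)
      then have "\<And>b. b \<in> B \<Longrightarrow> y b = \<zero>" using indep w(2) by blast
      then show ?thesis unfolding y(1) using gA by (intro A.M.add.finprod_one_eqI) simp
    qed
    have wW: "w l \<in> W" if "l \<le> m" for l
      using z that by (auto simp: W_def w_def intro!: exI[of _ "z l"])
    \<comment> \<open>Collects the part of the relation that belongs to one power of
      \<open>u\<close>, which brings it into the form required by
      \<open>power_sum_zero\<close>.\<close>
    have inner: "(\<Oplus>y\<in>B \<times> E. k (l, y) \<odot> f (l, y)) = w l \<otimes> u [^] l" if l: "l \<le> m" for l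
    proof -
      have ul: "u [^] l \<in> carrier A" using uA by simp
      have "(\<Oplus>y\<in>B \<times> E. k (l, y) \<odot> f (l, y)) = (\<Oplus>b\<in>B. \<Oplus>c\<in>E. k (l, b, c) \<odot> f (l, b, c))"
        using B(2) E(2) kK[OF l] gA cA ul by (intro A.M.finsum_Times) (auto simp: f_def)
      also have "\<dots> = (\<Oplus>b\<in>B. (g b \<otimes> z l b) \<otimes> u [^] l)"
      proof (rule A.M.finsum_cong')
        fix b assume b: "b \<in> B"
        have "(\<Oplus>c\<in>E. k (l, b, c) \<odot> f (l, b, c))
            = (\<Oplus>c\<in>E. (g b \<otimes> (k (l, b, c) \<odot> c)) \<otimes> u [^] l)"
          using kK[OF l b] gA[OF b] cA ul
          by (intro A.M.finsum_cong') (auto simp: f_def A.smult_mult_left A.smult_mult_right)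
        also have "\<dots> = (\<Oplus>c\<in>E. g b \<otimes> (k (l, b, c) \<odot> c)) \<otimes> u [^] l"
          using kK[OF l b] gA[OF b] cA ul E(2) by (intro A.A.finsum_ldistr[symmetric]) auto
        also have "(\<Oplus>c\<in>E. g b \<otimes> (k (l, b, c) \<odot> c)) = g b \<otimes> z l b"
          unfolding z_def using kK[OF l b] gA[OF b] cA E(2) by (intro A.A.finsum_rdistr[symmetric]) auto
        finally show "(\<Oplus>c\<in>E. k (l, b, c) \<odot> f (l, b, c)) = (g b \<otimes> z l b) \<otimes> u [^] l" .
      qed (use gA zA l ul in auto)
      also have "\<dots> = w l \<otimes> u [^] l"
        unfolding w_def using gA zA l ul B(2) by (intro A.A.finsum_ldistr[symmetric]) auto
      finally show ?thesis .
    qed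
    have fA: "k (l, b, c) \<odot> f (l, b, c) \<in> carrier A" if "l \<le> m" "b \<in> B" "c \<in> E" for l b c
      using kK[OF that] gA[OF that(2)] cA[OF that(3)] uA by (simp add: f_def)
    have "(\<Oplus>x\<in>?I. k x \<odot> f x) = (\<Oplus>l\<in>{..m}. \<Oplus>y\<in>B \<times> E. k (l, y) \<odot> f (l, y))"
      using B(2) E(2) fA by (intro A.M.finsum_Times) auto
    also have "\<dots> = (\<Oplus>l\<in>{..m}. w l \<otimes> u [^] l)"
      using inner wW WA uA by (intro A.M.finsum_cong') (auto simp: subset_iff)
    finally have "(\<Oplus>l\<in>{..m}. w l \<otimes> u [^] l) = \<zero>"
      using sum by simp
    then have w0: "w l = \<zero>" if "l \<le> m" for l
      using power_sum_zero[of W u m w l] WA W0 uA u(2) wW that by blast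
    obtain l b c where lbc: "x = (l, b, c)" "l \<le> m" "b \<in> B" "c \<in> E" using x by auto
    have "z l b = \<zero>"
      using indep[of "z l" b] z lbc w0[OF lbc(2)] h_zero by (simp add: w_def)
    then show "k x = \<zero>\<^bsub>K\<^esub>"
      unfolding z_def lbc(1) using kK[OF lbc(2,3)] 
      by (intro A.lin_indpt_finsumD[OF E(2) EA E(3) _ _ lbc(4), of "\<lambda>c. k (l, b, c)"]) auto
  qed
  then show ?thesis
    using B E G'(3) by (simp add: card_cartesian_product mult_ac)
qed

end

lemma (in scalar_extension) fg_extension:
  assumes "fg_algebra K A"
  shows "fg_algebra Q T"
  using assms emb_generators unfolding fg_algebra_def by blast

context cyclic_module
begin

text \<open>Acting on \<open>e\<close> turns \<open>emb\<close> into \<open>h\<close>, so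
  \<open>emb_filt\<close> reduces the dimension count for \<open>M\<close> to images of elements of
  \<open>A\<close>.\<close>

lemma mfilt_subset_span_h:
  assumes S: "S \<subseteq> carrier A"
  shows "M.mfilt (emb ` S) {e} i \<subseteq> M.V.span (h ` A.filt S i)"
proof -
  have cl: "h ` A.filt S i \<subseteq> carrier M.VM" and cl': "emb ` A.filt S i \<subseteq> carrier T"
    using A.filt_closed[OF S] h_closed emb_closed unfolding M.VM_simps(1) by blast+
  have "r \<odot>\<^bsub>M\<^esub> e \<in> M.V.span (h ` A.filt S i)" if r: "r \<in> T.filt (emb ` S) i" for r
  proof (rule M.act_mem_subspace[of r "emb ` A.filt S i" e "{e}"])
    show "r \<in> T.span (emb ` A.filt S i)"
      using r emb_filt[OF S] by blast
    show "e \<in> M.V.span {e}"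
      using M.V.in_own_span[of "{e}"] e_closed by simp
    show "x \<odot>\<^bsub>M\<^esub> y \<in> M.V.span (h ` A.filt S i)" if "x \<in> emb ` A.filt S i" "y \<in> {e}" for x y
      using that M.V.in_own_span[OF cl] by (auto simp: h_def)
  qed (use cl' e_closed M.V.span_is_subspace[OF cl] in auto)
  then show ?thesis
    unfolding M.mfilt_def by (intro M.V.span_least M.V.span_is_subspace[OF cl]) auto
qed

text \<open>The product estimate is taken with \<open>m = \<delta> * i\<close>, so that the factor
  \<open>Suc (\<delta> * i)\<close> dominates \<open>i ^ \<delta>\<close>, and combined with the
  lower bound for \<open>C\<close>. One step \<open>p\<close> of \<open>A\<close> contains both
  \<open>u\<close> and the generators of \<open>C\<close>; it does not depend on \<open>i\<close>,
  hence the index changes only linearly.\<close>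

lemma GK_cyclic_le:
  assumes fg: "fg_algebra K A" and SC: "finite SC" "SC \<subseteq> C" and "0 < c"
    and growth: "\<And>i. c * real i ^ n \<le> real (A.sdim (A.filt SC i))"
    and u: "u \<in> carrier A" "\<delta> = 0 \<or> \<delta> = 1 \<and> u \<noteq> \<zero> \<and> h u = \<zero>\<^bsub>M\<^esub>"
  shows "GK_module Q T M + ereal (real (n + \<delta>)) \<le> GK_algebra K A"
proof -
  define S where "S = chosen_generators K A"
  have S: "finite S" "algebra_generators K A S"
    using chosen_generatorsD[OF fg] unfolding S_def by blast+
  then have SA: "S \<subseteq> carrier A" by (auto simp: algebra_generators_def)
  obtain p where p: "insert u SC \<subseteq> A.filt S p"
    using A.finite_subset_filt[OF S(2), of "insert u SC"] SC u(1) C_closed(1) by auto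
  define d where "d i = M.V.sdim (M.V.span (h ` A.filt S i))" for i
  have "real (d i) * (c * real i ^ (n + \<delta>)) \<le> real (A.sdim (A.filt S (Suc (2 * p) * i + 0)))" for i
  proof -
    have "c * real i ^ (n + \<delta>) = (c * real i ^ n) * real i ^ \<delta>"
      by (simp add: power_add)
    also have "\<dots> \<le> real (A.sdim (A.filt SC i)) * real (Suc (\<delta> * i))"
      using growth[of i] u(2) assms(4) by (intro mult_mono) auto
    finally have "real (d i) * (c * real i ^ (n + \<delta>)) \<le> real (d i) * (real (A.sdim (A.filt SC i)) * real (Suc (\<delta> * i)))"
      by (rule mult_left_mono) simp
    also have "\<dots> = real (d i * A.sdim (A.filt SC i) * Suc (\<delta> * i))"
      by (simp only: of_nat_mult mult.assoc)
    also have "\<dots> \<le> real (A.sdim (A.filt S (Suc (2 * p) * i)))"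
      unfolding d_def using p u by (intro of_nat_mono dimension_product_le[OF S(1) SA SC, of p u]) auto
    finally show ?thesis by simp
  qed
  then have "growth_exponent d + ereal (real (n + \<delta>)) \<le> growth_exponent (\<lambda>i. A.sdim (A.filt S i))"
    using assms(4) by (intro growth_exponent_add_le[of c "Suc (2 * p)" d _ _ 0]) auto
  also have "\<dots> = GK_algebra K A"
    by (simp add: GK_algebra_def S_def subspace_dim_def)
  finally have *: "growth_exponent d + ereal (real (n + \<delta>)) \<le> GK_algebra K A" .
  have "M.V.sdim (M.mfilt (emb ` S) {e} i) \<le> d i" for i
  proof -
    obtain G where G: "finite G" "G \<subseteq> carrier A" "A.filt S i = A.span G"
      using A.filt_finite_dim[OF SA S(1)] .
    have cl: "h ` G \<subseteq> carrier M.VM" "h ` A.filt S i \<subseteq> carrier M.VM"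
      using G(2) A.filt_closed[OF SA] h_closed unfolding M.VM_simps(1) by blast+
    have "h ` A.filt S i \<subseteq> M.V.span (h ` G)"
      using h_span[OF G(2)] G(3) by auto
    moreover have "h ` G \<subseteq> h ` A.filt S i"
      using A.in_own_span[OF G(2)] G(3) by blast
    ultimately have span: "M.V.span (h ` A.filt S i) = M.V.span (h ` G)"
      using M.V.span_mono_span[OF _ cl(1)] M.V.span_is_monotone by (metis antisym)
    show ?thesis
      unfolding d_def span M.mfilt_def
    proof (rule M.V.sdim_mono)
      show "M.V.span {r \<odot>\<^bsub>M\<^esub> m |r m. r \<in> T.filt (emb ` S) i \<and> m \<in> {e}} \<subseteq> M.V.span (h ` G)"
        using mfilt_subset_span_h[OF SA, of i] span by (simp add: M.mfilt_def)
      show "{r \<odot>\<^bsub>M\<^esub> m |r m. r \<in> T.filt (emb ` S) i \<and> m \<in> {e}} \<subseteq> carrier M.VM"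
        using SA e_closed emb_closed by (intro M.mfilt_gens_closed) auto
    qed (use G cl in auto)
  qed
  then have "growth_exponent (\<lambda>i. M.V.sdim (M.mfilt (emb ` S) {e} i)) + ereal (real 0) \<le> growth_exponent d"
    by (intro growth_exponent_add_le[of 1 1 _ _ _ 0]) auto
  moreover have "GK_module Q T M \<le> growth_exponent (\<lambda>i. M.V.sdim (M.mfilt (emb ` S) {e} i))"
    using S e_gen by (intro M.GK_module_le emb_generators) auto
  ultimately have "GK_module Q T M \<le> growth_exponent d"
    by (simp add: zero_ereal_def[symmetric])
  then have "GK_module Q T M + ereal (real (n + \<delta>)) \<le> growth_exponent d + ereal (real (n + \<delta>))"
    by (rule add_right_mono)
  then show ?thesis using * by (rule order_trans)
qed

end

section \<open>Quotient modules\<close>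

text \<open>The laws pass along a surjection that preserves the operations. This serves for the
  cosets of the tensor module, for quotients by submodules and for a change of record type
  alike.\<close>

lemma abelian_group_image:
  assumes "abelian_group G" "\<pi> ` carrier G = carrier H"
    "\<And>x y. \<lbrakk>x \<in> carrier G; y \<in> carrier G\<rbrakk> \<Longrightarrow> \<pi> (x \<oplus>\<^bsub>G\<^esub> y) = \<pi> x \<oplus>\<^bsub>H\<^esub> \<pi> y"
    "\<pi> \<zero>\<^bsub>G\<^esub> = \<zero>\<^bsub>H\<^esub>"
  shows "abelian_group H"
proof -
  interpret G: abelian_group G by fact
  have ex: "\<exists>x\<in>carrier G. X = \<pi> x" if "X \<in> carrier H" for X
    using assms(2) that by blast
  have cl: "\<pi> x \<in> carrier H" if "x \<in> carrier G" for x
    using assms(2) that by blast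
  show ?thesis
  proof (rule abelian_groupI)
    fix X Y assume "X \<in> carrier H" "Y \<in> carrier H"
    then obtain x y where xy: "x \<in> carrier G" "y \<in> carrier G" "X = \<pi> x" "Y = \<pi> y" using ex by metis
    then show "X \<oplus>\<^bsub>H\<^esub> Y \<in> carrier H" using assms(3)[of x y] cl[of "x \<oplus>\<^bsub>G\<^esub> y"] by simp
    show "X \<oplus>\<^bsub>H\<^esub> Y = Y \<oplus>\<^bsub>H\<^esub> X"
      using xy assms(3)[of x y] assms(3)[of y x] G.a_comm[of x y] by simp
  next
    show "\<zero>\<^bsub>H\<^esub> \<in> carrier H" using cl[OF G.zero_closed] assms(4) by simp
  next
    fix X Y Z assume "X \<in> carrier H" "Y \<in> carrier H" "Z \<in> carrier H"
    then obtain x y z where *: "x \<in> carrier G" "y \<in> carrier G" "z \<in> carrier G" "X = \<pi> x" "Y = \<pi> y" "Z = \<pi> z"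
      using ex by metis
    then have "\<pi> (x \<oplus>\<^bsub>G\<^esub> y \<oplus>\<^bsub>G\<^esub> z) = X \<oplus>\<^bsub>H\<^esub> Y \<oplus>\<^bsub>H\<^esub> Z" "\<pi> (x \<oplus>\<^bsub>G\<^esub> (y \<oplus>\<^bsub>G\<^esub> z)) = X \<oplus>\<^bsub>H\<^esub> (Y \<oplus>\<^bsub>H\<^esub> Z)"
      using assms(3) by simp_all
    then show "X \<oplus>\<^bsub>H\<^esub> Y \<oplus>\<^bsub>H\<^esub> Z = X \<oplus>\<^bsub>H\<^esub> (Y \<oplus>\<^bsub>H\<^esub> Z)" using * by (simp add: G.a_assoc)
  next
    fix X assume "X \<in> carrier H"
    then obtain x where x: "x \<in> carrier G" "X = \<pi> x" using ex by metis
    then show "\<zero>\<^bsub>H\<^esub> \<oplus>\<^bsub>H\<^esub> X = X" using assms(3)[of "\<zero>\<^bsub>G\<^esub>" x] assms(4) by simp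
    have "\<pi> (\<ominus>\<^bsub>G\<^esub> x) \<oplus>\<^bsub>H\<^esub> X = \<zero>\<^bsub>H\<^esub>"
      using assms(3)[of "\<ominus>\<^bsub>G\<^esub> x" x] assms(4) x by (simp add: G.l_neg)
    then show "\<exists>Y\<in>carrier H. Y \<oplus>\<^bsub>H\<^esub> X = \<zero>\<^bsub>H\<^esub>" using cl x by blast
  qed
qed

lemma left_module_image:
  assumes "left_module R M" "\<pi> ` carrier M = carrier N"
    "\<And>x y. \<lbrakk>x \<in> carrier M; y \<in> carrier M\<rbrakk> \<Longrightarrow> \<pi> (x \<oplus>\<^bsub>M\<^esub> y) = \<pi> x \<oplus>\<^bsub>N\<^esub> \<pi> y"
    "\<pi> \<zero>\<^bsub>M\<^esub> = \<zero>\<^bsub>N\<^esub>"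
    "\<And>r x. \<lbrakk>r \<in> carrier R; x \<in> carrier M\<rbrakk> \<Longrightarrow> \<pi> (r \<odot>\<^bsub>M\<^esub> x) = r \<odot>\<^bsub>N\<^esub> \<pi> x"
  shows "left_module R N"
proof -
  interpret M: left_module R M by fact
  interpret N: abelian_group N
    using abelian_group_image[OF M.M.abelian_group_axioms assms(2-4)] by blast
  have ex: "\<exists>x\<in>carrier M. X = \<pi> x" if "X \<in> carrier N" for X
    using assms(2) that by blast
  have cl: "\<pi> x \<in> carrier N" if "x \<in> carrier M" for x
    using assms(2) that by blast
  show ?thesis
  proof (unfold_locales, goal_cases)
    case (1 a X)
    then obtain x where "x \<in> carrier M" "X = \<pi> x" using ex by metis
    then show ?case using 1 cl[OF M.smult_closed[of a x]] assms(5)[of a x] by simp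
  next
    case (2 a b X)
    then obtain x where x: "x \<in> carrier M" "X = \<pi> x" using ex by metis
    then have "\<pi> ((a \<oplus>\<^bsub>R\<^esub> b) \<odot>\<^bsub>M\<^esub> x) = (a \<oplus>\<^bsub>R\<^esub> b) \<odot>\<^bsub>N\<^esub> X" using 2 assms(5) by simp
    moreover have "\<pi> ((a \<oplus>\<^bsub>R\<^esub> b) \<odot>\<^bsub>M\<^esub> x) = a \<odot>\<^bsub>N\<^esub> X \<oplus>\<^bsub>N\<^esub> b \<odot>\<^bsub>N\<^esub> X"
      using 2 x assms(3,5) M.smult_closed by (simp add: M.smult_l_distr)
    ultimately show ?case by simp
  next
    case (3 a X Y)
    then obtain x y where x: "x \<in> carrier M" "X = \<pi> x" "y \<in> carrier M" "Y = \<pi> y" using ex by metis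
    then have "\<pi> (a \<odot>\<^bsub>M\<^esub> (x \<oplus>\<^bsub>M\<^esub> y)) = a \<odot>\<^bsub>N\<^esub> (X \<oplus>\<^bsub>N\<^esub> Y)" using 3 assms(3,5) by simp
    moreover have "\<pi> (a \<odot>\<^bsub>M\<^esub> (x \<oplus>\<^bsub>M\<^esub> y)) = a \<odot>\<^bsub>N\<^esub> X \<oplus>\<^bsub>N\<^esub> a \<odot>\<^bsub>N\<^esub> Y"
      using 3 x assms(3,5) M.smult_closed by (simp add: M.smult_r_distr)
    ultimately show ?case by simp
  next
    case (4 a b X)
    then obtain x where x: "x \<in> carrier M" "X = \<pi> x" using ex by metis
    then show ?case
      using 4 assms(5)[of "a \<otimes>\<^bsub>R\<^esub> b" x] assms(5)[of a "b \<odot>\<^bsub>M\<^esub> x"] assms(5)[of b x] M.smult_closed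
      by (simp add: M.smult_assoc)
  next
    case (5 X)
    then obtain x where x: "x \<in> carrier M" "X = \<pi> x" using ex by metis
    then show ?case using assms(5)[of "\<one>\<^bsub>R\<^esub>" x] by (simp add: M.smult_one)
  qed
qed

text \<open>The quotient by a submodule, with each coset \<open>X\<close> represented by the set of the constant
  sequences with value in \<open>X\<close>, so that its carrier has the type over which
  \<^const>\<open>holonomic_number\<close> ranges.\<close>

definition seq_coset :: "('r, 'm) module \<Rightarrow> 'm set \<Rightarrow> 'm \<Rightarrow> (nat \<Rightarrow> 'm) set" where
  "seq_coset M N x = {\<lambda>_. y | y. y \<in> carrier M \<and> y \<ominus>\<^bsub>M\<^esub> x \<in> N}"

definition seq_quotient :: "('r, 'm) module \<Rightarrow> 'm set \<Rightarrow> ('r, (nat \<Rightarrow> 'm) set) module" where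
  "seq_quotient M N =
     (let \<rho> = (\<lambda>X. SOME x. x \<in> carrier M \<and> seq_coset M N x = X) in
      \<lparr>carrier = seq_coset M N ` carrier M, monoid.mult = (\<lambda>_ _. {}), monoid.one = {},
       ring.zero = seq_coset M N \<zero>\<^bsub>M\<^esub>,
       ring.add = (\<lambda>X Y. seq_coset M N (\<rho> X \<oplus>\<^bsub>M\<^esub> \<rho> Y)),
       smult = (\<lambda>r X. seq_coset M N (r \<odot>\<^bsub>M\<^esub> \<rho> X))\<rparr>)"

context left_module
begin

lemma seq_coset_eq_iff:
  assumes N: "Module.submodule N R M" and "x \<in> carrier M" "y \<in> carrier M"
  shows "seq_coset M N x = seq_coset M N y \<longleftrightarrow> x \<ominus> y \<in> N"
proof
  note D = left_submoduleD[OF N]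
  have diff: "a \<ominus> c \<in> N" if "a \<ominus> b \<in> N" "b \<ominus> c \<in> N" "a \<in> carrier M" "b \<in> carrier M" "c \<in> carrier M" for a b c
  proof -
    have "a \<ominus> c = (a \<ominus> b) \<oplus> (b \<ominus> c)"
      using that(3-5) by (simp add: a_minus_def M.a_ac M.r_neg2)
    then show ?thesis using D(3)[OF that(1,2)] by simp
  qed
  have sym: "b \<ominus> a \<in> N" if "a \<ominus> b \<in> N" "a \<in> carrier M" "b \<in> carrier M" for a b
  proof -
    have "b \<ominus> a = \<ominus> (a \<ominus> b)"
      using that(2,3) by (simp add: a_minus_def M.minus_add M.a_comm)
    then show ?thesis using D(5)[OF that(1)] by simp
  qed
  show "x \<ominus> y \<in> N" if "seq_coset M N x = seq_coset M N y"
  proof -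
    have "x \<ominus> x \<in> N" using assms(2) D(2) by (simp add: a_minus_def M.r_neg)
    then have "(\<lambda>_. x) \<in> seq_coset M N x" using assms(2) by (auto simp: seq_coset_def)
    then have "(\<lambda>_. x) \<in> seq_coset M N y" using that by simp
    then show ?thesis unfolding seq_coset_def by (auto dest: fun_cong)
  qed
  show "seq_coset M N x = seq_coset M N y" if "x \<ominus> y \<in> N"
    unfolding seq_coset_def using diff[of _ x y] diff[of _ y x] sym[of x y] that assms(2,3) by blast
qed

lemma seq_quotient:
  assumes N: "Module.submodule N R M"
  defines "\<pi> \<equiv> seq_coset M N"
  shows "\<pi> ` carrier M = carrier (seq_quotient M N)"
    and "\<zero>\<^bsub>seq_quotient M N\<^esub> = \<pi> \<zero>"
    and "\<And>x y. \<lbrakk>x \<in> carrier M; y \<in> carrier M\<rbrakk> \<Longrightarrow> \<pi> (x \<oplus> y) = \<pi> x \<oplus>\<^bsub>seq_quotient M N\<^esub> \<pi> y"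
    and "\<And>r x. \<lbrakk>r \<in> carrier R; x \<in> carrier M\<rbrakk> \<Longrightarrow> \<pi> (r \<odot> x) = r \<odot>\<^bsub>seq_quotient M N\<^esub> \<pi> x"
    and "\<And>x. x \<in> carrier M \<Longrightarrow> \<pi> x = \<zero>\<^bsub>seq_quotient M N\<^esub> \<longleftrightarrow> x \<in> N"
    and "left_module R (seq_quotient M N)"
proof -
  note D = left_submoduleD[OF N]
  note eq = seq_coset_eq_iff[OF N, folded \<pi>_def]
  \<comment> \<open>Any choice of representatives works: the chosen element differs from
    \<open>x\<close> by an element of \<open>N\<close>, and both operations respect such
    differences.\<close>
  define \<rho> where "\<rho> X = (SOME x. x \<in> carrier M \<and> \<pi> x = X)" for X
  have \<rho>: "\<rho> (\<pi> x) \<in> carrier M" "\<rho> (\<pi> x) \<ominus> x \<in> N" if "x \<in> carrier M" for x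
  proof -
    have "\<exists>y. y \<in> carrier M \<and> \<pi> y = \<pi> x" using that by blast
    from someI_ex[OF this] have *: "\<rho> (\<pi> x) \<in> carrier M" "\<pi> (\<rho> (\<pi> x)) = \<pi> x"
      unfolding \<rho>_def by blast+
    then show "\<rho> (\<pi> x) \<in> carrier M" "\<rho> (\<pi> x) \<ominus> x \<in> N" using eq that by blast+
  qed
  show 1: "\<pi> ` carrier M = carrier (seq_quotient M N)" and 2: "\<zero>\<^bsub>seq_quotient M N\<^esub> = \<pi> \<zero>"
    by (simp_all add: seq_quotient_def Let_def \<pi>_def)
  show 3: "\<pi> (x \<oplus> y) = \<pi> x \<oplus>\<^bsub>seq_quotient M N\<^esub> \<pi> y" if "x \<in> carrier M" "y \<in> carrier M" for x y
  proof -
    have "(\<rho> (\<pi> x) \<oplus> \<rho> (\<pi> y)) \<ominus> (x \<oplus> y) = (\<rho> (\<pi> x) \<ominus> x) \<oplus> (\<rho> (\<pi> y) \<ominus> y)"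
      using \<rho>(1) that by (simp add: a_minus_def M.minus_add M.a_ac)
    then have "(\<rho> (\<pi> x) \<oplus> \<rho> (\<pi> y)) \<ominus> (x \<oplus> y) \<in> N" using \<rho>(2) that D(3) by simp
    then have "\<pi> (\<rho> (\<pi> x) \<oplus> \<rho> (\<pi> y)) = \<pi> (x \<oplus> y)" using eq \<rho>(1) that by simp
    then show ?thesis
      unfolding \<rho>_def by (simp add: seq_quotient_def Let_def \<pi>_def)
  qed
  show 4: "\<pi> (r \<odot> x) = r \<odot>\<^bsub>seq_quotient M N\<^esub> \<pi> x" if "r \<in> carrier R" "x \<in> carrier M" for r x
  proof -
    have "r \<odot> \<ominus> x = \<ominus> (r \<odot> x)"
    proof -
      have "r \<odot> \<ominus> x \<oplus> r \<odot> x = \<zero>"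
        using that smult_r_distr[of r "\<ominus> x" x] by (simp add: M.l_neg)
      then show ?thesis using that smult_closed by (intro M.minus_equality[symmetric]) auto
    qed
    then have "r \<odot> \<rho> (\<pi> x) \<ominus> r \<odot> x = r \<odot> (\<rho> (\<pi> x) \<ominus> x)"
      using \<rho>(1) that by (simp add: a_minus_def smult_r_distr)
    then have "r \<odot> \<rho> (\<pi> x) \<ominus> r \<odot> x \<in> N" using \<rho>(2) that D(4) by simp
    then have "\<pi> (r \<odot> \<rho> (\<pi> x)) = \<pi> (r \<odot> x)" using eq \<rho>(1) that smult_closed by simp
    then show ?thesis
      unfolding \<rho>_def by (simp add: seq_quotient_def Let_def \<pi>_def)
  qed
  show "\<pi> x = \<zero>\<^bsub>seq_quotient M N\<^esub> \<longleftrightarrow> x \<in> N" if "x \<in> carrier M" for x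
    using eq[OF that M.zero_closed] that M.add.inv_one M.r_zero by (simp add: 2 a_minus_def a_inv_def)
  show "left_module R (seq_quotient M N)"
    by (rule left_module_image[OF left_module_axioms 1 3 2[symmetric] 4])
qed

end

section \<open>Tensor products\<close>

locale pair_setup = A: ring A + Q: cring Q
  for A :: "('k, 'a) module" (structure) and Q :: "'q ring"
begin

abbreviation F :: "('a \<times> 'q \<Rightarrow>\<^sub>0 int) ring" where
  "F \<equiv> pair_ring A Q"

abbreviation pairs :: "('a \<times> 'q) set" where
  "pairs \<equiv> carrier A \<times> carrier Q"

lemma F_carrier: "x \<in> carrier F \<longleftrightarrow> Poly_Mapping.keys x \<subseteq> pairs"
  by (simp add: pair_ring_def)

lemma F_simps [simp]: "(\<oplus>\<^bsub>F\<^esub>) = (+)" "\<zero>\<^bsub>F\<^esub> = 0" "\<one>\<^bsub>F\<^esub> = frag_of (\<one>, \<one>\<^bsub>Q\<^esub>)"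
  by (simp_all add: pair_ring_def)

lemma F_mult: "x \<otimes>\<^bsub>F\<^esub> y = frag_extend (\<lambda>(a, q). frag_extend (\<lambda>(a', q'). frag_of (a \<otimes> a', q \<otimes>\<^bsub>Q\<^esub> q')) y) x"
  by (simp add: pair_ring_def)

lemma F_mult_of [simp]: "frag_of (a, q) \<otimes>\<^bsub>F\<^esub> frag_of (b, p) = frag_of (a \<otimes> b, q \<otimes>\<^bsub>Q\<^esub> p)"
  by (simp add: F_mult)

lemma F_mult_zero [simp]: "0 \<otimes>\<^bsub>F\<^esub> y = 0" "x \<otimes>\<^bsub>F\<^esub> 0 = 0"
  by (auto simp: F_mult intro: frag_extend_eq_0)

lemma F_mult_diff_left: "(x - y) \<otimes>\<^bsub>F\<^esub> z = x \<otimes>\<^bsub>F\<^esub> z - y \<otimes>\<^bsub>F\<^esub> z"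
  by (simp add: F_mult frag_extend_diff)

text \<open>In the left factor additivity is that of the outer \<open>frag_extend\<close>. In the
  right factor it sits under this outer sum, so it is proved for a single pair on the left and
  extended by induction over \<open>x\<close>.\<close>

lemma F_mult_diff_right: "x \<otimes>\<^bsub>F\<^esub> (y - z) = x \<otimes>\<^bsub>F\<^esub> y - x \<otimes>\<^bsub>F\<^esub> z"
proof (induction x rule: frag_induction[OF subset_UNIV])
  case (2 p)
  then show ?case by (cases p) (simp add: F_mult frag_extend_diff)
next
  case (3 a b)
  then show ?case by (simp add: F_mult_diff_left)
qed simp

lemma F_mult_minus: "(- x) \<otimes>\<^bsub>F\<^esub> y = - (x \<otimes>\<^bsub>F\<^esub> y)" "x \<otimes>\<^bsub>F\<^esub> (- y) = - (x \<otimes>\<^bsub>F\<^esub> y)"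
  using F_mult_diff_left[of 0 x y] F_mult_diff_right[of x 0 y] by simp_all

lemma F_mult_add: "(x + y) \<otimes>\<^bsub>F\<^esub> z = x \<otimes>\<^bsub>F\<^esub> z + y \<otimes>\<^bsub>F\<^esub> z" "x \<otimes>\<^bsub>F\<^esub> (y + z) = x \<otimes>\<^bsub>F\<^esub> y + x \<otimes>\<^bsub>F\<^esub> z"
  using F_mult_diff_left[of x "- y" z] F_mult_diff_right[of x y "- z"] by (simp_all add: F_mult_minus)

lemma F_induct [consumes 1, case_names zero one diff]:
  assumes "x \<in> carrier F" "P 0" "\<And>a q. \<lbrakk>a \<in> carrier A; q \<in> carrier Q\<rbrakk> \<Longrightarrow> P (frag_of (a, q))"
    "\<And>x y. \<lbrakk>x \<in> carrier F; y \<in> carrier F; P x; P y\<rbrakk> \<Longrightarrow> P (x - y)"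
  shows "P x"
  using assms(1) unfolding F_carrier
  by (induction rule: free_Abelian_group_induct) (use assms in \<open>auto simp: F_carrier\<close>)

lemma F_closed: "0 \<in> carrier F" "\<lbrakk>a \<in> carrier A; q \<in> carrier Q\<rbrakk> \<Longrightarrow> frag_of (a, q) \<in> carrier F"
  "\<lbrakk>x \<in> carrier F; y \<in> carrier F\<rbrakk> \<Longrightarrow> x - y \<in> carrier F"
  "\<lbrakk>x \<in> carrier F; y \<in> carrier F\<rbrakk> \<Longrightarrow> x + y \<in> carrier F"
  "x \<in> carrier F \<Longrightarrow> - x \<in> carrier F"
  using keys_diff[of x y] keys_add[of x y] by (auto simp: F_carrier)

lemma F_mult_closed:
  assumes "x \<in> carrier F" "y \<in> carrier F"
  shows "x \<otimes>\<^bsub>F\<^esub> y \<in> carrier F"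
  using assms(1)
proof (induction rule: F_induct)
  case (one a q)
  from assms(2) show ?case
    by (induction rule: F_induct) (use one in \<open>auto simp: F_mult_diff_right intro: F_closed\<close>)
qed (auto simp: F_mult_diff_left intro: F_closed)

lemma F_mult_assoc:
  assumes "x \<in> carrier F" "y \<in> carrier F" "z \<in> carrier F"
  shows "(x \<otimes>\<^bsub>F\<^esub> y) \<otimes>\<^bsub>F\<^esub> z = x \<otimes>\<^bsub>F\<^esub> (y \<otimes>\<^bsub>F\<^esub> z)"
  using assms(1)
proof (induction rule: F_induct)
  case one1: (one a q)
  from assms(2) show ?case
  proof (induction rule: F_induct)
    case one2: (one b p)
    from assms(3) show ?case
      by (induction rule: F_induct)
        (use one1 one2 in \<open>auto simp: F_mult_diff_right A.m_assoc Q.m_assoc\<close>)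
  qed (auto simp: F_mult_diff_left F_mult_diff_right)
qed (auto simp: F_mult_diff_left)

text \<open>This is the integral monoid ring of the product of the multiplicative monoids of
  \<open>A\<close> and \<open>Q\<close>; the laws are inherited from pairs.\<close>

lemma F_ring: "ring F"
proof (rule ringI)
  show "abelian_group F"
    by (rule abelian_groupI)
      (auto intro: F_closed bexI[of _ "- x" for x])
  show "Group.monoid F"
  proof (rule monoidI)
    fix x assume x: "x \<in> carrier F"
    then show "\<one>\<^bsub>F\<^esub> \<otimes>\<^bsub>F\<^esub> x = x"
      by (induction rule: F_induct) (auto simp: F_mult_diff_right)
    show "x \<otimes>\<^bsub>F\<^esub> \<one>\<^bsub>F\<^esub> = x"
      using x by (induction rule: F_induct) (auto simp: F_mult_diff_left)
  qed (auto intro: F_mult_closed F_closed F_mult_assoc)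
qed (auto simp: F_mult_add)

end

text \<open>Serves both tensor products, over \<open>K\<close> and over \<open>C\<close>. The last
  two conditions say that the actions of \<open>S\<close> commute with left multiplication, hence
  that the relations form a left ideal of the pair ring.\<close>

locale balanced_relations = pair_setup A Q
  for A :: "('k, 'a) module" (structure) and Q :: "'q ring" +
  fixes S :: "'s set" and ract :: "'a \<Rightarrow> 's \<Rightarrow> 'a" and lact :: "'s \<Rightarrow> 'q \<Rightarrow> 'q"
  assumes ract_closed: "\<lbrakk>a \<in> carrier A; s \<in> S\<rbrakk> \<Longrightarrow> ract a s \<in> carrier A"
    and lact_closed: "\<lbrakk>q \<in> carrier Q; s \<in> S\<rbrakk> \<Longrightarrow> lact s q \<in> carrier Q"
    and ract_mult: "\<lbrakk>a \<in> carrier A; b \<in> carrier A; s \<in> S\<rbrakk> \<Longrightarrow> b \<otimes> ract a s = ract (b \<otimes> a) s"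
    and lact_mult: "\<lbrakk>p \<in> carrier Q; q \<in> carrier Q; s \<in> S\<rbrakk> \<Longrightarrow> p \<otimes>\<^bsub>Q\<^esub> lact s q = lact s (p \<otimes>\<^bsub>Q\<^esub> q)"
begin

abbreviation J where "J \<equiv> tensor_relations A Q S ract lact"

definition relators :: "('a \<times> 'q \<Rightarrow>\<^sub>0 int) set" where
  "relators = {frag_of (a \<oplus> a', q) - frag_of (a, q) - frag_of (a', q) | a a' q.
           a \<in> carrier A \<and> a' \<in> carrier A \<and> q \<in> carrier Q} \<union>
        {frag_of (a, q \<oplus>\<^bsub>Q\<^esub> q') - frag_of (a, q) - frag_of (a, q') | a q q'.
           a \<in> carrier A \<and> q \<in> carrier Q \<and> q' \<in> carrier Q} \<union>
        {frag_of (ract a s, q) - frag_of (a, lact s q) | a s q.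
           a \<in> carrier A \<and> s \<in> S \<and> q \<in> carrier Q}"

lemma J_eq_generate: "J = generate (free_Abelian_group pairs) relators"
  by (simp only: tensor_relations_def relators_def)

lemma J_add_left: "\<lbrakk>a \<in> carrier A; a' \<in> carrier A; q \<in> carrier Q\<rbrakk> \<Longrightarrow>
    frag_of (a \<oplus> a', q) - frag_of (a, q) - frag_of (a', q) \<in> J"
  unfolding J_eq_generate relators_def by (rule generate.incl) blast

lemma J_add_right: "\<lbrakk>a \<in> carrier A; q \<in> carrier Q; q' \<in> carrier Q\<rbrakk> \<Longrightarrow>
    frag_of (a, q \<oplus>\<^bsub>Q\<^esub> q') - frag_of (a, q) - frag_of (a, q') \<in> J"
  unfolding J_eq_generate relators_def by (rule generate.incl) blast

lemma J_balanced: "\<lbrakk>a \<in> carrier A; s \<in> S; q \<in> carrier Q\<rbrakk> \<Longrightarrow>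
    frag_of (ract a s, q) - frag_of (a, lact s q) \<in> J"
  unfolding J_eq_generate relators_def by (rule generate.incl) blast

lemma J_induct [consumes 1, case_names zero add_left add_right balanced minus add]:
  assumes "x \<in> J" and "P 0"
    and left: "\<And>a a' q. \<lbrakk>a \<in> carrier A; a' \<in> carrier A; q \<in> carrier Q\<rbrakk> \<Longrightarrow>
      P (frag_of (a \<oplus> a', q) - frag_of (a, q) - frag_of (a', q))"
    and right: "\<And>a q q'. \<lbrakk>a \<in> carrier A; q \<in> carrier Q; q' \<in> carrier Q\<rbrakk> \<Longrightarrow>
      P (frag_of (a, q \<oplus>\<^bsub>Q\<^esub> q') - frag_of (a, q) - frag_of (a, q'))"
    and bal: "\<And>a s q. \<lbrakk>a \<in> carrier A; s \<in> S; q \<in> carrier Q\<rbrakk> \<Longrightarrow>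
      P (frag_of (ract a s, q) - frag_of (a, lact s q))"
    and minus: "\<And>x. x \<in> carrier F \<Longrightarrow> P x \<Longrightarrow> P (- x)"
    and add: "\<And>x y. \<lbrakk>x \<in> carrier F; y \<in> carrier F; P x; P y\<rbrakk> \<Longrightarrow> P (x + y)"
  shows "P x"
proof -
  have H: "P h \<and> h \<in> carrier F" if "h \<in> relators" for h
    using that left right bal unfolding relators_def
    by (auto intro!: F_closed(2,3) ract_closed lact_closed)
  have "P x \<and> x \<in> carrier F"
    using assms(1) unfolding J_eq_generate
  proof (induction rule: generate.induct)
    case one
    then show ?case using assms(2) F_closed(1) by simp
  next
    case (incl h)
    then show ?case by (rule H)
  next
    case (inv h)
    then have "Poly_Mapping.keys h \<subseteq> pairs" using H[OF inv] by (simp add: F_carrier)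
    then show ?case using H[OF inv] minus F_closed(5) by simp
  next
    case (eng h1 h2)
    then show ?case using add F_closed(4) by simp
  qed
  then show ?thesis ..
qed

lemma J_subset: "J \<subseteq> carrier F"
  by (rule subsetI, erule J_induct) (auto intro!: F_closed ract_closed lact_closed)

lemma J_subgroup: "subgroup J (free_Abelian_group pairs)"
proof -
  have "relators \<subseteq> J"
    unfolding J_eq_generate by (blast intro: generate.incl)
  then have "relators \<subseteq> carrier (free_Abelian_group pairs)"
    using J_subset F_carrier by auto
  then show ?thesis
    unfolding J_eq_generate by (rule group.generate_is_subgroup[OF group_free_Abelian_group])
qed

lemma J_closed: "0 \<in> J" "\<lbrakk>x \<in> J; y \<in> J\<rbrakk> \<Longrightarrow> x + y \<in> J" "x \<in> J \<Longrightarrow> - x \<in> J" "\<lbrakk>x \<in> J; y \<in> J\<rbrakk> \<Longrightarrow> x - y \<in> J"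
proof -
  show 1: "0 \<in> J" "\<And>x y. \<lbrakk>x \<in> J; y \<in> J\<rbrakk> \<Longrightarrow> x + y \<in> J"
    using subgroup.one_closed[OF J_subgroup] subgroup.m_closed[OF J_subgroup] by auto
  show 2: "- x \<in> J" if "x \<in> J" for x
    using subgroup.m_inv_closed[OF J_subgroup that] that J_subset F_carrier by auto
  show "\<lbrakk>x \<in> J; y \<in> J\<rbrakk> \<Longrightarrow> x - y \<in> J"
    using 1(2)[of x "- y"] 2[of y] by simp
qed

lemma J_mult_left:
  assumes "x \<in> carrier F" "j \<in> J"
  shows "x \<otimes>\<^bsub>F\<^esub> j \<in> J"
  using assms(1)
proof (induction rule: F_induct)
  case (one b p)
  from assms(2) show ?case
  proof (induction rule: J_induct)
    case (add_left a a' q)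
    then show ?case
      using one J_add_left[of "b \<otimes> a" "b \<otimes> a'" "p \<otimes>\<^bsub>Q\<^esub> q"] by (simp add: F_mult_diff_right A.r_distr)
  next
    case (add_right a q q')
    then show ?case
      using one J_add_right[of "b \<otimes> a" "p \<otimes>\<^bsub>Q\<^esub> q" "p \<otimes>\<^bsub>Q\<^esub> q'"] by (simp add: F_mult_diff_right Q.r_distr)
  next
    case (balanced a s q)
    then show ?case
      using one J_balanced[of "b \<otimes> a" s "p \<otimes>\<^bsub>Q\<^esub> q"]
      by (simp add: F_mult_diff_right ract_mult lact_mult)
  qed (auto simp: F_mult_minus F_mult_add intro: J_closed)
qed (auto simp: F_mult_diff_left intro: J_closed)

text \<open>The condition on \<open>ract\<close> makes the relations a two-sided ideal. It holds for
  scalars from \<open>K\<close>, which are central in \<open>A\<close>, but in general not for right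
  multiplication by \<open>C\<close>; this is why one quotient is an algebra and the other only a
  module.\<close>

lemma J_mult_right:
  assumes "x \<in> carrier F" "j \<in> J"
    and ract: "\<And>a b s. \<lbrakk>a \<in> carrier A; b \<in> carrier A; s \<in> S\<rbrakk> \<Longrightarrow> ract a s \<otimes> b = ract (a \<otimes> b) s"
  shows "j \<otimes>\<^bsub>F\<^esub> x \<in> J"
  using assms(1)
proof (induction rule: F_induct)
  case (one b p)
  from assms(2) show ?case
  proof (induction rule: J_induct)
    case (add_left a a' q)
    then show ?case
      using one J_add_left[of "a \<otimes> b" "a' \<otimes> b" "q \<otimes>\<^bsub>Q\<^esub> p"] by (simp add: F_mult_diff_left A.l_distr)
  next
    case (add_right a q q')
    then show ?case
      using one J_add_right[of "a \<otimes> b" "q \<otimes>\<^bsub>Q\<^esub> p" "q' \<otimes>\<^bsub>Q\<^esub> p"] by (simp add: F_mult_diff_left Q.l_distr)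
  next
    case (balanced a s q)
    have "lact s q \<otimes>\<^bsub>Q\<^esub> p = lact s (q \<otimes>\<^bsub>Q\<^esub> p)"
      using lact_mult[of p q s] lact_closed[of q s] balanced one Q.m_comm by metis
    then show ?case
      using one balanced J_balanced[of "a \<otimes> b" s "q \<otimes>\<^bsub>Q\<^esub> p"]
      by (simp add: F_mult_diff_left ract)
  qed (auto simp: F_mult_minus F_mult_add intro: J_closed)
qed (auto simp: F_mult_diff_right intro: J_closed)

lemma coset_eq_iff: "J +>\<^bsub>F\<^esub> x = J +>\<^bsub>F\<^esub> y \<longleftrightarrow> x - y \<in> J"
proof -
  have co: "J +>\<^bsub>F\<^esub> z = (\<lambda>j. j + z) ` J" for z
    by (auto simp: a_r_coset_def r_coset_def)
  show ?thesis
  proof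
    assume "J +>\<^bsub>F\<^esub> x = J +>\<^bsub>F\<^esub> y"
    moreover have "x \<in> J +>\<^bsub>F\<^esub> x" unfolding co using J_closed(1) by (intro image_eqI[of _ _ 0]) auto
    ultimately have "x \<in> J +>\<^bsub>F\<^esub> y" by simp
    then show "x - y \<in> J" unfolding co by auto
  next
    assume d: "x - y \<in> J"
    have "J +>\<^bsub>F\<^esub> x \<subseteq> J +>\<^bsub>F\<^esub> y" if "x - y \<in> J" for x y
    proof -
      have "j + x = (j + (x - y)) + y" for j by simp
      then show ?thesis unfolding co using J_closed(2)[OF _ that] by (metis (no_types, lifting) image_eqI image_subsetI)
    qed
    moreover have "y - x \<in> J" using J_closed(3)[OF d] by simp
    ultimately show "J +>\<^bsub>F\<^esub> x = J +>\<^bsub>F\<^esub> y" using d by (metis subset_antisym)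
  qed
qed

lemma mem_coset_iff: "z \<in> J +>\<^bsub>F\<^esub> x \<longleftrightarrow> z - x \<in> J"
proof -
  have "z \<in> (\<lambda>j. j + x) ` J \<longleftrightarrow> z - x \<in> J"
    by (auto intro!: image_eqI[of _ _ "z - x"])
  then show ?thesis by (auto simp: a_r_coset_def r_coset_def)
qed

lemma Quot_carrier: "carrier (F Quot J) = (\<lambda>x. J +>\<^bsub>F\<^esub> x) ` carrier F"
  by (auto simp: FactRing_def A_RCOSETS_def RCOSETS_def a_r_coset_def)

lemma Quot_zero: "\<zero>\<^bsub>F Quot J\<^esub> = J +>\<^bsub>F\<^esub> 0"
  by (auto simp: FactRing_def mem_coset_iff)

lemma Quot_add: "(J +>\<^bsub>F\<^esub> x) \<oplus>\<^bsub>F Quot J\<^esub> (J +>\<^bsub>F\<^esub> y) = J +>\<^bsub>F\<^esub> (x + y)"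
proof -
  have "z \<in> (J +>\<^bsub>F\<^esub> x) <+>\<^bsub>F\<^esub> (J +>\<^bsub>F\<^esub> y) \<longleftrightarrow> z \<in> J +>\<^bsub>F\<^esub> (x + y)" for z
  proof
    assume "z \<in> (J +>\<^bsub>F\<^esub> x) <+>\<^bsub>F\<^esub> (J +>\<^bsub>F\<^esub> y)"
    then obtain a b where ab: "a - x \<in> J" "b - y \<in> J" "z = a + b"
      by (auto simp: set_add_def set_mult_def mem_coset_iff)
    have "z - (x + y) = (a - x) + (b - y)" using ab(3) by simp
    then show "z \<in> J +>\<^bsub>F\<^esub> (x + y)" using J_closed(2)[OF ab(1,2)] unfolding mem_coset_iff by metis
  next
    assume "z \<in> J +>\<^bsub>F\<^esub> (x + y)"
    then have "z - y - x \<in> J" unfolding mem_coset_iff by (metis diff_diff_eq2 diff_diff_add add.commute)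
    then have "z - y \<in> J +>\<^bsub>F\<^esub> x" "y \<in> J +>\<^bsub>F\<^esub> y" "z = (z - y) + y"
      using J_closed(1) by (simp_all add: mem_coset_iff)
    then show "z \<in> (J +>\<^bsub>F\<^esub> x) <+>\<^bsub>F\<^esub> (J +>\<^bsub>F\<^esub> y)"
      unfolding set_add_def set_mult_def by fastforce
  qed
  then show ?thesis by (auto simp: FactRing_def)
qed

end

lemma ring_cong:
  assumes "ring R" "carrier R' = carrier R" "(\<otimes>\<^bsub>R'\<^esub>) = (\<otimes>\<^bsub>R\<^esub>)" "\<one>\<^bsub>R'\<^esub> = \<one>\<^bsub>R\<^esub>"
    "(\<oplus>\<^bsub>R'\<^esub>) = (\<oplus>\<^bsub>R\<^esub>)" "\<zero>\<^bsub>R'\<^esub> = \<zero>\<^bsub>R\<^esub>"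
  shows "ring R'"
proof -
  have "abelian_group R'"
    by (rule abelian_group_image[of R id]) (use assms in \<open>simp_all add: ring.is_abelian_group\<close>)
  then show ?thesis
    using assms unfolding ring_def Group.monoid_def ring_axioms_def by simp
qed

section \<open>The tensor algebra over K and its action on the tensor module over C\<close>

locale tensor_setup = fraction_setup K A C Q \<iota>
  for K :: "'k ring" and A :: "('k, 'a) module" (structure) and C :: "'a set"
    and Q :: "'q ring" and \<iota> :: "'a \<Rightarrow> 'q" +
  assumes domain: "noncomm_domain A"
    and subcring: "subcring C A"
begin

lemma C_comm: "\<lbrakk>c \<in> C; d \<in> C\<rbrakk> \<Longrightarrow> c \<otimes> d = d \<otimes> c"
  using subcring.sub_m_comm[OF subcring] by blast

sublocale pair_setup A Q ..

sublocale I: balanced_relations A Q "carrier K" "\<lambda>a k. k \<odot> a" "\<lambda>k q. \<iota> (k \<odot> \<one>) \<otimes>\<^bsub>Q\<^esub> q"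
  using \<iota>_hom(1) C_closed(6)
  by unfold_locales (auto simp: A.smult_mult_right Q.m_lcomm)

sublocale J: balanced_relations A Q C "\<lambda>a c. a \<otimes> c" "\<lambda>c q. \<iota> c \<otimes>\<^bsub>Q\<^esub> q"
  using \<iota>_hom(1) by unfold_locales (auto simp: A.A.m_assoc Q.m_lcomm)

abbreviation T where "T \<equiv> tensor_algebra K A Q \<iota>"
abbreviation M where "M \<equiv> tensor_module A C Q \<iota>"

definition cI :: "('a \<times> 'q \<Rightarrow>\<^sub>0 int) \<Rightarrow> ('a \<times> 'q \<Rightarrow>\<^sub>0 int) set" where "cI x = I.J +>\<^bsub>F\<^esub> x"
definition cJ :: "('a \<times> 'q \<Rightarrow>\<^sub>0 int) \<Rightarrow> ('a \<times> 'q \<Rightarrow>\<^sub>0 int) set" where "cJ x = J.J +>\<^bsub>F\<^esub> x"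

lemma cI_eq_iff: "cI x = cI y \<longleftrightarrow> x - y \<in> I.J"
  unfolding cI_def by (rule I.coset_eq_iff)

lemma cJ_eq_iff: "cJ x = cJ y \<longleftrightarrow> x - y \<in> J.J"
  unfolding cJ_def by (rule J.coset_eq_iff)

text \<open>Since \<open>k a = a (k 1)\<close> and \<open>k 1\<close> lies in \<open>C\<close>, a
  scalar crosses the tensor sign as an element of \<open>C\<close>.\<close>

lemma I_subset_J: "I.J \<subseteq> J.J"
proof
  fix x assume "x \<in> I.J"
  then show "x \<in> J.J"
  proof (induction rule: I.J_induct)
    case (balanced a k q)
    have "a \<otimes> (k \<odot> \<one>) = k \<odot> a"
      using balanced A.smult_mult_right[of k a "\<one>"] by simp
    then show ?case
      using J.J_balanced[of a "k \<odot> \<one>" q] balanced C_closed(6) by simp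
  qed (auto intro: J.J_closed J.J_add_left J.J_add_right)
qed

lemma I_mult_right: "\<lbrakk>x \<in> carrier F; i \<in> I.J\<rbrakk> \<Longrightarrow> i \<otimes>\<^bsub>F\<^esub> x \<in> I.J"
  by (rule I.J_mult_right) (auto simp: A.smult_mult_left)

text \<open>The unions in the definitions of product and action collapse to a single coset because
  \<open>a b - x y = (a - x) b + x (b - y)\<close>. The first summand uses that the relations over
  \<open>K\<close> form a right ideal contained in the relations over \<open>C\<close>, the second
  that both kinds form left ideals.\<close>

lemma mult_cosets:
  assumes "x \<in> carrier F" "y \<in> carrier F"
  shows "(\<Union>a\<in>cI x. \<Union>b\<in>cI y. I.J +>\<^bsub>F\<^esub> (a \<otimes>\<^bsub>F\<^esub> b)) = cI (x \<otimes>\<^bsub>F\<^esub> y)"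
    and "(\<Union>a\<in>cI x. \<Union>b\<in>cJ y. J.J +>\<^bsub>F\<^esub> (a \<otimes>\<^bsub>F\<^esub> b)) = cJ (x \<otimes>\<^bsub>F\<^esub> y)"
proof -
  have split: "a \<otimes>\<^bsub>F\<^esub> b - x \<otimes>\<^bsub>F\<^esub> y = (a - x) \<otimes>\<^bsub>F\<^esub> b + x \<otimes>\<^bsub>F\<^esub> (b - y)" for a b
    by (simp add: F_mult_diff_left F_mult_diff_right)
  have self: "x \<in> cI x" "y \<in> cI y" "y \<in> cJ y"
    using I.J_closed(1) J.J_closed(1) by (auto simp: cI_def cJ_def I.mem_coset_iff J.mem_coset_iff)
  have bF: "b \<in> carrier F" if "b - y \<in> carrier F" for b
    using F_closed(4)[OF that assms(2)] by simp
  have "I.J +>\<^bsub>F\<^esub> (a \<otimes>\<^bsub>F\<^esub> b) = cI (x \<otimes>\<^bsub>F\<^esub> y)" if "a \<in> cI x" "b \<in> cI y" for a b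
  proof -
    have ab: "a - x \<in> I.J" "b - y \<in> I.J"
      using that by (auto simp: cI_def I.mem_coset_iff)
    then have b: "b \<in> carrier F" using I.J_subset bF by blast
    show ?thesis
      unfolding cI_def I.coset_eq_iff split
      by (rule I.J_closed(2)[OF I_mult_right[OF b ab(1)] I.J_mult_left[OF assms(1) ab(2)]])
  qed
  then show "(\<Union>a\<in>cI x. \<Union>b\<in>cI y. I.J +>\<^bsub>F\<^esub> (a \<otimes>\<^bsub>F\<^esub> b)) = cI (x \<otimes>\<^bsub>F\<^esub> y)"
    using self by auto
  have "J.J +>\<^bsub>F\<^esub> (a \<otimes>\<^bsub>F\<^esub> b) = cJ (x \<otimes>\<^bsub>F\<^esub> y)" if "a \<in> cI x" "b \<in> cJ y" for a b
  proof -
    have ab: "a - x \<in> I.J" "b - y \<in> J.J"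
      using that by (auto simp: cI_def cJ_def I.mem_coset_iff J.mem_coset_iff)
    then have "b \<in> carrier F" using J.J_subset bF by blast
    then have "(a - x) \<otimes>\<^bsub>F\<^esub> b \<in> J.J" using I_mult_right ab I_subset_J by blast
    from J.J_closed(2)[OF this J.J_mult_left[OF assms(1) ab(2)]] show ?thesis
      unfolding cJ_def J.coset_eq_iff split .
  qed
  then show "(\<Union>a\<in>cI x. \<Union>b\<in>cJ y. J.J +>\<^bsub>F\<^esub> (a \<otimes>\<^bsub>F\<^esub> b)) = cJ (x \<otimes>\<^bsub>F\<^esub> y)"
    using self by auto
qed

lemma T_fields:
  "carrier T = carrier (F Quot I.J)" "(\<otimes>\<^bsub>T\<^esub>) = (\<otimes>\<^bsub>F Quot I.J\<^esub>)" "\<one>\<^bsub>T\<^esub> = \<one>\<^bsub>F Quot I.J\<^esub>"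
  "\<zero>\<^bsub>T\<^esub> = \<zero>\<^bsub>F Quot I.J\<^esub>" "(\<oplus>\<^bsub>T\<^esub>) = (\<oplus>\<^bsub>F Quot I.J\<^esub>)"
  "c \<odot>\<^bsub>T\<^esub> X = cI (frag_of (\<one>, c)) \<otimes>\<^bsub>T\<^esub> X"
  by (simp_all add: tensor_algebra_def relations_K_def Let_def cI_def)

lemma T_carrier: "carrier T = cI ` carrier F"
  by (simp add: T_fields I.Quot_carrier cI_def)

lemma T_add: "cI x \<oplus>\<^bsub>T\<^esub> cI y = cI (x + y)"
  by (simp add: T_fields I.Quot_add cI_def)

lemma T_zero: "\<zero>\<^bsub>T\<^esub> = cI 0"
  by (simp add: T_fields I.Quot_zero cI_def)

lemma T_mult: "\<lbrakk>x \<in> carrier F; y \<in> carrier F\<rbrakk> \<Longrightarrow> cI x \<otimes>\<^bsub>T\<^esub> cI y = cI (x \<otimes>\<^bsub>F\<^esub> y)"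
  using mult_cosets(1)[of x y] by (simp add: T_fields FactRing_def rcoset_mult_def)

lemma T_one: "\<one>\<^bsub>T\<^esub> = cI (frag_of (\<one>, \<one>\<^bsub>Q\<^esub>))"
  by (simp add: T_fields FactRing_def cI_def)

lemma T_smult: "\<lbrakk>c \<in> carrier Q; x \<in> carrier F\<rbrakk> \<Longrightarrow> c \<odot>\<^bsub>T\<^esub> cI x = cI (frag_of (\<one>, c) \<otimes>\<^bsub>F\<^esub> x)"
  by (simp add: T_fields(6) T_mult F_closed)

lemma M_fields:
  "carrier M = carrier (F Quot J.J)" "\<zero>\<^bsub>M\<^esub> = \<zero>\<^bsub>F Quot J.J\<^esub>" "(\<oplus>\<^bsub>M\<^esub>) = (\<oplus>\<^bsub>F Quot J.J\<^esub>)"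
  "X \<odot>\<^bsub>M\<^esub> Y = (\<Union>x\<in>X. \<Union>y\<in>Y. J.J +>\<^bsub>F\<^esub> (x \<otimes>\<^bsub>F\<^esub> y))"
  by (simp_all add: tensor_module_def relations_C_def Let_def)

lemma M_carrier: "carrier M = cJ ` carrier F"
  by (simp add: M_fields J.Quot_carrier cJ_def)

lemma M_add: "cJ x \<oplus>\<^bsub>M\<^esub> cJ y = cJ (x + y)"
  by (simp add: M_fields J.Quot_add cJ_def)

lemma M_zero: "\<zero>\<^bsub>M\<^esub> = cJ 0"
  by (simp add: M_fields J.Quot_zero cJ_def)

lemma M_smult: "\<lbrakk>x \<in> carrier F; y \<in> carrier F\<rbrakk> \<Longrightarrow> cI x \<odot>\<^bsub>M\<^esub> cJ y = cJ (x \<otimes>\<^bsub>F\<^esub> y)"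
  using mult_cosets(2)[of x y] by (simp add: M_fields)

lemma F_abelian: "abelian_group F"
  using F_ring by (simp add: ring_def)

lemma T_ring: "ring T"
proof -
  have "add_monoid F = free_Abelian_group pairs"
    by (simp add: pair_ring_def free_Abelian_group_def)
  then have "ideal I.J F"
    using I.J_subgroup I.J_mult_left I_mult_right by (intro idealI[OF F_ring]) auto
  then have "ring (F Quot I.J)" by (rule ideal.quotient_is_ring)
  then show ?thesis by (rule ring_cong) (simp_all add: T_fields)
qed

lemma scalar_central: "\<lbrakk>x \<in> carrier F; c \<in> carrier Q\<rbrakk> \<Longrightarrow>
    x \<otimes>\<^bsub>F\<^esub> frag_of (\<one>, c) = frag_of (\<one>, c) \<otimes>\<^bsub>F\<^esub> x"
  by (induction rule: F_induct) (auto simp: F_mult_diff_left F_mult_diff_right Q.m_comm)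

lemma T_assoc_algebra: "assoc_algebra Q T"
proof -
  interpret T: ring T by (rule T_ring)
  have TE: "\<exists>x\<in>carrier F. X = cI x" if "X \<in> carrier T" for X
    using that T_carrier by blast
  have s: "frag_of (\<one>, c) \<in> carrier F" if "c \<in> carrier Q" for c
    using that by (simp add: F_closed)
  interpret F: ring F by (rule F_ring)
  have smc: "c \<odot>\<^bsub>T\<^esub> X \<in> carrier T" if "c \<in> carrier Q" "X \<in> carrier T" for c X
    using that s T_carrier by (auto simp: T_smult F_mult_closed)
  have vs: "vectorspace Q T"
  proof (rule vs_criteria)
    show "field Q" by (rule Q.field_axioms)
    show "\<forall>v\<in>carrier T. \<exists>neg_v\<in>carrier T. v \<oplus>\<^bsub>T\<^esub> neg_v = \<zero>\<^bsub>T\<^esub>"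
      using T.r_neg T.a_inv_closed by blast
    show "\<forall>c v. c \<in> carrier Q \<and> v \<in> carrier T \<longrightarrow> c \<odot>\<^bsub>T\<^esub> v \<in> carrier T"
      using smc by blast
    show "\<forall>a b v. a \<in> carrier Q \<and> b \<in> carrier Q \<and> v \<in> carrier T \<longrightarrow>
        (a \<otimes>\<^bsub>Q\<^esub> b) \<odot>\<^bsub>T\<^esub> v = a \<odot>\<^bsub>T\<^esub> (b \<odot>\<^bsub>T\<^esub> v)"
    proof clarify
      fix a b X assume *: "a \<in> carrier Q" "b \<in> carrier Q" "X \<in> carrier T"
      then obtain x where x: "x \<in> carrier F" "X = cI x" using TE by blast
      have "frag_of (\<one>, a \<otimes>\<^bsub>Q\<^esub> b) \<otimes>\<^bsub>F\<^esub> x = frag_of (\<one>, a) \<otimes>\<^bsub>F\<^esub> (frag_of (\<one>, b) \<otimes>\<^bsub>F\<^esub> x)"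
        using F_mult_assoc[OF s s x(1), of a b] * by simp
      then show "(a \<otimes>\<^bsub>Q\<^esub> b) \<odot>\<^bsub>T\<^esub> X = a \<odot>\<^bsub>T\<^esub> (b \<odot>\<^bsub>T\<^esub> X)"
        using * x s by (simp add: T_smult F_mult_closed)
    qed
    show "\<forall>a b v. a \<in> carrier Q \<and> b \<in> carrier Q \<and> v \<in> carrier T \<longrightarrow>
        (a \<oplus>\<^bsub>Q\<^esub> b) \<odot>\<^bsub>T\<^esub> v = a \<odot>\<^bsub>T\<^esub> v \<oplus>\<^bsub>T\<^esub> b \<odot>\<^bsub>T\<^esub> v"
    proof clarify
      fix a b X assume *: "a \<in> carrier Q" "b \<in> carrier Q" "X \<in> carrier T"
      then obtain x where x: "x \<in> carrier F" "X = cI x" using TE by blast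
      have "(frag_of (\<one>, a \<oplus>\<^bsub>Q\<^esub> b) - frag_of (\<one>, a) - frag_of (\<one>, b)) \<otimes>\<^bsub>F\<^esub> x \<in> I.J"
        using * by (intro I_mult_right x I.J_add_right) auto
      then have "cI (frag_of (\<one>, a \<oplus>\<^bsub>Q\<^esub> b) \<otimes>\<^bsub>F\<^esub> x)
          = cI (frag_of (\<one>, a) \<otimes>\<^bsub>F\<^esub> x + frag_of (\<one>, b) \<otimes>\<^bsub>F\<^esub> x)"
        by (simp add: cI_eq_iff F_mult_diff_left F_mult_add diff_diff_eq)
      then show "(a \<oplus>\<^bsub>Q\<^esub> b) \<odot>\<^bsub>T\<^esub> X = a \<odot>\<^bsub>T\<^esub> X \<oplus>\<^bsub>T\<^esub> b \<odot>\<^bsub>T\<^esub> X"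
        using * x by (simp add: T_smult T_add)
    qed
    show "\<forall>c v w. c \<in> carrier Q \<and> v \<in> carrier T \<and> w \<in> carrier T \<longrightarrow>
        c \<odot>\<^bsub>T\<^esub> (v \<oplus>\<^bsub>T\<^esub> w) = c \<odot>\<^bsub>T\<^esub> v \<oplus>\<^bsub>T\<^esub> c \<odot>\<^bsub>T\<^esub> w"
    proof clarify
      fix c X Y assume *: "c \<in> carrier Q" "X \<in> carrier T" "Y \<in> carrier T"
      then obtain x y where "x \<in> carrier F" "X = cI x" "y \<in> carrier F" "Y = cI y" using TE by blast
      then show "c \<odot>\<^bsub>T\<^esub> (X \<oplus>\<^bsub>T\<^esub> Y) = c \<odot>\<^bsub>T\<^esub> X \<oplus>\<^bsub>T\<^esub> c \<odot>\<^bsub>T\<^esub> Y"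
        using * by (simp add: T_smult T_add F_closed F_mult_add)
    qed
    show "\<forall>v\<in>carrier T. \<one>\<^bsub>Q\<^esub> \<odot>\<^bsub>T\<^esub> v = v"
    proof
      fix X assume "X \<in> carrier T"
      then obtain x where "x \<in> carrier F" "X = cI x" using TE by blast
      then show "\<one>\<^bsub>Q\<^esub> \<odot>\<^bsub>T\<^esub> X = X" using F.l_one[of x] by (simp add: T_smult)
    qed
  qed (auto simp: T.a_ac)
  show ?thesis
  proof (intro assoc_algebra.intro assoc_algebra_axioms.intro vs T_ring)
    fix c X Y assume *: "c \<in> carrier Q" "X \<in> carrier T" "Y \<in> carrier T"
    then obtain x y where xy: "x \<in> carrier F" "X = cI x" "y \<in> carrier F" "Y = cI y" using TE by blast
    show "c \<odot>\<^bsub>T\<^esub> X \<otimes>\<^bsub>T\<^esub> Y = c \<odot>\<^bsub>T\<^esub> (X \<otimes>\<^bsub>T\<^esub> Y)"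
      using xy * s by (simp add: T_smult T_mult F_mult_closed F_mult_assoc)
    have "x \<otimes>\<^bsub>F\<^esub> (frag_of (\<one>, c) \<otimes>\<^bsub>F\<^esub> y) = frag_of (\<one>, c) \<otimes>\<^bsub>F\<^esub> (x \<otimes>\<^bsub>F\<^esub> y)"
      using xy * s scalar_central[OF xy(1) *(1)] by (simp flip: F_mult_assoc)
    then show "X \<otimes>\<^bsub>T\<^esub> (c \<odot>\<^bsub>T\<^esub> Y) = c \<odot>\<^bsub>T\<^esub> (X \<otimes>\<^bsub>T\<^esub> Y)"
      using xy * s by (simp add: T_smult T_mult F_mult_closed)
  qed
qed

lemma M_left_module: "left_module T M"
proof -
  interpret T: ring T by (rule T_ring)
  interpret F: ring F by (rule F_ring)
  have TE: "\<exists>x\<in>carrier F. X = cI x" if "X \<in> carrier T" for X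
    using that T_carrier by blast
  have ME: "\<exists>x\<in>carrier F. X = cJ x" if "X \<in> carrier M" for X
    using that M_carrier by blast
  interpret M: abelian_group M
    by (rule abelian_group_image[OF F_abelian, of cJ]) (simp_all add: M_carrier M_add M_zero)
  show ?thesis
  proof (unfold_locales, goal_cases)
    case (1 a X)
    then show ?case using M_carrier T_carrier by (auto simp: M_smult F_mult_closed)
  next
    case (2 a b X)
    then obtain x y z where "x \<in> carrier F" "y \<in> carrier F" "z \<in> carrier F" "a = cI x" "b = cI y" "X = cJ z"
      using TE ME by metis
    then show ?case by (simp add: T_add M_smult M_add F_closed F_mult_add)
  next
    case (3 a X Y)
    then obtain x y z where "x \<in> carrier F" "y \<in> carrier F" "z \<in> carrier F" "a = cI x" "X = cJ y" "Y = cJ z"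
      using TE ME by metis
    then show ?case by (simp add: M_smult M_add F_closed F_mult_add)
  next
    case (4 a b X)
    then obtain x y z where "x \<in> carrier F" "y \<in> carrier F" "z \<in> carrier F" "a = cI x" "b = cI y" "X = cJ z"
      using TE ME by metis
    then show ?case by (simp add: T_mult M_smult F_mult_closed F_mult_assoc)
  next
    case (5 X)
    then obtain x where "x \<in> carrier F" "X = cJ x" using ME by metis
    then show ?case using F.l_one[of x] F.one_closed by (simp add: T_one M_smult)
  qed
qed

definition t :: "'a \<Rightarrow> 'q \<Rightarrow> ('a \<times> 'q \<Rightarrow>\<^sub>0 int) set" where
  "t a q = cI (frag_of (a, q))"

sublocale scalar_extension K A C Q \<iota> T t
proof (intro scalar_extension.intro scalar_extension_axioms.intro fraction_setup_axioms T_assoc_algebra)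
  interpret T: assoc_algebra Q T by (rule T_assoc_algebra)
  show t: "t a q \<in> carrier T" if "a \<in> carrier A" "q \<in> carrier Q" for a q
    using that F_closed(2) by (auto simp: t_def T_carrier)
  show "t (a \<oplus> b) q = t a q \<oplus>\<^bsub>T\<^esub> t b q" if "a \<in> carrier A" "b \<in> carrier A" "q \<in> carrier Q" for a b q
    using I.J_add_left[OF that] by (simp add: t_def T_add cI_eq_iff diff_diff_eq)
  show "t a p \<otimes>\<^bsub>T\<^esub> t b q = t (a \<otimes> b) (p \<otimes>\<^bsub>Q\<^esub> q)"
    if "a \<in> carrier A" "b \<in> carrier A" "p \<in> carrier Q" "q \<in> carrier Q" for a b p q
    using that by (simp add: t_def T_mult F_closed)
  show "t \<one> \<one>\<^bsub>Q\<^esub> = \<one>\<^bsub>T\<^esub>"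
    by (simp add: t_def T_one)
  show smult: "p \<odot>\<^bsub>T\<^esub> t a q = t a (p \<otimes>\<^bsub>Q\<^esub> q)" if "a \<in> carrier A" "p \<in> carrier Q" "q \<in> carrier Q" for a p q
    using that by (simp add: t_def T_smult F_closed)
  show "t (k \<odot> a) q = t a (\<iota> (k \<odot> \<one>) \<otimes>\<^bsub>Q\<^esub> q)"
    if "k \<in> carrier K" "a \<in> carrier A" "q \<in> carrier Q" for k a q
    using I.J_balanced[of a k q] that by (simp add: t_def cI_eq_iff)
  have cl: "(\<lambda>a. t a \<one>\<^bsub>Q\<^esub>) ` carrier A \<subseteq> carrier T" using t by auto
  note W = T.subspace_memD[OF T.span_is_subspace[OF cl]]
  have "cI x \<in> T.span ((\<lambda>a. t a \<one>\<^bsub>Q\<^esub>) ` carrier A)" if "x \<in> carrier F" for x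
    using that
  proof (induction rule: F_induct)
    case zero
    then show ?case using W(2) by (simp add: T_zero)
  next
    case (one a q)
    have "t a \<one>\<^bsub>Q\<^esub> \<in> T.span ((\<lambda>a. t a \<one>\<^bsub>Q\<^esub>) ` carrier A)"
      using T.in_own_span[OF cl] one by blast
    then have "q \<odot>\<^bsub>T\<^esub> t a \<one>\<^bsub>Q\<^esub> \<in> T.span ((\<lambda>a. t a \<one>\<^bsub>Q\<^esub>) ` carrier A)"
      using W(4) one by blast
    then show ?case using smult[of a q "\<one>\<^bsub>Q\<^esub>"] one by (simp add: t_def)
  next
    case (diff x y)
    have "(\<ominus>\<^bsub>Q\<^esub> \<one>\<^bsub>Q\<^esub>) \<odot>\<^bsub>T\<^esub> cI y \<in> T.span ((\<lambda>a. t a \<one>\<^bsub>Q\<^esub>) ` carrier A)"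
      using W(4) diff by simp
    moreover have "cI y \<in> carrier T" using diff T_carrier by blast
    then have "(\<ominus>\<^bsub>Q\<^esub> \<one>\<^bsub>Q\<^esub>) \<odot>\<^bsub>T\<^esub> cI y = \<ominus>\<^bsub>T\<^esub> cI y"
      by (rule T.smult_minus_1)
    moreover have "\<ominus>\<^bsub>T\<^esub> cI y = cI (- y)"
      using diff F_closed(5) T_carrier by (intro T.M.minus_equality) (auto simp: T_add T_zero)
    ultimately have "cI x \<oplus>\<^bsub>T\<^esub> cI (- y) \<in> T.span ((\<lambda>a. t a \<one>\<^bsub>Q\<^esub>) ` carrier A)"
      using W(3) diff by simp
    then show ?case by (simp add: T_add)
  qed
  then have "carrier T \<subseteq> T.span ((\<lambda>a. t a \<one>\<^bsub>Q\<^esub>) ` carrier A)"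
    unfolding T_carrier by blast
  then show "T.span ((\<lambda>a. t a \<one>\<^bsub>Q\<^esub>) ` carrier A) = carrier T"
    by (rule equalityI[OF W(1)])
qed

definition unit :: "('a \<times> 'q \<Rightarrow>\<^sub>0 int) set" where
  "unit = cJ (frag_of (\<one>, \<one>\<^bsub>Q\<^esub>))"

lemma unit_closed: "unit \<in> carrier M"
  by (auto simp: unit_def M_carrier F_closed)

lemma t_unit: "\<lbrakk>a \<in> carrier A; q \<in> carrier Q\<rbrakk> \<Longrightarrow> t a q \<odot>\<^bsub>M\<^esub> unit = cJ (frag_of (a, q))"
  by (simp add: t_def unit_def M_smult F_closed)

text \<open>Surjective images of the tensor module inherit the generator and the rule for moving
  \<open>C\<close> across the tensor sign. This is applied to the identity and to the quotient
  maps.\<close>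

lemma cyclic_image:
  assumes N: "left_module T N" and \<pi>: "\<pi> ` carrier M = carrier N"
    "\<And>r x. \<lbrakk>r \<in> carrier T; x \<in> carrier M\<rbrakk> \<Longrightarrow> \<pi> (r \<odot>\<^bsub>M\<^esub> x) = r \<odot>\<^bsub>N\<^esub> \<pi> x"
  shows "cyclic_module K A Q T C \<iota> t N (\<pi> unit)"
proof (intro cyclic_module.intro scalar_extension_axioms cyclic_module_axioms.intro algebra_module.intro
    T_assoc_algebra N domain)
  interpret N: left_module T N by fact
  interpret F: ring F by (rule F_ring)
  show e: "\<pi> unit \<in> carrier N" using \<pi>(1) unit_closed by blast
  show "module_generators T N {\<pi> unit}"
    unfolding module_generators_def
  proof (intro conjI allI impI)
    fix P assume P: "Module.submodule P T N \<and> {\<pi> unit} \<subseteq> P"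
    have D: "P \<subseteq> carrier N" "\<And>a x. \<lbrakk>a \<in> carrier T; x \<in> P\<rbrakk> \<Longrightarrow> a \<odot>\<^bsub>N\<^esub> x \<in> P"
      using N.left_submoduleD[of P] P by auto
    have "X \<in> P" if "X \<in> carrier N" for X
    proof -
      have "X \<in> \<pi> ` cJ ` carrier F"
        using that unfolding \<pi>(1)[symmetric] M_carrier .
      then obtain x where x: "x \<in> carrier F" "X = \<pi> (cJ x)" by blast
      have "cJ x = cI x \<odot>\<^bsub>M\<^esub> unit"
        using x(1) F.r_one[of x] F.one_closed by (simp add: unit_def M_smult)
      moreover have "cI x \<in> carrier T" using x(1) T_carrier by blast
      ultimately show ?thesis using x(2) \<pi>(2)[OF _ unit_closed] D(2) P by simp
    qed
    then show "P = carrier N" using D(1) by blast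
  qed (use e in simp)
  show "t (a \<otimes> c) \<one>\<^bsub>Q\<^esub> \<odot>\<^bsub>N\<^esub> \<pi> unit = t a (\<iota> c) \<odot>\<^bsub>N\<^esub> \<pi> unit" if "a \<in> carrier A" "c \<in> C" for a c
  proof -
    have "t (a \<otimes> c) \<one>\<^bsub>Q\<^esub> \<odot>\<^bsub>M\<^esub> unit = t a (\<iota> c) \<odot>\<^bsub>M\<^esub> unit"
      using that \<iota>_hom(1)[of c] J.J_balanced[of a c "\<one>\<^bsub>Q\<^esub>"]
      by (simp add: t_unit cJ_eq_iff)
    then show ?thesis
      using \<pi>(2)[OF _ unit_closed, symmetric] that \<iota>_hom(1) by simp
  qed
qed

end

section \<open>Common denominators in the tensor module\<close>

context tensor_setup
begin

lemma C_mult_nonzero: "\<lbrakk>c \<in> C; d \<in> C; c \<noteq> \<zero>; d \<noteq> \<zero>\<rbrakk> \<Longrightarrow> c \<otimes> d \<noteq> \<zero>"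
  using domain C_in_A unfolding noncomm_domain_def by meson

lemma inv_\<iota>:
  assumes "d \<in> C" "d \<noteq> \<zero>"
  shows "inv\<^bsub>Q\<^esub> \<iota> d \<in> carrier Q" "\<iota> d \<otimes>\<^bsub>Q\<^esub> inv\<^bsub>Q\<^esub> \<iota> d = \<one>\<^bsub>Q\<^esub>"
proof -
  have "\<iota> d \<in> Units Q"
    using \<iota>_hom(1)[OF assms(1)] \<iota>_zeroD[OF assms(1)] assms(2) Q.field_Units by blast
  then show "inv\<^bsub>Q\<^esub> \<iota> d \<in> carrier Q" "\<iota> d \<otimes>\<^bsub>Q\<^esub> inv\<^bsub>Q\<^esub> \<iota> d = \<one>\<^bsub>Q\<^esub>"
    by auto
qed

lemma inv_\<iota>_mult:
  assumes "d \<in> C" "d \<noteq> \<zero>" "e \<in> C" "e \<noteq> \<zero>"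
  shows "\<iota> e \<otimes>\<^bsub>Q\<^esub> inv\<^bsub>Q\<^esub> \<iota> (d \<otimes> e) = inv\<^bsub>Q\<^esub> \<iota> d"
proof -
  let ?x = "inv\<^bsub>Q\<^esub> \<iota> (d \<otimes> e)"
  have de: "d \<otimes> e \<in> C" "d \<otimes> e \<noteq> \<zero>"
    using assms C_closed(4) C_mult_nonzero by auto
  note cl = \<iota>_hom(1)[OF assms(1)] \<iota>_hom(1)[OF assms(3)] inv_\<iota>(1)[OF de] inv_\<iota>(1)[OF assms(1,2)]
  have "\<iota> d \<otimes>\<^bsub>Q\<^esub> (\<iota> e \<otimes>\<^bsub>Q\<^esub> ?x) = \<one>\<^bsub>Q\<^esub>"
    using inv_\<iota>(2)[OF de] \<iota>_hom(2)[OF assms(1,3)] cl by (simp add: Q.m_assoc)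
  then show ?thesis
    using Q.comm_inv_char[of "\<iota> d" "\<iota> e \<otimes>\<^bsub>Q\<^esub> ?x"] cl by simp
qed

text \<open>For \<open>d \<noteq> 0\<close> this is the \<open>C\<close>-module of all fractions
  \<open>c / d\<close>. Every element of \<open>Q\<close> lies in one of them, and products of
  denominators make the family directed.\<close>

definition denom :: "'a \<Rightarrow> 'q set" where
  "denom d = {q \<in> carrier Q. \<exists>c\<in>C. \<iota> c = q \<otimes>\<^bsub>Q\<^esub> \<iota> d}"

definition num :: "'a \<Rightarrow> 'q \<Rightarrow> 'a" where
  "num d q = (THE c. c \<in> C \<and> \<iota> c = q \<otimes>\<^bsub>Q\<^esub> \<iota> d)"

lemma num_eqI: "\<lbrakk>c \<in> C; \<iota> c = q \<otimes>\<^bsub>Q\<^esub> \<iota> d\<rbrakk> \<Longrightarrow> num d q = c"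
  unfolding num_def by (rule the_equality) (auto intro: \<iota>_hom(5))

lemma num: "q \<in> denom d \<Longrightarrow> num d q \<in> C" "q \<in> denom d \<Longrightarrow> \<iota> (num d q) = q \<otimes>\<^bsub>Q\<^esub> \<iota> d"
  using num_eqI[of _ q d] by (auto simp: denom_def)

lemma denom_closed: "q \<in> denom d \<Longrightarrow> q \<in> carrier Q"
  by (simp add: denom_def)

lemma denomI: "\<lbrakk>q \<in> carrier Q; c \<in> C; \<iota> c = q \<otimes>\<^bsub>Q\<^esub> \<iota> d\<rbrakk> \<Longrightarrow> q \<in> denom d"
  by (auto simp: denom_def)

lemma denom_exists:
  assumes "q \<in> carrier Q"
  obtains d where "d \<in> C" "d \<noteq> \<zero>" "q \<in> denom d"
proof -
  obtain c d where cd: "c \<in> C" "d \<in> C" "d \<noteq> \<zero>" "q = \<iota> c \<otimes>\<^bsub>Q\<^esub> inv\<^bsub>Q\<^esub> \<iota> d"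
    using fractionE[OF assms] .
  have "inv\<^bsub>Q\<^esub> \<iota> d \<otimes>\<^bsub>Q\<^esub> \<iota> d = \<one>\<^bsub>Q\<^esub>"
    using inv_\<iota>[OF cd(2,3)] \<iota>_hom(1)[OF cd(2)] by (simp add: Q.m_comm)
  then have "\<iota> c = q \<otimes>\<^bsub>Q\<^esub> \<iota> d"
    using cd inv_\<iota>(1)[OF cd(2,3)] \<iota>_hom(1) by (simp add: Q.m_assoc)
  then show ?thesis using that cd denomI[OF assms] by blast
qed

lemma num_mult:
  assumes "q \<in> denom d" "d \<in> C" "e \<in> C"
  shows "q \<in> denom (d \<otimes> e)" "num (d \<otimes> e) q = num d q \<otimes> e"
proof -
  have *: "\<iota> (num d q \<otimes> e) = q \<otimes>\<^bsub>Q\<^esub> \<iota> (d \<otimes> e)"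
    using num[OF assms(1)] assms(2,3) denom_closed[OF assms(1)] \<iota>_hom(1) by (simp add: \<iota>_hom(2) Q.m_assoc)
  have cl: "num d q \<otimes> e \<in> C" using num(1)[OF assms(1)] assms(3) C_closed(4) by blast
  show "q \<in> denom (d \<otimes> e)" by (rule denomI[OF denom_closed[OF assms(1)] cl *])
  show "num (d \<otimes> e) q = num d q \<otimes> e" by (rule num_eqI[OF cl *])
qed

text \<open>The map \<open>\<Sum> a\<^sub>i \<otimes> q\<^sub>i \<mapsto> \<Sum> a\<^sub>i (q\<^sub>i d)\<close>, defined if \<open>d\<close> is a common denominator of the \<open>q\<^sub>i\<close>.\<close>

definition clear_denom :: "'a \<Rightarrow> ('a \<times> 'q \<Rightarrow>\<^sub>0 int) \<Rightarrow> 'a" where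
  "clear_denom d = (SOME f. f \<in> hom (free_Abelian_group (carrier A \<times> denom d)) (add_monoid A) \<and>
     (\<forall>a\<in>carrier A. \<forall>q\<in>denom d. f (frag_of (a, q)) = a \<otimes> num d q))"

lemma clear_denom_spec:
  "clear_denom d \<in> hom (free_Abelian_group (carrier A \<times> denom d)) (add_monoid A)"
  "\<lbrakk>a \<in> carrier A; q \<in> denom d\<rbrakk> \<Longrightarrow> clear_denom d (frag_of (a, q)) = a \<otimes> num d q"
proof -
  have "(\<lambda>(a, q). a \<otimes> num d q) ` (carrier A \<times> denom d) \<subseteq> carrier (add_monoid A)"
    using num(1) by auto
  then obtain f where f: "f \<in> hom (free_Abelian_group (carrier A \<times> denom d)) (add_monoid A)"
    "\<And>x. x \<in> carrier A \<times> denom d \<Longrightarrow> f (frag_of x) = (\<lambda>(a, q). a \<otimes> num d q) x"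
    using comm_group.free_Abelian_group_universal[OF A.M.a_comm_group] by blast
  then have "\<exists>f. f \<in> hom (free_Abelian_group (carrier A \<times> denom d)) (add_monoid A) \<and>
     (\<forall>a\<in>carrier A. \<forall>q\<in>denom d. f (frag_of (a, q)) = a \<otimes> num d q)"
    by (intro exI[of _ f]) auto
  from someI_ex[OF this] show "clear_denom d \<in> hom (free_Abelian_group (carrier A \<times> denom d)) (add_monoid A)"
    "\<lbrakk>a \<in> carrier A; q \<in> denom d\<rbrakk> \<Longrightarrow> clear_denom d (frag_of (a, q)) = a \<otimes> num d q"
    unfolding clear_denom_def by auto
qed

definition over :: "'a \<Rightarrow> ('a \<times> 'q \<Rightarrow>\<^sub>0 int) set" where
  "over d = {x. Poly_Mapping.keys x \<subseteq> carrier A \<times> denom d}"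

lemma over_closed: "0 \<in> over d" "\<lbrakk>a \<in> carrier A; q \<in> denom d\<rbrakk> \<Longrightarrow> frag_of (a, q) \<in> over d"
  "\<lbrakk>x \<in> over d; y \<in> over d\<rbrakk> \<Longrightarrow> x + y \<in> over d" "\<lbrakk>x \<in> over d; y \<in> over d\<rbrakk> \<Longrightarrow> x - y \<in> over d"
  "x \<in> over d \<Longrightarrow> - x \<in> over d"
  using keys_add[of x y] keys_diff[of x y] by (auto simp: over_def)

lemma clear_denom_add:
  "\<lbrakk>x \<in> over d; y \<in> over d\<rbrakk> \<Longrightarrow> clear_denom d (x + y) = clear_denom d x \<oplus> clear_denom d y"
  "x \<in> over d \<Longrightarrow> clear_denom d x \<in> carrier A"
  using hom_mult[OF clear_denom_spec(1), of x d y] hom_in_carrier[OF clear_denom_spec(1), of x d]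
  by (auto simp: over_def)

lemma clear_denom_zero: "clear_denom d 0 = \<zero>"
  using clear_denom_add(1)[of 0 d 0] clear_denom_add(2)[of 0 d] over_closed(1) by simp

lemma clear_denom_minus: "x \<in> over d \<Longrightarrow> clear_denom d (- x) = \<ominus> clear_denom d x"
  using clear_denom_add(1)[of "- x" d x] clear_denom_add(2)[of x d] clear_denom_add(2)[of "- x" d]
    over_closed(5)[of x d] clear_denom_zero by (intro A.M.minus_equality[symmetric]) auto

lemma clear_denom_diff:
  "\<lbrakk>x \<in> over d; y \<in> over d\<rbrakk> \<Longrightarrow> clear_denom d (x - y) = clear_denom d x \<ominus> clear_denom d y"
  using clear_denom_add(1)[of x d "- y"] clear_denom_minus[of y d] over_closed(5)[of y d] by (simp add: a_minus_def)

text \<open>Since enlarging the denominator only multiplies from the right, an element that has been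
  cleared to 0 stays 0 when denominators are made common.\<close>

lemma clear_denom_mult:
  assumes "x \<in> over d" "d \<in> C" "e \<in> C"
  shows "x \<in> over (d \<otimes> e) \<and> clear_denom (d \<otimes> e) x = clear_denom d x \<otimes> e"
proof -
  have "Poly_Mapping.keys x \<subseteq> carrier A \<times> denom d" using assms(1) by (simp add: over_def)
  then show ?thesis
  proof (induction rule: free_Abelian_group_induct[consumes 1, case_names zero diff one])
    case zero
    show ?case using over_closed(1) assms(3) by (simp add: clear_denom_zero)
  next
    case (diff x y)
    then have xy: "x \<in> over d" "y \<in> over d" by (simp_all add: over_def)
    show ?case
      using diff xy assms(3) by (simp add: over_closed(4) clear_denom_diff clear_denom_add(2) a_minus_def
          A.A.l_distr A.A.l_minus)
  next
    case (one p)
    then obtain a q where p: "p = (a, q)" "a \<in> carrier A" "q \<in> denom d" by auto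
    then show ?case
      using num_mult[OF p(3) assms(2,3)] assms(3) num(1)[OF p(3)]
      by (simp add: over_closed(2) clear_denom_spec(2) A.A.m_assoc)
  qed
qed

text \<open>There is no denominator common to all relations, so each has its own \<open>d\<close>,
  and a sum passes to the product of the denominators of its terms. Consequently an element that no
  denominator clears to 0 is nonzero in the tensor product.\<close>

lemma relations_C_killed:
  assumes "x \<in> J.J"
  shows "\<exists>d\<in>C. d \<noteq> \<zero> \<and> x \<in> over d \<and> clear_denom d x = \<zero>"
  using assms
proof (induction rule: J.J_induct)
  case zero
  have "\<one> \<noteq> \<zero>" using domain by (simp add: noncomm_domain_def)
  then show ?case using C_closed(2) over_closed(1) clear_denom_zero by blast
next
  case (add_left a a' q)
  obtain d where d: "d \<in> C" "d \<noteq> \<zero>" "q \<in> denom d"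
    using denom_exists[OF add_left(3)] .
  have "num d q \<in> carrier A" using num(1)[OF d(3)] by simp
  then show ?case
    using d add_left
    by (intro bexI[of _ d]) (auto simp: over_closed clear_denom_diff clear_denom_spec(2) A.A.l_distr a_minus_def
        A.M.a_ac A.M.r_neg A.M.r_neg1 A.M.r_neg2 A.M.minus_add)
next
  case (add_right a q q')
  obtain d where d: "d \<in> C" "d \<noteq> \<zero>" "q \<in> denom d"
    using denom_exists[OF add_right(2)] .
  obtain d' where d': "d' \<in> C" "d' \<noteq> \<zero>" "q' \<in> denom d'"
    using denom_exists[OF add_right(3)] .
  \<comment> \<open>Two fractions occur in this relation. Over the common denominator the numerator
    of their sum is the sum of their numerators.\<close>
  define e where "e = d \<otimes> d'"
  have e: "e \<in> C" "e \<noteq> \<zero>" using d d' C_closed(4) C_mult_nonzero by (auto simp: e_def)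
  have q: "q \<in> denom e" "q' \<in> denom e"
    using num_mult(1)[OF d(3,1) d'(1)] num_mult(1)[OF d'(3,1) d(1)] C_comm[OF d(1) d'(1)]
    by (simp_all add: e_def)
  have n: "num e q \<oplus> num e q' \<in> C" "\<iota> (num e q \<oplus> num e q') = (q \<oplus>\<^bsub>Q\<^esub> q') \<otimes>\<^bsub>Q\<^esub> \<iota> e"
    using num[OF q(1)] num[OF q(2)] C_closed(5) \<iota>_hom(1)[OF e(1)] add_right(2,3)
    by (simp_all add: \<iota>_hom(3) Q.l_distr)
  have qq: "q \<oplus>\<^bsub>Q\<^esub> q' \<in> denom e" using add_right(2,3) by (intro denomI[OF _ n]) simp
  have "num e q \<in> carrier A" "num e q' \<in> carrier A" using num(1) q by simp_all
  then show ?case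
    using e q qq add_right num_eqI[OF n]
    by (intro bexI[of _ e]) (auto simp: over_closed clear_denom_diff clear_denom_spec(2) A.A.r_distr a_minus_def
        A.M.a_ac A.M.r_neg A.M.r_neg1 A.M.r_neg2 A.M.minus_add)
next
  case (balanced a s q)
  obtain d where d: "d \<in> C" "d \<noteq> \<zero>" "q \<in> denom d"
    using denom_exists[OF balanced(3)] .
  have n: "s \<otimes> num d q \<in> C" "\<iota> (s \<otimes> num d q) = (\<iota> s \<otimes>\<^bsub>Q\<^esub> q) \<otimes>\<^bsub>Q\<^esub> \<iota> d"
    using num[OF d(3)] balanced d(1) C_closed(4) \<iota>_hom(1) by (simp_all add: \<iota>_hom(2) Q.m_assoc)
  have sq: "\<iota> s \<otimes>\<^bsub>Q\<^esub> q \<in> denom d"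
    using balanced \<iota>_hom(1) by (intro denomI[OF _ n]) simp
  have "num d q \<in> carrier A" using num(1)[OF d(3)] by simp
  then show ?case
    using d sq balanced num_eqI[OF n]
    by (intro bexI[of _ d]) (auto simp: over_closed clear_denom_diff clear_denom_spec(2) A.A.m_assoc a_minus_def
        A.M.r_neg)
next
  case (minus x)
  then show ?case using over_closed(5) by (auto simp: clear_denom_minus)
next
  case (add x y)
  then obtain d e where d: "d \<in> C" "d \<noteq> \<zero>" "x \<in> over d" "clear_denom d x = \<zero>"
    and e: "e \<in> C" "e \<noteq> \<zero>" "y \<in> over e" "clear_denom e y = \<zero>" by blast
  have x: "x \<in> over (d \<otimes> e)" "clear_denom (d \<otimes> e) x = \<zero>"
    using clear_denom_mult[OF d(3,1) e(1)] d(4) e(1) by simp_all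
  have y: "y \<in> over (d \<otimes> e)" "clear_denom (d \<otimes> e) y = \<zero>"
    using clear_denom_mult[OF e(3,1) d(1)] e(4) d(1) C_comm[OF d(1) e(1)] by simp_all
  show ?case
    using x y C_mult_nonzero[OF d(1) e(1) d(2) e(2)] C_closed(4)[OF d(1) e(1)]
    by (intro bexI[of _ "d \<otimes> e"]) (simp_all add: over_closed(3) clear_denom_add(1))
qed

text \<open>Clearing a denominator \<open>d\<close> sends \<open>1 \<otimes> 1\<close> to
  \<open>d\<close>, which is nonzero.\<close>

lemma unit_nonzero: "unit \<noteq> \<zero>\<^bsub>M\<^esub>"
proof
  assume "unit = \<zero>\<^bsub>M\<^esub>"
  then have "frag_of (\<one>, \<one>\<^bsub>Q\<^esub>) \<in> J.J"
    by (simp add: unit_def M_zero cJ_eq_iff)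
  then obtain d where d: "d \<in> C" "d \<noteq> \<zero>" "clear_denom d (frag_of (\<one>, \<one>\<^bsub>Q\<^esub>)) = \<zero>"
    using relations_C_killed by blast
  have *: "\<iota> d = \<one>\<^bsub>Q\<^esub> \<otimes>\<^bsub>Q\<^esub> \<iota> d" using \<iota>_hom(1)[OF d(1)] by simp
  have "\<one>\<^bsub>Q\<^esub> \<in> denom d" using denomI[OF _ d(1) *] by simp
  then show False
    using d clear_denom_spec(2)[of "\<one>" "\<one>\<^bsub>Q\<^esub>" d] num_eqI[OF d(1) *] by simp
qed

lemma frag_zero: "q \<in> carrier Q \<Longrightarrow> cJ (frag_of (\<zero>, q)) = \<zero>\<^bsub>M\<^esub>"
  using J.J_closed(3)[OF J.J_add_left[of "\<zero>" "\<zero>" q]] by (simp add: M_zero cJ_eq_iff)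

lemma frag_balanced: "\<lbrakk>a \<in> carrier A; c \<in> C; q \<in> carrier Q\<rbrakk> \<Longrightarrow>
    cJ (frag_of (a \<otimes> c, q)) = cJ (frag_of (a, \<iota> c \<otimes>\<^bsub>Q\<^esub> q))"
  using J.J_balanced[of a c q] by (simp add: cJ_eq_iff)

text \<open>Numerators move into \<open>A\<close>, and a difference is brought over a common
  denominator: \<open>a \<otimes> 1/d - b \<otimes> 1/e = (a e - b d) \<otimes> 1/(d e)\<close>.
  Commutativity of \<open>C\<close> makes the two ways of extending a denominator agree.\<close>

lemma M_single_fraction:
  assumes "X \<in> carrier M"
  obtains a d where "a \<in> carrier A" "d \<in> C" "d \<noteq> \<zero>" "X = cJ (frag_of (a, inv\<^bsub>Q\<^esub> \<iota> d))"
proof -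
  obtain x where x: "x \<in> carrier F" "X = cJ x"
    using assms unfolding M_carrier by blast
  have "\<exists>a\<in>carrier A. \<exists>d\<in>C. d \<noteq> \<zero> \<and> cJ x = cJ (frag_of (a, inv\<^bsub>Q\<^esub> \<iota> d))"
    using x(1)
  proof (induction rule: F_induct)
    case zero
    have "\<one> \<noteq> \<zero>" using domain by (simp add: noncomm_domain_def)
    then show ?case
      using frag_zero[OF inv_\<iota>(1)[OF C_closed(2)]] C_closed(2)
      by (intro bexI[of _ "\<zero>"] bexI[of _ "\<one>"]) (simp_all add: M_zero)
  next
    case (one a q)
    obtain c d where cd: "c \<in> C" "d \<in> C" "d \<noteq> \<zero>" "q = \<iota> c \<otimes>\<^bsub>Q\<^esub> inv\<^bsub>Q\<^esub> \<iota> d"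
      using fractionE[OF one(2)] .
    have "cJ (frag_of (a, q)) = cJ (frag_of (a \<otimes> c, inv\<^bsub>Q\<^esub> \<iota> d))"
      unfolding cd(4) by (rule frag_balanced[OF one(1) cd(1) inv_\<iota>(1)[OF cd(2,3)], symmetric])
    moreover have "a \<otimes> c \<in> carrier A" using one(1) cd(1) by simp
    ultimately show ?case using cd(2,3) by blast
  next
    case (diff x y)
    then obtain a d b e where a: "a \<in> carrier A" "d \<in> C" "d \<noteq> \<zero>" "cJ x = cJ (frag_of (a, inv\<^bsub>Q\<^esub> \<iota> d))"
      and b: "b \<in> carrier A" "e \<in> C" "e \<noteq> \<zero>" "cJ y = cJ (frag_of (b, inv\<^bsub>Q\<^esub> \<iota> e))"
      by blast
    define f where "f = d \<otimes> e"
    define r where "r = inv\<^bsub>Q\<^esub> \<iota> f"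
    have f: "f \<in> C" "f \<noteq> \<zero>" using a b C_closed(4) C_mult_nonzero by (auto simp: f_def)
    have r: "r \<in> carrier Q" using inv_\<iota>(1)[OF f] by (simp add: r_def)
    have "cJ x = cJ (frag_of (a \<otimes> e, r))"
      using frag_balanced[OF a(1) b(2) r] inv_\<iota>_mult[OF a(2,3) b(2,3)] a(4) by (simp add: r_def f_def)
    moreover have "cJ y = cJ (frag_of (b \<otimes> d, r))"
      using frag_balanced[OF b(1) a(2) r] inv_\<iota>_mult[OF b(2,3) a(2,3)] b(4) C_comm[OF a(2) b(2)]
      by (simp add: r_def f_def)
    ultimately have "x - frag_of (a \<otimes> e, r) \<in> J.J" "y - frag_of (b \<otimes> d, r) \<in> J.J"
      by (simp_all add: cJ_eq_iff)
    note 1 = J.J_closed(4)[OF this]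
    define g where "g = a \<otimes> e \<ominus> b \<otimes> d"
    have g: "g \<in> carrier A" "g \<oplus> b \<otimes> d = a \<otimes> e" "b \<otimes> d \<in> carrier A"
      using a b by (simp_all add: g_def a_minus_def A.M.a_assoc A.M.l_neg)
    have 2: "frag_of (a \<otimes> e, r) - frag_of (g, r) - frag_of (b \<otimes> d, r) \<in> J.J"
      using J.J_add_left[OF g(1,3) r] g(2) by simp
    have "x - y - frag_of (g, r) \<in> J.J"
      using J.J_closed(2)[OF 1 2] by (simp add: algebra_simps)
    then show ?case
      using g(1) f by (auto simp: cJ_eq_iff r_def)
  qed
  then show ?thesis using that x(2) by blast
qed

text \<open>A nonzero element \<open>a \<otimes> 1/d\<close> is multiplied by
  \<open>1 \<otimes> d\<close> to give \<open>a \<otimes> 1\<close>, and \<open>a\<close> is nonzero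
  because \<open>0 \<otimes> q\<close> vanishes. In the quotient by the submodule this produces a
  nonzero \<open>u\<close> with \<open>h u = 0\<close>, the situation of \<delta> = 1.\<close>

lemma submodule_meets_A:
  assumes "Module.submodule N T M" "N \<noteq> {\<zero>\<^bsub>M\<^esub>}"
  obtains u where "u \<in> carrier A" "u \<noteq> \<zero>" "emb u \<odot>\<^bsub>M\<^esub> unit \<in> N"
proof -
  interpret M: left_module T M by (rule M_left_module)
  note N = M.left_submoduleD[OF assms(1)]
  obtain X where X: "X \<in> N" "X \<noteq> \<zero>\<^bsub>M\<^esub>" using assms(2) N(2) by blast
  then obtain a d where a: "a \<in> carrier A" "d \<in> C" "d \<noteq> \<zero>" "X = cJ (frag_of (a, inv\<^bsub>Q\<^esub> \<iota> d))"
    using M_single_fraction N(1) by blast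
  have "a \<noteq> \<zero>"
    using a(4) X(2) frag_zero[OF inv_\<iota>(1)[OF a(2,3)]] by blast
  moreover have "t \<one> (\<iota> d) \<odot>\<^bsub>M\<^esub> X = emb a \<odot>\<^bsub>M\<^esub> unit"
    using a inv_\<iota>[OF a(2,3)] \<iota>_hom(1)[OF a(2)] by (simp add: t_def M_smult t_unit F_closed) (simp add: t_def[symmetric] t_unit)
  then have "emb a \<odot>\<^bsub>M\<^esub> unit \<in> N"
    using N(4)[of "t \<one> (\<iota> d)" X] X(1) \<iota>_hom(1)[OF a(2)] by simp
  ultimately show ?thesis using that a(1) by blast
qed

end

theorem theorem5p2:
  fixes K :: "'k ring" and A :: "('k, 'a) module" and C :: "'a set"
    and Q :: "'q ring" and \<iota> :: "'a \<Rightarrow> 'q"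
  assumes "field K"
    and "assoc_algebra K A"
    and "fg_algebra K A"
    and "noncomm_domain A"
    and "0 < GK_algebra K A" and "GK_algebra K A < \<infinity>"
    and "is_subalgebra K A C"
    and "subcring C A"
    and "fg_algebra K (A\<lparr>carrier := C\<rparr>)"
    and "field_of_fractions (A\<lparr>carrier := C\<rparr>) Q \<iota>"
    and "GK_algebra K A - GK_algebra K (A\<lparr>carrier := C\<rparr>)
           = holonomic_number Q (tensor_algebra K A Q \<iota>)"
  shows "simple_module (tensor_algebra K A Q \<iota>) (tensor_module A C Q \<iota>) \<and>
         holonomic Q (tensor_algebra K A Q \<iota>) (tensor_module A C Q \<iota>)"
proof -
  interpret tensor_setup K A C Q \<iota>
    by (intro tensor_setup.intro fraction_setup.intro fraction_setup_axioms.intro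
        tensor_setup_axioms.intro) fact+
  interpret C: assoc_algebra K "A\<lparr>carrier := C\<rparr>"
    by (rule A.subalgebra_assoc_algebra[OF assms(7)])
  interpret M: left_module T M by (rule M_left_module)
  define SC where "SC = chosen_generators K (A\<lparr>carrier := C\<rparr>)"
  have SC: "finite SC" "SC \<subseteq> C"
    using chosen_generatorsD[OF assms(9)] by (auto simp: SC_def algebra_generators_def)
  have one_C: "\<one>\<^bsub>A\<lparr>carrier := C\<rparr>\<^esub> \<noteq> \<zero>\<^bsub>A\<lparr>carrier := C\<rparr>\<^esub>" and SC': "SC \<subseteq> carrier (A\<lparr>carrier := C\<rparr>)"
    using assms(4) SC(2) by (simp_all add: noncomm_domain_def)
  have "cring (A\<lparr>carrier := C\<rparr>)"
    using A.A.subcring_iff[OF C_closed(1)] assms(8) by blast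
  then obtain n :: nat and c :: real where c: "0 < c"
    "\<And>i. c * real i ^ n \<le> real (subspace_dim K (A\<lparr>carrier := C\<rparr>) (C.filt SC i))"
    "growth_exponent (\<lambda>i. subspace_dim K (A\<lparr>carrier := C\<rparr>) (C.filt SC i)) \<le> ereal (real n)"
    using comm_algebra_growth[OF C.assoc_algebra_axioms _ one_C SC(1) SC'] by blast
  have GKC: "GK_algebra K (A\<lparr>carrier := C\<rparr>) \<le> ereal (real n)"
    using c(3) by (simp add: GK_algebra_def SC_def)
  have growth: "c * real i ^ n \<le> real (A.sdim (A.filt SC i))" for i
    using c(2)[of i] A.filt_subalgebra[OF assms(7) SC(2)] by (simp add: subspace_dim_def)
  obtain g where g: "GK_algebra K A = ereal g"
    using assms(5,6) by (cases "GK_algebra K A") auto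
  let ?h = "holonomic_number Q T"
  \<comment> \<open>The hypothesis on the holonomic number enters here: replacing GK(C) by the upper
    bound \<open>n\<close> turns the equality into a lower bound for \<open>?h\<close>.\<close>
  have h_ge: "ereal (g - real n) \<le> ?h"
    unfolding assms(11)[symmetric] g using GKC by (cases "GK_algebra K (A\<lparr>carrier := C\<rparr>)") auto
  have fgT: "fg_algebra Q T" by (rule fg_extension[OF assms(3)])
  have h_le: "?h \<le> GK_module Q T N"
    if "left_module T N" "fg_module T N" "carrier N \<noteq> {\<zero>\<^bsub>N\<^esub>}"
    for N :: "(('a \<times> 'q \<Rightarrow>\<^sub>0 int) set, (nat \<Rightarrow> ('a \<times> 'q \<Rightarrow>\<^sub>0 int) set) set) module"
    unfolding holonomic_number_def using that by (intro Inf_lower) blast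
  \<comment> \<open>The carrier of \<open>seq_quotient\<close> has the type over which the infimum
    runs, so every proper submodule yields a module to which both the lower bound \<open>?h\<close>
    and the upper bound for cyclic modules apply.\<close>
  have quotient: "?h \<le> GK_module Q T (seq_quotient M N)"
    and quotient_cyclic: "cyclic_module K A Q T C \<iota> t (seq_quotient M N) (seq_coset M N unit)"
    if N: "Module.submodule N T M" and ne: "N \<noteq> carrier M" for N
  proof -
    note S = M.seq_quotient[OF N]
    show cyc: "cyclic_module K A Q T C \<iota> t (seq_quotient M N) (seq_coset M N unit)"
      by (rule cyclic_image[OF S(6,1,4)])
    have "fg_module T (seq_quotient M N)"
      using cyclic_module.e_gen[OF cyc] unfolding fg_module_def by blast
    moreover have "carrier (seq_quotient M N) \<noteq> {\<zero>\<^bsub>seq_quotient M N\<^esub>}"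
    proof
      assume *: "carrier (seq_quotient M N) = {\<zero>\<^bsub>seq_quotient M N\<^esub>}"
      have "x \<in> N" if "x \<in> carrier M" for x
        using S(5)[OF that] S(1) * that by blast
      then show False using ne M.left_submoduleD(1)[OF N] by blast
    qed
    ultimately show "?h \<le> GK_module Q T (seq_quotient M N)" by (intro h_le S(6))
  qed
  have zero_sub: "Module.submodule {\<zero>\<^bsub>M\<^esub>} T M"
    by (rule M.left_submoduleI) auto
  have nonzero: "carrier M \<noteq> {\<zero>\<^bsub>M\<^esub>}"
    using unit_nonzero unit_closed by blast
  have simple: "simple_module T M"
    unfolding simple_module_def
  proof (intro conjI allI impI M_left_module nonzero)
    fix N assume N: "Module.submodule N T M"
    show "N = {\<zero>\<^bsub>M\<^esub>} \<or> N = carrier M"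
    proof (rule ccontr)
      assume "\<not> (N = {\<zero>\<^bsub>M\<^esub>} \<or> N = carrier M)"
      then have ne: "N \<noteq> {\<zero>\<^bsub>M\<^esub>}" "N \<noteq> carrier M" by auto
      note S = M.seq_quotient[OF N]
      interpret N: cyclic_module K A Q T C \<iota> t "seq_quotient M N" "seq_coset M N unit"
        by (rule quotient_cyclic[OF N ne(2)])
      obtain u where u: "u \<in> carrier A" "u \<noteq> \<zero>\<^bsub>A\<^esub>" "emb u \<odot>\<^bsub>M\<^esub> unit \<in> N"
        using submodule_meets_A[OF N ne(1)] .
      have "N.h u = seq_coset M N (emb u \<odot>\<^bsub>M\<^esub> unit)"
        unfolding N.h_def using S(4) u(1) unit_closed emb_closed by simp
      also have "\<dots> = \<zero>\<^bsub>seq_quotient M N\<^esub>"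
        using S(5) u(1,3) unit_closed emb_closed M.smult_closed by blast
      \<comment> \<open>With \<delta> = 1 the quotient has dimension at most
        \<open>g - n - 1\<close>, although \<open>g - n\<close> is a lower bound for it. Finiteness
        of \<open>g\<close> makes this a contradiction.\<close>
      finally have "GK_module Q T (seq_quotient M N) + ereal (real (n + 1)) \<le> ereal g"
        using N.GK_cyclic_le[OF assms(3) SC c(1) growth u(1), of 1] u(2) g by simp
      moreover have "ereal (g - real n) \<le> GK_module Q T (seq_quotient M N)"
        using h_ge quotient[OF N ne(2)] by (rule order_trans)
      ultimately show False
        by (cases "GK_module Q T (seq_quotient M N)") auto
    qed
  qed
  have cyc: "cyclic_module K A Q T C \<iota> t M unit"
    using cyclic_image[OF M_left_module, of id] by simp
  interpret M': cyclic_module K A Q T C \<iota> t M unit by (rule cyc)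
  have fg: "fg_module T M"
    using M'.e_gen unfolding fg_module_def by blast
  \<comment> \<open>The carrier of the tensor module has another type, so the infimum says nothing
    about it directly. Its quotient by 0 has the right type and is an image of it.\<close>
  note S = M.seq_quotient[OF zero_sub]
  have alg: "algebra_module Q T (seq_quotient M {\<zero>\<^bsub>M\<^esub>})"
    by (intro algebra_module.intro T_assoc_algebra S(6))
  have "?h \<le> GK_module Q T (seq_quotient M {\<zero>\<^bsub>M\<^esub>})"
    by (rule quotient[OF zero_sub nonzero[symmetric]])
  also have "\<dots> \<le> GK_module Q T M"
    by (rule GK_module_surj_le[OF M'.M.algebra_module_axioms alg fgT fg S(1)])
      (erule (1) S(3), erule (1) S(4))
  finally have "?h \<le> GK_module Q T M" .
  \<comment> \<open>The element 0 fills the place of \<open>u\<close>, since \<delta> = 0 asks only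
    for membership in \<open>A\<close>.\<close>
  moreover have "GK_module Q T M + ereal (real (n + 0)) \<le> ereal g"
    using M'.GK_cyclic_le[OF assms(3) SC c(1) growth A.zero_closed, of 0] g by simp
  then have "GK_module Q T M \<le> ereal (g - real n)"
    by (cases "GK_module Q T M") auto
  then have "GK_module Q T M \<le> ?h" using h_ge by (rule order_trans)
  ultimately have "GK_module Q T M = ?h" by (rule antisym[rotated])
  then show ?thesis
    using simple fg nonzero M_left_module unfolding holonomic_def by blast
qed

end
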